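(* Let $U$ be a nonempty open subset of $\mathbb{R}^d$, let $(x_n)_{n\ge1}$ be a sequence in $\mathbb{R}^d$ that is uniformly eutaxic in $U$, and let $\mathrm{r}=(r_n)_{n\ge1}$ be a nonincreasing sequence of positive reals. Let $F=\{x\in\mathbb{R}^d:|x-x_n|<r_n\text{ for infinitely many }n\ge1\}$. If $\sum_nr_n^d=\infty$, then $F$ has full Lebesgue measure in $U$. If $\sum_nr_n^d<\infty$, then $F$ is $\mathfrak{n}_{\mathrm{r}}$-describable in $U$, where $\mathfrak{n}_{\mathrm{r}}$ is the Borel measure on $(0,1]$ given by $\mathfrak{n}_{\mathrm{r}}=\sum_{n:\,r_n\le1}\delta_{r_n}$ (so $\int f\,d\mathfrak{n}_{\mathrm r}=\sum_n f(r_n)$ for nonnegative measurable $f$ supported in $(0,1]$).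
   Context: $\mathrm{P}_d$ is the set of real sequences $(r_n)_{n\ge1}$ with $r_{n+1}\le r_n$, $r_n\to0$ and $\sum_nr_n^d=\infty$; $(x_n)$ is uniformly eutaxic in $U$ if for every $(r_n)\in\mathrm{P}_d$, $\mathcal{L}^d$-a.e. $x\in U$ satisfies $|x-x_n|<r_n$ for infinitely many $n$. Fix $d\ge1$ and a norm $|\cdot|$ on $\mathbb{R}^d$ (diameters are taken with respect to it); $\mathcal{L}^d$ is Lebesgue measure. A gauge function is a function $g:[0,\infty]\to[0,\infty]$ that is nondecreasing on a neighbourhood of $0$ and satisfies $\lim_{r\to0}g(r)=g(0)=0$, $g(\infty)=\infty$; $\mathfrak{G}$ denotes the set of gauge functions. $\mathcal{H}^g$ is the Hausdorff $g$-measure: $\mathcal{H}^g(E)=\lim_{\delta\downarrow0}\inf\{\sum_ng(\mathrm{diam}\,C_n):E\subseteq\bigcup_nC_n,\ \mathrm{diam}\,C_n\le\delta\}$. The $d$-normalization of $g$ is $g_d(r)=r^d\inf_{0<\rho\le r}g(\rho)/\rho^d$ for $r\in(0,\infty)$, $g_d(0)=0$, $g_d(\infty)=\infty$; $g$ is $d$-normalized if $g=g_d$ on a neighbourhood of $0$. Let $\ell_g=\liminf_{r\to0}g(r)/r^d$, $\mathfrak{G}^\infty=\{g\in\mathfrak{G}:\ell_g=\infty\}$, $\mathfrak{G}^*=\{g\in\mathfrak{G}:\ell_g\in(0,\infty]\}$. For $d$-normalized gauge functions $g,h$ write $h\prec g$ if $h(r)/g(r)$ increases monotonically to $\infty$ as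 $r\downarrow0$ (with the convention that $h\prec g$ for every $h$ if $g$ vanishes on a neighbourhood of $0$). Dyadic cubes are the sets $2^{-j}(k+[0,1)^d)$, $j\in\mathbb{Z}$, $k\in\mathbb{Z}^d$. For a $d$-normalized gauge function $h$, let $\varepsilon_h$ be the supremum of those $\varepsilon>0$ such that $h$ is nondecreasing on $[0,\varepsilon]$ and $r\mapsto h(r)/r^d$ is nonincreasing on $(0,\varepsilon]$, and let $\mathcal{M}^h_\infty(E)=\inf\sum_nh(\mathrm{diam}\,\lambda_n)$, the infimum over all countable coverings of $E$ by dyadic cubes $\lambda_n$ of diameter less than $\varepsilon_h$. For a gauge function $g$ and a nonempty open set $U\subseteq\mathbb{R}^d$, the large intersection class $G^g(U)$ is the collection of $G_\delta$ subsets $F\subseteq\mathbb{R}^d$ such that $\mathcal{M}^h_\infty(F\cap V)=\mathcal{M}^h_\infty(V)$ for every $d$-normalized gauge function $h$ with $h\prec g_d$ and every open $V\subseteq U$. Let $\mathcal{Z}(U)$ be the set of Borel sets $E$ with $\mathcal{L}^d(E\cap U)=0$; for such $E$, the majorizing collection is $\mathfrak{M}(E,U)=\{g\in\mathfrak{G}^\infty:\mathcal{H}^g(E\cap U)=0\}$ and the minorizing collection is $\mathfrak{m}(E,U)=\{g\in\mathfrak{G}^*:\exists F\in G^g(U),\ F\subseteq E\}$. Let $\mathcal{R}$ be the set of positive Borel measures $\mathfrak{n}$ on $(0,1]$ with infinite total mass and $\mathfrak{n}([\rho,1])<\infty$ for all $\rho\in(0,1]$, and $\mathcal{R}_d=\{\mathfrak{n}\in\mathcal{R}:\int_{(0,1]}r^d\,\mathfrak{n}(dr)<\infty\}$.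 For $\mathfrak{n}\in\mathcal{R}_d$, $\mathfrak{G}(\mathfrak{n})=\{g\in\mathfrak{G}^\infty:\int_{(0,1]}g_d\,d\mathfrak{n}=\infty\}$ and $\mathfrak{G}(\mathfrak{n})^\complement=\mathfrak{G}^\infty\setminus\mathfrak{G}(\mathfrak{n})$. A set $E$ is $\mathfrak{n}$-describable in $U$ if $E\in\mathcal{Z}(U)$, $\mathfrak{M}(E,U)=\mathfrak{G}(\mathfrak{n})^\complement$ and $\mathfrak{m}(E,U)\cap\mathfrak{G}^\infty=\mathfrak{G}(\mathfrak{n})$. For $\mathfrak{s}\in[0,d)$, $\mathfrak{G}(\mathfrak{s})$ is the set of $g\in\mathfrak{G}^\infty$ such that for every $s>\mathfrak{s}$, $g_d(r)$ is not $o(r^s)$ as $r\to0$; $E$ is $\mathfrak{s}$-describable in $U$ if $E\in\mathcal{Z}(U)$, $\mathfrak{M}(E,U)=\mathfrak{G}^\infty\setminus\mathfrak{G}(\mathfrak{s})$ and $\mathfrak{m}(E,U)\cap\mathfrak{G}^\infty=\mathfrak{G}(\mathfrak{s})$. *)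

theory Defs
  imports "HOL-Analysis.Analysis" "HOL-Library.Extended_Nonnegative_Real"
begin

definition is_norm :: "('a::euclidean_space \<Rightarrow> real) \<Rightarrow> bool" where
  "is_norm N \<longleftrightarrow> (\<forall>x y. N (x + y) \<le> N x + N y) \<and> (\<forall>c x. N (c *\<^sub>R x) = \<bar>c\<bar> * N x)
     \<and> (\<forall>x. N x = 0 \<longleftrightarrow> x = 0)"

(* diameter w.r.t. the norm N, in [0,\<infinity>]; diam {} = 0 *)
definition ediam :: "('a::euclidean_space \<Rightarrow> real) \<Rightarrow> 'a set \<Rightarrow> ennreal" where
  "ediam N C = (SUP p\<in>C \<times> C. ennreal (N (fst p - snd p)))"

definition Pd :: "nat \<Rightarrow> (nat \<Rightarrow> real) set" where
  "Pd d = {r. decseq r \<and> r \<longlonglongrightarrow> 0 \<and> \<not> summable (\<lambda>n. r n ^ d)}"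

definition uniformly_eutaxic :: "('a::euclidean_space \<Rightarrow> real) \<Rightarrow> 'a set \<Rightarrow> (nat \<Rightarrow> 'a) \<Rightarrow> bool" where
  "uniformly_eutaxic N U x \<longleftrightarrow>
     (\<forall>r\<in>Pd DIM('a). AE y in lborel. y \<in> U \<longrightarrow> infinite {n. N (y - x n) < r n})"

definition gauge :: "(ennreal \<Rightarrow> ennreal) \<Rightarrow> bool" where
  "gauge g \<longleftrightarrow> (\<exists>\<epsilon>>0. mono_on {0..\<epsilon>} g) \<and> (g \<longlongrightarrow> 0) (at 0) \<and> g 0 = 0 \<and> g top = top"

(* Hausdorff g-measure w.r.t. the norm N (limit as \<delta> decreases to 0 = supremum over \<delta> > 0) *)
definition hausdorff_g :: "('a::euclidean_space \<Rightarrow> real) \<Rightarrow> (ennreal \<Rightarrow> ennreal) \<Rightarrow> 'a set \<Rightarrow> ennreal" where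
  "hausdorff_g N g E = (SUP \<delta>\<in>{0::real<..}.
      INF C\<in>{C::nat \<Rightarrow> 'a set. E \<subseteq> (\<Union>n. C n) \<and> (\<forall>n. ediam N (C n) \<le> ennreal \<delta>)}.
        (\<Sum>n. g (ediam N (C n))))"

definition dnorm :: "nat \<Rightarrow> (ennreal \<Rightarrow> ennreal) \<Rightarrow> ennreal \<Rightarrow> ennreal" where
  "dnorm d g r = (if r = 0 then 0 else if r = top then top
                  else r ^ d * (INF \<rho>\<in>{0<..r}. g \<rho> / \<rho> ^ d))"

definition d_normalized :: "nat \<Rightarrow> (ennreal \<Rightarrow> ennreal) \<Rightarrow> bool" where
  "d_normalized d g \<longleftrightarrow> (\<forall>\<^sub>F r in nhds 0. g r = dnorm d g r)"

definition ell :: "nat \<Rightarrow> (ennreal \<Rightarrow> ennreal) \<Rightarrow> ennreal" where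
  "ell d g = Liminf (at 0) (\<lambda>r. g r / r ^ d)"

definition Gauges_inf :: "nat \<Rightarrow> (ennreal \<Rightarrow> ennreal) set" where
  "Gauges_inf d = {g. gauge g \<and> ell d g = top}"

definition Gauges_star :: "nat \<Rightarrow> (ennreal \<Rightarrow> ennreal) set" where
  "Gauges_star d = {g. gauge g \<and> ell d g > 0}"

definition gprec :: "(ennreal \<Rightarrow> ennreal) \<Rightarrow> (ennreal \<Rightarrow> ennreal) \<Rightarrow> bool" where
  "gprec h g \<longleftrightarrow> (\<exists>\<epsilon>>0. \<forall>r\<in>{0..<\<epsilon>}. g r = 0)
     \<or> ((\<exists>\<epsilon>>0. antimono_on {0<..\<epsilon>} (\<lambda>r. h r / g r)) \<and> ((\<lambda>r. h r / g r) \<longlongrightarrow> top) (at_right 0))"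

definition dyadic_cubes :: "'a::euclidean_space set set" where
  "dyadic_cubes = {{x. \<forall>i\<in>Basis. real_of_int (k i) \<le> 2 powr (real_of_int j) * (x \<bullet> i)
                                 \<and> 2 powr (real_of_int j) * (x \<bullet> i) < real_of_int (k i) + 1}
                   | (j::int) (k::'a \<Rightarrow> int). True}"

definition eps_h :: "nat \<Rightarrow> (ennreal \<Rightarrow> ennreal) \<Rightarrow> ennreal" where
  "eps_h d h = (SUP \<epsilon>\<in>{\<epsilon>::real. 0 < \<epsilon> \<and> mono_on {0..ennreal \<epsilon>} h
                      \<and> antimono_on {0<..ennreal \<epsilon>} (\<lambda>r. h r / r ^ d)}. ennreal \<epsilon>)"

definition M_inf :: "nat \<Rightarrow> ('a::euclidean_space \<Rightarrow> real) \<Rightarrow> (ennreal \<Rightarrow> ennreal) \<Rightarrow> 'a set \<Rightarrow> ennreal" where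
  "M_inf d N h E = (INF C\<in>{C. countable C \<and> C \<subseteq> dyadic_cubes \<and> (\<forall>c\<in>C. ediam N c < eps_h d h)
                            \<and> E \<subseteq> \<Union>C}.
                      (\<Sum>\<^sub>\<infinity>c\<in>C. h (ediam N c)))"

definition gdelta :: "'a::topological_space set \<Rightarrow> bool" where
  "gdelta F \<longleftrightarrow> (\<exists>A::nat \<Rightarrow> 'a set. (\<forall>n. open (A n)) \<and> F = (\<Inter>n. A n))"

definition large_int_class :: "('a::euclidean_space \<Rightarrow> real) \<Rightarrow> (ennreal \<Rightarrow> ennreal) \<Rightarrow> 'a set \<Rightarrow> 'a set set" where
  "large_int_class N g U = {F. gdelta F \<and>
     (\<forall>h. gauge h \<and> d_normalized DIM('a) h \<and> gprec h (dnorm DIM('a) g) \<longrightarrow>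
        (\<forall>V. open V \<and> V \<subseteq> U \<longrightarrow> M_inf DIM('a) N h (F \<inter> V) = M_inf DIM('a) N h V))}"

definition Zset :: "'a::euclidean_space set \<Rightarrow> 'a set set" where
  "Zset U = {E. E \<in> sets borel \<and> emeasure lborel (E \<inter> U) = 0}"

definition majorizing :: "('a::euclidean_space \<Rightarrow> real) \<Rightarrow> 'a set \<Rightarrow> 'a set \<Rightarrow> (ennreal \<Rightarrow> ennreal) set" where
  "majorizing N E U = {g \<in> Gauges_inf DIM('a). hausdorff_g N g (E \<inter> U) = 0}"

definition minorizing :: "('a::euclidean_space \<Rightarrow> real) \<Rightarrow> 'a set \<Rightarrow> 'a set \<Rightarrow> (ennreal \<Rightarrow> ennreal) set" where
  "minorizing N E U = {g \<in> Gauges_star DIM('a). \<exists>F\<in>large_int_class N g U. F \<subseteq> E}"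

(* measures on (0,1], modelled as Borel measures on the reals carried by (0,1] *)
definition Rd :: "nat \<Rightarrow> real measure \<Rightarrow> bool" where
  "Rd d n \<longleftrightarrow> sets n = sets borel \<and> emeasure n (- {0<..1}) = 0 \<and> emeasure n {0<..1} = top
      \<and> (\<forall>\<rho>\<in>{0<..1}. emeasure n {\<rho>..1} < top)
      \<and> (\<integral>\<^sup>+ t. indicator {0<..1} t * ennreal (t ^ d) \<partial>n) < top"

definition Gn :: "nat \<Rightarrow> real measure \<Rightarrow> (ennreal \<Rightarrow> ennreal) set" where
  "Gn d n = {g \<in> Gauges_inf d. (\<integral>\<^sup>+ t. indicator {0<..1} t * dnorm d g (ennreal t) \<partial>n) = top}"

definition describable :: "('a::euclidean_space \<Rightarrow> real) \<Rightarrow> real measure \<Rightarrow> 'a set \<Rightarrow> 'a set \<Rightarrow> bool" where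
  "describable N n E U \<longleftrightarrow> Rd DIM('a) n \<and> E \<in> Zset U
     \<and> majorizing N E U = Gauges_inf DIM('a) - Gn DIM('a) n
     \<and> minorizing N E U \<inter> Gauges_inf DIM('a) = Gn DIM('a) n"

(* n_r = sum over {n. r n \<le> 1} of Dirac masses at r n *)
definition nr :: "(nat \<Rightarrow> real) \<Rightarrow> real measure" where
  "nr r = distr (count_space {n. r n \<le> 1}) borel r"

end

(*
  Let F be the limsup set and M = M^h_infinity the net content.  Dyadic cubes of equal generation have
  equal diameter in the norm N, so a d-normalized gauge h enters only through its real profile
  phi(t) = h(t) near 0.

  If sum phi(r_n) = oo, then M(F Int L) >= c phi(diam L) for all small dyadic cubes L inside U, with c
  independent of L.  For the open sets A_m = UN n>=m. ball(x_n, r_n) this is a mass distribution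
  argument: eutaxy is applied to the enlarged radii R_n with
  R_n^d = (diam L)^d phi(r_n) / phi(diam L), a greedy selection gives disjoint balls ball(x_n, R_n)
  filling a fixed proportion of L, and the mass R_n^d is spread over ball(x_n, r_n).  A nested-cube
  argument passes from the A_m to their intersection F.  Finally c improves to 1: given a cover C of
  F Int V, the Whitney cubes of V of generation >= J that are not swallowed by C cost at most 1/c times
  the part of C of generation >= J, which tends to 0.

  Conversely, if sum g_d(r_n) < oo, then H^g(F) = 0 by covering each ball with cubes of the size that is
  nearly optimal in the definition of g_d; and some h = psi o g_d that precedes g_d still satisfies
  sum h(r_n) < oo, so that no subset of F belongs to the large intersection class.
*)
theory Submission
  imports Defs
begin

section \<open>Dyadic cubes and Whitney families\<close>

text \<open>Eutaxy speaks of Lebesgue measure only, so a content bound has to be bought by enlarging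
  the radii. As \<open>ell\<close> is infinite, phi(t) / t^d is unbounded and R_n is eventually at
  least 2 r_n; this gap forces a cube meeting two small balls to be at least as large as their
  radii. The factor (diam L)^d / phi(diam L) is the smallest a with t^d <= a phi(t) for all t <=
  diam L, which the packing bound on subcubes needs, and a constant factor does not affect
  divergence. The resulting c may depend neither on L nor on m, since the nested cubes shrink while
  m grows. It must finally become 1, because the class asks for equality of contents. The class of g
  tests only gauges h that dominate g_d near 0. Divergence for g_d therefore passes to every such h
  by comparison, whereas convergence for g_d says nothing about the class until a larger gauge with
  convergent sum has been built. Profiles are controlled only on (0, \<epsilon>], hence the sums
  over \<open>min (r n) \<epsilon>\<close>; when r_n tends to 0, this alters finitely many
  terms.\<close>

definition dcube :: "int \<Rightarrow> 'a::euclidean_space \<Rightarrow> 'a set" where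
  "dcube j y = {x. \<forall>i\<in>Basis. \<lfloor>2 powr of_int j * (x \<bullet> i)\<rfloor> = \<lfloor>2 powr of_int j * (y \<bullet> i)\<rfloor>}"

lemma dcube_refl [simp]: "y \<in> dcube j y"
  by (simp add: dcube_def)

text \<open>A cube is named by its generation and any one of its points, so two cubes of the same
  generation that share a point are equal, with no integer corners to compare.\<close>

lemma dcube_eqI: "x \<in> dcube j y \<Longrightarrow> dcube j x = dcube j y"
  by (auto simp: dcube_def)

lemma dyadic_cubes_eq: "dyadic_cubes = {dcube j y |j (y::'a::euclidean_space). True}"
proof -
  have 1: "{x. \<forall>i\<in>Basis. real_of_int (k i) \<le> 2 powr (real_of_int j) * (x \<bullet> i)
             \<and> 2 powr (real_of_int j) * (x \<bullet> i) < real_of_int (k i) + 1}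
         = dcube j (\<Sum>i\<in>Basis. (of_int (k i) / 2 powr (real_of_int j)) *\<^sub>R i :: 'a)" (is "?L = dcube j ?y")
    for j and k :: "'a \<Rightarrow> int"
  proof -
    have "\<lfloor>2 powr of_int j * (?y \<bullet> i)\<rfloor> = k i" if "i \<in> Basis" for i
      using that by simp
    then show ?thesis
      by (auto simp: dcube_def floor_eq_iff)
  qed
  have 2: "dcube j y = {x. \<forall>i\<in>Basis. real_of_int (\<lfloor>2 powr of_int j * (y \<bullet> i)\<rfloor>) \<le> 2 powr (real_of_int j) * (x \<bullet> i)
             \<and> 2 powr (real_of_int j) * (x \<bullet> i) < real_of_int (\<lfloor>2 powr of_int j * (y \<bullet> i)\<rfloor>) + 1}" for j and y :: 'a
    by (auto simp: dcube_def floor_eq_iff)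
  show ?thesis
    unfolding dyadic_cubes_def
  proof (intro equalityI subsetI)
    fix q :: "'a set"
    assume "q \<in> {dcube j y |j y. True}"
    then obtain j y where "q = dcube j y" by blast
    with 2[of j y]
    show "q \<in> {{x. \<forall>i\<in>Basis. real_of_int (k i) \<le> 2 powr (real_of_int j) * (x \<bullet> i)
             \<and> 2 powr (real_of_int j) * (x \<bullet> i) < real_of_int (k i) + 1} | (j::int) (k::'a \<Rightarrow> int). True}"
      by (intro CollectI exI[of _ j] exI[of _ "\<lambda>i. \<lfloor>2 powr of_int j * (y \<bullet> i)\<rfloor>"]) simp
  qed (use 1 in blast)
qed

lemma dcube_dyadic [simp]: "dcube j y \<in> dyadic_cubes"
  by (auto simp: dyadic_cubes_eq)

lemma dyadic_cubesE:
  assumes "q \<in> dyadic_cubes" obtains j y where "q = dcube j y"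
  using assms by (auto simp: dyadic_cubes_eq)

text \<open>The integer labels at generation j are those at generation k divided by 2^(k-j) with
  rounding down, so equal fine labels give equal coarse labels.\<close>

lemma dcube_antimono: "j \<le> k \<Longrightarrow> dcube k y \<subseteq> dcube j (y::'a::euclidean_space)"
proof -
  assume "j \<le> k"
  define n where "n = nat (k - j)"
  have *: "2 powr of_int j * t = (2 powr of_int k * t) / real_of_int (2 ^ n)" for t :: real
  proof -
    have "2 powr of_int j = 2 powr of_int k / 2 powr real n"
      using \<open>j \<le> k\<close> by (simp add: n_def flip: powr_diff)
    then show ?thesis by (simp add: powr_realpow)
  qed
  have "\<lfloor>2 powr of_int j * t\<rfloor> = \<lfloor>2 powr of_int k * t\<rfloor> div (2 ^ n)" for t :: real
    unfolding * by (rule floor_divide_real_eq_div) simp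
  then show ?thesis by (auto simp: dcube_def)
qed

lemma dcube_subset:
  assumes "j \<le> k" "dcube k y \<inter> dcube j z \<noteq> {}"
  shows "dcube k y \<subseteq> dcube j z"
proof -
  obtain x where x: "x \<in> dcube k y" "x \<in> dcube j z" using assms by blast
  then show ?thesis using dcube_antimono[OF assms(1), of x] dcube_eqI by metis
qed

lemma dyadic_trichotomy:
  assumes "p \<in> dyadic_cubes" "q \<in> dyadic_cubes" "p \<inter> q \<noteq> {}"
  shows "p \<subseteq> q \<or> q \<subseteq> p"
  using assms by (metis dyadic_cubesE dcube_subset linear Int_commute)

lemma countable_dyadic_cubes: "countable (dyadic_cubes :: 'a::euclidean_space set set)"
proof -
  let ?Q = "{k :: 'a \<Rightarrow> int. \<forall>i. i \<notin> Basis \<longrightarrow> k i = 0}"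
  define f where "f = (\<lambda>(j, k). {x. \<forall>i\<in>Basis. \<lfloor>2 powr real_of_int j * (x \<bullet> i)\<rfloor> = (k::'a\<Rightarrow>int) i})"
  \<comment> \<open>Labels off \<open>Basis\<close> do not influence the cube; restricting to
    \<open>Basis\<close> leaves a countable index set, which the full function type is not when
    \<open>Basis\<close> has an infinite complement.\<close>
  have "countable (PiE Basis (\<lambda>_. UNIV :: int set) :: ('a \<Rightarrow> int) set)"
    by (rule countable_PiE) auto
  then have "countable (f ` (UNIV \<times> PiE Basis (\<lambda>_. UNIV)))" by auto
  moreover have "dyadic_cubes \<subseteq> f ` (UNIV \<times> PiE Basis (\<lambda>_. UNIV))"
  proof
    fix q :: "'a set" assume "q \<in> dyadic_cubes"
    then obtain j y where q: "q = dcube j y" by (rule dyadic_cubesE)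
    have "q = f (j, restrict (\<lambda>i. \<lfloor>2 powr real_of_int j * (y \<bullet> i)\<rfloor>) Basis)"
      by (auto simp: q f_def dcube_def)
    then show "q \<in> f ` (UNIV \<times> PiE Basis (\<lambda>_. UNIV))" by (rule image_eqI) simp
  qed
  ultimately show ?thesis by (rule countable_subset[rotated])
qed

lemma dcube_borel [measurable]: "dcube j (y::'a::euclidean_space) \<in> sets borel"
  unfolding dcube_def by measurable

definition ccorner :: "int \<Rightarrow> 'a::euclidean_space \<Rightarrow> 'a" where
  "ccorner j y = (\<Sum>i\<in>Basis. (of_int \<lfloor>2 powr of_int j * (y \<bullet> i)\<rfloor> / 2 powr of_int j) *\<^sub>R i)"

lemma dcube_alt:
  "dcube j y = {x. \<forall>i\<in>Basis. ccorner j y \<bullet> i \<le> x \<bullet> i \<and> x \<bullet> i < ccorner j y \<bullet> i + 2 powr - of_int j}"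
proof -
  have "\<lfloor>2 powr of_int j * t\<rfloor> = \<lfloor>2 powr of_int j * s\<rfloor> \<longleftrightarrow>
     of_int \<lfloor>2 powr of_int j * s\<rfloor> / 2 powr of_int j \<le> t \<and>
     t < of_int \<lfloor>2 powr of_int j * s\<rfloor> / 2 powr of_int j + 2 powr - of_int j" for s t :: real
    by (simp add: floor_eq_iff powr_minus field_simps)
  then show ?thesis by (simp add: dcube_def ccorner_def)
qed

lemma dcube_box:
  "box (ccorner j y) (ccorner j y + (2 powr - of_int j) *\<^sub>R One) \<subseteq> dcube j y"
  "dcube j y \<subseteq> cbox (ccorner j y) (ccorner j y + (2 powr - of_int j) *\<^sub>R One)"
  by (auto simp: dcube_alt mem_box algebra_simps inner_sum_left_Basis less_imp_le)

lemma emeasure_dcube: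
  "emeasure lborel (dcube j (y::'a::euclidean_space)) = ennreal ((2 powr - of_int j) ^ DIM('a))"
proof -
  let ?a = "ccorner j y" and ?b = "ccorner j y + (2 powr - of_int j) *\<^sub>R (One::'a)"
  have "emeasure lborel (box ?a ?b) = ennreal ((2 powr - of_int j) ^ DIM('a))"
    by (subst emeasure_lborel_box) (auto simp: algebra_simps)
  moreover have "emeasure lborel (cbox ?a ?b) = ennreal ((2 powr - of_int j) ^ DIM('a))"
    by (subst emeasure_lborel_cbox) (auto simp: algebra_simps)
  moreover have "emeasure lborel (box ?a ?b) \<le> emeasure lborel (dcube j y)"
    by (intro emeasure_mono dcube_box) auto
  moreover have "emeasure lborel (dcube j y) \<le> emeasure lborel (cbox ?a ?b)"
    by (intro emeasure_mono dcube_box) auto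
  ultimately show ?thesis by (metis antisym)
qed

text \<open>Volumes decide: a smaller volume means a larger generation. Applied in both directions,
  this also shows that a cube determines its generation.\<close>

lemma dcube_gen_inj:
  assumes "dcube j y \<subseteq> dcube k (z::'a::euclidean_space)" shows "k \<le> j"
proof -
  have "emeasure lborel (dcube j y) \<le> emeasure lborel (dcube k z)"
    using assms by (intro emeasure_mono) auto
  then have "(2 powr - of_int j :: real) ^ DIM('a) \<le> (2 powr - of_int k) ^ DIM('a)"
    by (simp add: emeasure_dcube)
  then have "(2 powr - of_int j :: real) \<le> (2 powr - of_int k)"
    using power_mono_iff[of "2 powr - of_int j :: real" "2 powr - of_int k" "DIM('a)"] by simp
  then show ?thesis by simp
qed

lemma interior_dcube:
  "box (ccorner j y) (ccorner j y + (2 powr - of_int j) *\<^sub>R One) \<subseteq> interior (dcube j y)"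
  by (intro interior_maximal dcube_box open_box)

text \<open>The set of differences of a half-open cube does not see its position. Every diameter of
  a cube, for any norm, thus depends on the generation alone.\<close>

lemma dcube_diff:
  "(\<lambda>p. fst p - snd p) ` (dcube j y \<times> dcube j y) = {z::'a::euclidean_space. \<forall>i\<in>Basis. \<bar>z \<bullet> i\<bar> < 2 powr - of_int j}"
    (is "?L = ?R")
proof
  show "?L \<subseteq> ?R"
    by (force simp: dcube_alt inner_diff_left)
next
  show "?R \<subseteq> ?L"
  proof
    fix z :: 'a assume z: "z \<in> ?R"
    \<comment> \<open>Positive and negative parts of z, both added to the corner: each coordinate of
      both points stays in the half-open side.\<close>
    define p q where "p = ccorner j y + (\<Sum>i\<in>Basis. max 0 (z \<bullet> i) *\<^sub>R i)"
      and "q = ccorner j y + (\<Sum>i\<in>Basis. max 0 (- (z \<bullet> i)) *\<^sub>R i)"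
    have "p \<in> dcube j y" "q \<in> dcube j y"
      using z by (auto simp: p_def q_def dcube_alt inner_add_left abs_less_iff)
    moreover have "z = p - q"
      by (rule euclidean_eqI) (auto simp: p_def q_def inner_diff_left inner_add_left)
    ultimately show "z \<in> ?L" by (auto intro!: image_eqI[of _ _ "(p,q)"])
  qed
qed

text \<open>Around each point the coarsest cube of generation at least J with closure inside G is
  taken; such a cube exists by the bound of the norm by the l1 norm. Closures are required because
  the nested-cube argument needs limit points to remain in the open sets.\<close>

lemma whitney:
  fixes G :: "'a::euclidean_space set"
  assumes "open G"
  obtains W where "W \<subseteq> dyadic_cubes" "\<And>w. w \<in> W \<Longrightarrow> closure w \<subseteq> G" "\<Union>W = G"
    "disjoint W" "\<And>w. w \<in> W \<Longrightarrow> \<exists>k\<ge>J. \<exists>y. w = dcube k y"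
proof -
  have ex: "\<exists>n. closure (dcube (J + int n) y) \<subseteq> G" if y: "y \<in> G" for y
  proof -
    obtain e where e: "e > 0" "cball y e \<subseteq> G" using assms y open_contains_cball by blast
    have "(\<lambda>n. (2 powr - of_int J * real DIM('a)) * (1/2) ^ n) \<longlonglongrightarrow> (2 powr - of_int J * real DIM('a)) * 0"
      by (intro tendsto_intros LIMSEQ_power_zero) auto
    then have "\<forall>\<^sub>F n in sequentially. (2 powr - of_int J * real DIM('a)) * (1/2) ^ n < e"
      using e(1) by (intro order_tendstoD(2)[where y=0]) simp_all
    then obtain n where "(2 powr - of_int J * real DIM('a)) * (1/2) ^ n < e"
      by (meson eventually_sequentially le_refl)
    then have n: "real DIM('a) * 2 powr - of_int (J + int n) < e"
      by (simp add: powr_add powr_minus powr_realpow field_simps power_divide powr_diff)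
    have "dcube (J + int n) y \<subseteq> cball y e"
    proof
      fix x assume "x \<in> dcube (J + int n) y"
      then have "y - x \<in> (\<lambda>p. fst p - snd p) ` (dcube (J + int n) y \<times> dcube (J + int n) y)"
        by (auto intro!: image_eqI[of _ _ "(y,x)"])
      then have "\<bar>(y - x) \<bullet> i\<bar> \<le> 2 powr - of_int (J + int n)" if "i \<in> Basis" for i
        using that unfolding dcube_diff by (auto simp: less_imp_le)
      then have "(\<Sum>i\<in>Basis. \<bar>(y - x) \<bullet> i\<bar>) \<le> real DIM('a) * 2 powr - of_int (J + int n)"
        by (intro sum_bounded_above) auto
      then have "norm (y - x) \<le> real DIM('a) * 2 powr - of_int (J + int n)"
        using norm_le_l1[of "y - x"] by linarith
      then show "x \<in> cball y e" using n by (simp add: dist_norm)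
    qed
    then have "closure (dcube (J + int n) y) \<subseteq> cball y e" by (simp add: closure_minimal)
    then show ?thesis using e by blast
  qed
  define l where "l y = (LEAST n. closure (dcube (J + int n) y) \<subseteq> G)" for y
  define W where "W = (\<lambda>y. dcube (J + int (l y)) y) ` G"
  have l: "closure (dcube (J + int (l y)) y) \<subseteq> G" if "y \<in> G" for y
    unfolding l_def using ex[OF that] by (rule LeastI_ex)
  \<comment> \<open>Disjointness comes from minimality: if two chosen cubes meet, the coarser one
    contains the other centre and already qualifies for it, so the finer one was not a coarser
    choice missed.\<close>
  have key: "dcube (J + int (l y)) y = dcube (J + int (l z)) z"
    if "y \<in> G" "z \<in> G" "dcube (J + int (l y)) y \<inter> dcube (J + int (l z)) z \<noteq> {}" "l y \<le> l z" for y z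
  proof -
    have "dcube (J + int (l z)) z \<subseteq> dcube (J + int (l y)) y"
      using that by (intro dcube_subset) auto
    then have "z \<in> dcube (J + int (l y)) y" using dcube_refl by blast
    then have eq: "dcube (J + int (l y)) z = dcube (J + int (l y)) y" by (rule dcube_eqI)
    then have "l z \<le> l y" unfolding l_def[of z] using l[OF \<open>y \<in> G\<close>] by (intro Least_le) simp
    then show ?thesis using eq that by simp
  qed
  show ?thesis
  proof (rule that[of W])
    show "W \<subseteq> dyadic_cubes" "\<And>w. w \<in> W \<Longrightarrow> closure w \<subseteq> G"
      using l by (auto simp: W_def)
    then have "\<Union>W \<subseteq> G" using closure_subset by blast
    moreover have "G \<subseteq> \<Union>W" by (auto simp: W_def)
    ultimately show "\<Union>W = G" by blast
    show "disjoint W"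
    proof (rule disjointI)
      fix p q assume "p \<in> W" "q \<in> W" "p \<noteq> q"
      then obtain y z where "y \<in> G" "z \<in> G" "p = dcube (J + int (l y)) y" "q = dcube (J + int (l z)) z"
        by (auto simp: W_def)
      then show "p \<inter> q = {}" using key[of y z] key[of z y] \<open>p \<noteq> q\<close> by (metis Int_commute linear)
    qed
    show "\<exists>k\<ge>J. \<exists>y. w = dcube k y" if "w \<in> W" for w
    proof -
      obtain y where "w = dcube (J + int (l y)) y" using \<open>w \<in> W\<close> unfolding W_def by (rule imageE)
      then show ?thesis by (intro exI[of _ "J + int (l y)"]) auto
    qed
  qed
qed

section \<open>Norm balls and diameters of cubes\<close>

locale euclidean_norm =
  fixes N :: "'a::euclidean_space \<Rightarrow> real"
  assumes norm_N: "is_norm N"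
begin

lemma N_triangle: "N (x + y) \<le> N x + N y"
  and N_scale: "N (c *\<^sub>R x) = \<bar>c\<bar> * N x"
  and N_eq_0 [simp]: "N x = 0 \<longleftrightarrow> x = 0"
  using norm_N by (auto simp: is_norm_def)

lemma N_zero [simp]: "N 0 = 0"
  by simp

lemma N_minus [simp]: "N (- x) = N x"
  using N_scale[of "-1" x] by simp

lemma N_diff_commute: "N (x - y) = N (y - x)"
  using N_minus[of "x - y"] by simp

lemma N_nonneg [simp]: "0 \<le> N x"
  using N_triangle[of x "- x"] by simp

lemma N_diff_triangle: "N (x - z) \<le> N (x - y) + N (y - z)"
  using N_triangle[of "x - y" "y - z"] by simp

lemma N_le_norm: obtains C where "C > 0" "\<And>x. N x \<le> C * norm x"
proof -
  define C where "C = (\<Sum>i\<in>Basis. N (i::'a)) + 1"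
  have sum: "N (sum f A) \<le> (\<Sum>i\<in>A. N (f i))" if "finite A" for f :: "'a \<Rightarrow> 'a" and A
    using that
  proof (induction rule: finite_induct)
    case (insert a A)
    then show ?case using N_triangle[of "f a" "sum f A"] by simp
  qed simp
  have "N x \<le> C * norm x" for x
  proof -
    have "N x = N (\<Sum>i\<in>Basis. (x \<bullet> i) *\<^sub>R i)" by (simp add: euclidean_representation)
    also have "\<dots> \<le> (\<Sum>i\<in>Basis. N ((x \<bullet> i) *\<^sub>R i))" by (rule sum) simp
    also have "\<dots> = (\<Sum>i\<in>Basis. \<bar>x \<bullet> i\<bar> * N i)" by (simp add: N_scale)
    also have "\<dots> \<le> (\<Sum>i\<in>Basis. norm x * N i)"
      by (intro sum_mono mult_right_mono) (auto simp: Basis_le_norm)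
    also have "\<dots> \<le> C * norm x" unfolding C_def sum_distrib_left[symmetric] by (simp add: algebra_simps)
    finally show ?thesis .
  qed
  moreover have "C > 0" unfolding C_def by (intro add_nonneg_pos sum_nonneg) auto
  ultimately show ?thesis using that by blast
qed

lemma continuous_on_N: "continuous_on A N"
proof -
  obtain C where C: "C > 0" "\<And>x. N x \<le> C * norm x" using N_le_norm by blast
  have "dist (N x) (N y) \<le> C * dist x y" for x y
    using N_triangle[of "x - y" y] N_triangle[of "y - x" x] C(2)[of "x - y"] N_diff_commute[of x y]
    by (auto simp: dist_real_def dist_norm abs_le_iff)
  then have "C-lipschitz_on A N" using C(1) by (intro lipschitz_onI) auto
  then show ?thesis by (rule lipschitz_on_continuous_on)
qed

lemma norm_le_N: obtains c where "c > 0" "\<And>x. norm x \<le> c * N x"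
proof -
  obtain b :: 'a where "b \<in> Basis" using nonempty_Basis by blast
  then have "sphere (0::'a) 1 \<noteq> {}" by (auto intro!: exI[of _ b])
  then obtain u where u: "u \<in> sphere 0 1" "\<And>y. y \<in> sphere 0 1 \<Longrightarrow> N u \<le> N y"
    using continuous_attains_inf[OF compact_sphere _ continuous_on_N] by blast
  have "N u \<noteq> 0" using u(1) by auto
  then have pos: "N u > 0" using N_nonneg[of u] by linarith
  have "norm x \<le> (1 / N u) * N x" for x
  proof (cases "x = 0")
    case False
    have "N u \<le> N ((1 / norm x) *\<^sub>R x)" using False by (intro u) simp
    then show ?thesis using False pos by (simp add: N_scale field_simps)
  qed simp
  then show ?thesis using that[of "1 / N u"] pos by auto
qed

definition nball :: "'a \<Rightarrow> real \<Rightarrow> 'a set" where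
  "nball x r = {y. N (y - x) < r}"

lemma mem_nball [simp]: "y \<in> nball x r \<longleftrightarrow> N (y - x) < r"
  by (simp add: nball_def)

lemma open_nball [simp]: "open (nball x r)"
  unfolding nball_def
  by (intro open_Collect_less continuous_intros continuous_on_compose2[OF continuous_on_N]) auto

lemma nball_borel [measurable]: "nball x r \<in> sets borel"
  by simp

definition vN :: real where "vN = measure lborel (nball 0 1)"

lemma vN_aux: "vN > 0 \<and> emeasure lborel (nball 0 1) = ennreal vN"
proof -
  obtain C where C: "C > 0" "\<And>x. N x \<le> C * norm x" using N_le_norm by blast
  obtain c where c: "c > 0" "\<And>x. norm x \<le> c * N x" using norm_le_N by blast
  have "norm x \<le> c" if "N x < 1" for x
    using c(2)[of x] that mult_left_mono[of "N x" 1 c] c(1) by linarith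
  then have "nball 0 1 \<subseteq> cball 0 c" by auto
  then have "bounded (nball 0 1)" using bounded_cball bounded_subset by blast
  then have fin: "emeasure lborel (nball 0 1) < top"
    using emeasure_bounded_finite by auto
  have "emeasure lborel (nball 0 1) \<noteq> 0"
  proof
    assume "emeasure lborel (nball 0 1) = 0"
    then have "nball 0 1 \<in> null_sets lebesgue"
      by (intro null_sets_completionI) (auto simp: null_sets_def)
    then have "negligible (nball 0 1)" by (simp add: negligible_iff_null_sets)
    then have "nball 0 1 = {}" using open_not_negligible open_nball by blast
    moreover have "0 \<in> nball 0 1" by simp
    ultimately show False by blast
  qed
  then show ?thesis using fin unfolding vN_def
    by (metis emeasure_eq_ennreal_measure ennreal_0 less_irrefl measure_nonneg order_less_le)
qed

lemma vN_pos [simp]: "vN > 0" and emeasure_nball_0: "emeasure lborel (nball 0 1) = ennreal vN"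
  using vN_aux by auto

lemma emeasure_nball:
  assumes "r > 0"
  shows "emeasure lborel (nball x r) = ennreal (vN * r ^ DIM('a))"
proof -
  have "nball x r = (\<lambda>y. x + r *\<^sub>R y) ` nball 0 1"
  proof (intro equalityI subsetI)
    fix y assume y: "y \<in> nball x r"
    then have "(1 / r) *\<^sub>R (y - x) \<in> nball 0 1" using assms by (simp add: N_scale)
    moreover have "y = x + r *\<^sub>R ((1 / r) *\<^sub>R (y - x))" using assms by simp
    ultimately show "y \<in> (\<lambda>y. x + r *\<^sub>R y) ` nball 0 1" by blast
  next
    fix y assume "y \<in> (\<lambda>y. x + r *\<^sub>R y) ` nball 0 1"
    then show "y \<in> nball x r" using assms by (auto simp: N_scale)
  qed
  then have "emeasure lebesgue (nball x r) = ennreal (r ^ DIM('a)) * emeasure lebesgue (nball 0 1)"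
    using emeasure_lebesgue_affine[of r x "nball 0 1"] assms by (simp only: add.commute[of x]) simp
  then have "emeasure lborel (nball x r) = ennreal (r ^ DIM('a)) * ennreal vN"
    by (simp add: emeasure_nball_0)
  then show ?thesis using assms vN_pos by (simp add: ennreal_mult[symmetric] mult.commute)
qed

text \<open>The diameter of a unit dyadic cube in the norm N: its differences form the open cube
  (-1,1)^d. A cube of generation k has diameter \<open>kap\<close> * 2^(-k).\<close>

definition kap :: real where
  "kap = (SUP z\<in>{z::'a. \<forall>i\<in>Basis. \<bar>z \<bullet> i\<bar> < 1}. N z)"

lemma bdd_above_unit_cube: "bdd_above (N ` {z::'a. \<forall>i\<in>Basis. \<bar>z \<bullet> i\<bar> < 1})"
proof -
  obtain C where C: "C > 0" "\<And>x. N x \<le> C * norm x" using N_le_norm by blast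
  have "N z \<le> C * DIM('a)" if "\<forall>i\<in>Basis. \<bar>z \<bullet> i\<bar> < 1" for z :: 'a
  proof -
    have "(\<Sum>i\<in>Basis. \<bar>z \<bullet> i\<bar>) \<le> real DIM('a) * 1"
      using that by (intro sum_bounded_above) (auto simp: less_imp_le)
    then have "norm z \<le> DIM('a)" using norm_le_l1[of z] by linarith
    then show ?thesis using C(2)[of z] C(1) by (smt (verit) mult_left_mono)
  qed
  then show ?thesis by (intro bdd_aboveI[of _ "C * DIM('a)"]) auto
qed

lemma kap_pos [simp]: "kap > 0"
proof -
  obtain b :: 'a where b: "b \<in> Basis" using nonempty_Basis by blast
  have "N ((1/2) *\<^sub>R b) \<le> kap" unfolding kap_def
    using b by (intro cSUP_upper bdd_above_unit_cube) (auto simp: inner_Basis)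
  moreover have "N ((1/2) *\<^sub>R b) \<noteq> 0" using b by auto
  ultimately show ?thesis using N_nonneg[of "(1/2) *\<^sub>R b"] by linarith
qed

abbreviation cube_diam :: "int \<Rightarrow> real" where
  "cube_diam k \<equiv> kap * 2 powr - of_int k"

lemma N_diff_dcube:
  assumes "x \<in> dcube j w" "y \<in> dcube j w"
  shows "N (x - y) \<le> cube_diam j"
proof -
  let ?s = "2 powr - of_int j :: real"
  have "x - y \<in> (\<lambda>p. fst p - snd p) ` (dcube j w \<times> dcube j w)"
    using assms by (auto intro!: image_eqI[of _ _ "(x,y)"])
  then have "\<forall>i\<in>Basis. \<bar>(x - y) \<bullet> i\<bar> < ?s" unfolding dcube_diff by auto
  then have "\<forall>i\<in>Basis. \<bar>((1 / ?s) *\<^sub>R (x - y)) \<bullet> i\<bar> < 1"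
    by (simp add: abs_mult)
  then have "N ((1 / ?s) *\<^sub>R (x - y)) \<le> kap" unfolding kap_def
    by (intro cSUP_upper bdd_above_unit_cube) auto
  then show ?thesis unfolding N_scale by (simp add: field_simps)
qed

lemma ediam_dcube: "ediam N (dcube j w) = ennreal (cube_diam j)"
proof (rule antisym)
  show "ediam N (dcube j w) \<le> ennreal (cube_diam j)"
    unfolding ediam_def using N_diff_dcube by (intro SUP_least ennreal_leI) auto
next
  let ?s = "2 powr - of_int j :: real"
  show "ennreal (kap * ?s) \<le> ediam N (dcube j w)"
  proof (cases "ediam N (dcube j w)")
    case (real t)
    have "N z \<le> t / ?s" if z: "\<forall>i\<in>Basis. \<bar>z \<bullet> i\<bar> < 1" for z :: 'a
    proof -
      have "\<forall>i\<in>Basis. \<bar>(?s *\<^sub>R z) \<bullet> i\<bar> < ?s"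
        using z by (simp add: abs_mult)
      then have "?s *\<^sub>R z \<in> (\<lambda>p. fst p - snd p) ` (dcube j w \<times> dcube j w)"
        unfolding dcube_diff by simp
      then obtain p where p: "p \<in> dcube j w \<times> dcube j w" "?s *\<^sub>R z = fst p - snd p" by blast
      have "ennreal (N (fst p - snd p)) \<le> ediam N (dcube j w)"
        unfolding ediam_def using p(1) by (rule SUP_upper)
      then have "?s * N z \<le> t" using real p(2)[symmetric] by (simp add: N_scale)
      then show ?thesis by (simp add: field_simps)
    qed
    then have "kap \<le> t / ?s" unfolding kap_def
      by (intro cSUP_least) (auto intro!: exI[of _ 0])
    then show ?thesis using real by (simp add: field_simps ennreal_leI)
  qed simp
qed

definition cubes_meeting :: "int \<Rightarrow> 'a set \<Rightarrow> 'a set set" where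
  "cubes_meeting j A = {q \<in> range (dcube j). q \<inter> A \<noteq> {}}"

lemma cubes_meeting_cover: "A \<subseteq> \<Union>(cubes_meeting j A)"
  unfolding cubes_meeting_def using dcube_refl by blast

lemma cubes_meeting_dyadic: "cubes_meeting j A \<subseteq> dyadic_cubes"
  by (auto simp: cubes_meeting_def)

text \<open>Disjoint cubes of equal volume all lie in the ball enlarged by one cube diameter, so
  volumes bound their number. The bound is proved for finite subfamilies first, since it is also
  what shows finiteness.\<close>

lemma cubes_meeting_nball:
  assumes "R > 0"
  shows "finite (cubes_meeting j (nball x R))"
    and "real (card (cubes_meeting j (nball x R))) * (2 powr - of_int j) ^ DIM('a)
          \<le> vN * (R + cube_diam j) ^ DIM('a)"
proof -
  let ?s = "2 powr - of_int j :: real"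
  let ?Q = "cubes_meeting j (nball x R)"
  have sub: "q \<subseteq> nball x (R + kap * ?s)" if "q \<in> ?Q" for q
  proof
    fix y assume y: "y \<in> q"
    obtain w z where w: "q = dcube j w" "z \<in> q" "N (z - x) < R"
      using \<open>q \<in> ?Q\<close> unfolding cubes_meeting_def by force
    then show "y \<in> nball x (R + kap * ?s)"
      using N_diff_dcube[of y j w z] N_diff_triangle[of y x z] y by auto
  qed
  have pos: "R + kap * ?s > 0" using assms by (intro add_pos_pos mult_pos_pos) auto
  have bound: "real (card F) * ?s ^ DIM('a) \<le> vN * (R + kap * ?s) ^ DIM('a)"
    if F: "finite F" "F \<subseteq> ?Q" for F
  proof -
    have "disjoint F"
    proof (rule disjointI)
      fix p q assume "p \<in> F" "q \<in> F" "p \<noteq> q"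
      then have "p \<in> range (dcube j)" "q \<in> range (dcube j)"
        using F(2) unfolding cubes_meeting_def by auto
      then obtain a b where ab: "p = dcube j a" "q = dcube j b" by auto
      show "p \<inter> q = {}"
        using ab \<open>p \<noteq> q\<close> dcube_subset[of j j a b] dcube_subset[of j j b a] by (auto simp: Int_commute)
    qed
    then have "emeasure lborel (\<Union>F) = (\<Sum>q\<in>F. emeasure lborel q)"
      using F sum_emeasure[of "\<lambda>q. q" F lborel]
      by (force simp: cubes_meeting_def disjoint_family_on_def disjoint_def)
    also have "\<dots> = (\<Sum>q\<in>F. ennreal (?s ^ DIM('a)))"
      using F by (intro sum.cong) (auto simp: cubes_meeting_def emeasure_dcube dest!: subsetD)
    also have "\<dots> = ennreal (real (card F) * ?s ^ DIM('a))"
      by (simp add: ennreal_mult'' ennreal_of_nat_eq_real_of_nat)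
    finally have "ennreal (real (card F) * ?s ^ DIM('a)) = emeasure lborel (\<Union>F)" by simp
    also have "\<dots> \<le> emeasure lborel (nball x (R + kap * ?s))"
      using sub F by (intro emeasure_mono) auto
    finally show ?thesis using pos
      by (simp add: emeasure_nball less_imp_le)
  qed
  show fin: "finite ?Q"
  proof (rule ccontr)
    assume inf: "infinite ?Q"
    obtain n :: nat where n: "vN * (R + kap * ?s) ^ DIM('a) / ?s ^ DIM('a) < real n"
      using reals_Archimedean2 by blast
    obtain F where F: "finite F" "card F = n" "F \<subseteq> ?Q"
      using infinite_arbitrarily_large[OF inf] by metis
    show False using bound[OF F(1) F(3)] F(2) n by (simp add: field_simps)
  qed
  show "real (card ?Q) * ?s ^ DIM('a) \<le> vN * (R + kap * ?s) ^ DIM('a)"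
    using bound[OF fin] by simp
qed

text \<open>The ball sits at the centre and its radius comes from comparing N with the Euclidean
  norm. Balls inside the interior are what the eutaxic sequence will be asked to fill, and b enters
  the final content constant.\<close>

lemma center_ball:
  obtains b where "b > 0" "\<And>j y. \<exists>z. nball z (b * 2 powr - of_int j) \<subseteq> interior (dcube j y)"
proof -
  obtain c where c: "c > 0" "\<And>x. norm x \<le> c * N x" using norm_le_N by blast
  have "nball (ccorner j y + (2 powr - of_int j / 2) *\<^sub>R One) (1 / (2 * c) * 2 powr - of_int j)
     \<subseteq> interior (dcube j y)" (is "nball ?z ?r \<subseteq> _") for j y
  proof
    fix w assume "w \<in> nball ?z ?r"
    then have "c * N (w - ?z) < 2 powr - of_int j / 2" using c(1) by (simp add: field_simps)
    then have nm: "norm (w - ?z) < 2 powr - of_int j / 2" using c(2)[of "w - ?z"] by linarith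
    have "\<bar>(w - ?z) \<bullet> i\<bar> < 2 powr - of_int j / 2" if "i \<in> Basis" for i
      using Basis_le_norm[OF that, of "w - ?z"] nm by linarith
    then have "w \<in> box (ccorner j y) (ccorner j y + (2 powr - of_int j) *\<^sub>R One)"
      unfolding mem_box abs_less_iff by (force simp: inner_diff_left inner_add_left)
    then show "w \<in> interior (dcube j y)" using interior_dcube by blast
  qed
  then show ?thesis using that[of "1 / (2 * c)"] c(1) by fastforce
qed

end

section \<open>Weights of families of cubes\<close>

text \<open>The sum of a family is encoded as an integral for counting measure, so that interchange
  of sums, monotonicity and continuity from above are inherited from integration;
  \<open>infsum_eq_csum\<close> ties it to the sum in \<open>M_inf\<close>.\<close>

definition csum :: "('b \<Rightarrow> ennreal) \<Rightarrow> 'b set \<Rightarrow> ennreal" where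
  "csum f C = (\<integral>\<^sup>+q. f q * indicator C q \<partial>count_space UNIV)"

lemma csum_count_space: "csum f C = (\<integral>\<^sup>+q. f q \<partial>count_space C)"
  by (cases "C = UNIV") (simp_all add: csum_def nn_integral_count_space_indicator)

lemma csum_finite: "finite A \<Longrightarrow> csum f A = sum f A"
  by (simp add: csum_count_space nn_integral_count_space_finite)

lemma csum_member: "x \<in> A \<Longrightarrow> f x \<le> csum f A"
  unfolding csum_count_space by (rule nn_integral_ge_point)

lemma csum_cmult: "csum (\<lambda>x. c * f x) A = c * csum f A"
  unfolding csum_count_space by (rule nn_integral_cmult) simp

lemma csum_mono_set: "A \<subseteq> B \<Longrightarrow> csum f A \<le> csum f B"
  unfolding csum_def by (intro nn_integral_mono) (auto split: split_indicator)

lemma csum_mono: "(\<And>q. q \<in> A \<Longrightarrow> f q \<le> g q) \<Longrightarrow> csum f A \<le> csum g A"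
  unfolding csum_count_space by (intro nn_integral_mono) auto

lemma csum_Un_le: "csum f (A \<union> B) \<le> csum f A + csum f B"
proof -
  have "csum f (A \<union> B) \<le> (\<integral>\<^sup>+q. f q * indicator A q + f q * indicator B q \<partial>count_space UNIV)"
    unfolding csum_def by (intro nn_integral_mono) (auto split: split_indicator)
  also have "\<dots> = csum f A + csum f B"
    unfolding csum_def by (rule nn_integral_add) auto
  finally show ?thesis .
qed

lemma infsum_eq_csum:
  fixes f :: "'b \<Rightarrow> ennreal"
  assumes "countable A"
  shows "infsum f A = csum f A"
proof (cases "finite A")
  case True
  then show ?thesis by (simp add: csum_finite)
next
  case False
  have inf: "infsum f A = (SUP F\<in>{F. finite F \<and> F \<subseteq> A}. sum f F)"
    by (rule nonneg_infsum_complete) simp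
  show ?thesis
  proof (rule antisym)
    show "infsum f A \<le> csum f A"
      unfolding inf
    proof (rule SUP_least)
      fix F assume "F \<in> {F. finite F \<and> F \<subseteq> A}"
      then show "sum f F \<le> csum f A"
        using csum_mono_set[of F A f] by (simp add: csum_finite)
    qed
  next
    have bij: "bij_betw (from_nat_into A) UNIV A"
      using False assms by (simp add: bij_betw_from_nat_into)
    have "csum f A = (\<Sum>i. f (from_nat_into A i))"
      using nn_integral_bij_count_space[OF bij, of f] by (simp add: csum_count_space nn_integral_count_space_nat)
    also have "\<dots> = (SUP n. \<Sum>i<n. f (from_nat_into A i))"
      by (rule suminf_eq_SUP)
    also have "\<dots> \<le> infsum f A"
    proof (rule SUP_least)
      fix n
      have inj: "inj_on (from_nat_into A) {..<n}"
        using bij by (auto simp: bij_betw_def intro: inj_on_subset)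
      then have "(\<Sum>i<n. f (from_nat_into A i)) = sum f (from_nat_into A ` {..<n})"
        by (simp add: sum.reindex)
      also have "\<dots> \<le> infsum f A"
        unfolding inf using bij by (intro SUP_upper) (auto simp: bij_betw_def)
      finally show "(\<Sum>i<n. f (from_nat_into A i)) \<le> infsum f A" .
    qed
    finally show "csum f A \<le> infsum f A" .
  qed
qed

lemma csum_swap:
  assumes "countable W" "countable C"
  shows "csum (\<lambda>w. csum (\<lambda>p. f w p) C) W = csum (\<lambda>p. csum (\<lambda>w. f w p) W) C"
  unfolding csum_count_space using assms by (intro nn_integral_count_space_nn_integral) auto

text \<open>Since W is disjoint, a nonempty p lies inside at most one member of W, so after
  exchanging the two sums each f p is counted at most once. The empty set would lie inside all of
  them.\<close>

lemma csum_subordinate_le: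
  assumes C: "countable C" and W: "countable W" "disjoint W"
    and ne: "\<And>p. p \<in> C \<Longrightarrow> p \<noteq> {}"
  shows "csum (\<lambda>w. csum f {p \<in> C. p \<subseteq> w}) W \<le> csum f {p \<in> C. \<exists>w\<in>W. p \<subseteq> w}"
proof -
  have "csum (\<lambda>w. csum f {p \<in> C. p \<subseteq> w}) W
      = csum (\<lambda>w. csum (\<lambda>p. f p * indicator {p. p \<subseteq> w} p) C) W"
  proof -
    have "csum f {p \<in> C. p \<subseteq> w} = csum (\<lambda>p. f p * indicator {p. p \<subseteq> w} p) C" for w
      unfolding csum_def by (intro nn_integral_cong) (auto split: split_indicator)
    then show ?thesis by simp
  qed
  also have "\<dots> = csum (\<lambda>p. csum (\<lambda>w. f p * indicator {p. p \<subseteq> w} p) W) C"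
    by (rule csum_swap[OF W(1) C])
  also have "\<dots> \<le> csum (\<lambda>p. f p * indicator {p. \<exists>w\<in>W. p \<subseteq> w} p) C"
  proof (rule csum_mono)
    fix p assume p: "p \<in> C"
    show "csum (\<lambda>w. f p * indicator {p. p \<subseteq> w} p) W \<le> f p * indicator {p. \<exists>w\<in>W. p \<subseteq> w} p"
    proof (cases "\<exists>w\<in>W. p \<subseteq> w")
      case True
      then obtain w where w: "w \<in> W" "p \<subseteq> w" by blast
      have uniq: "w' = w" if "w' \<in> W" "p \<subseteq> w'" for w'
        using w that disjointD[OF W(2), of w' w] ne[OF p] by blast
      have "indicator {p. p \<subseteq> w'} p = (indicator {w} w' :: ennreal)" if "w' \<in> W" for w'
        using uniq[OF that] w(2) by (cases "p \<subseteq> w'") auto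
      then have "csum (\<lambda>w. f p * indicator {p. p \<subseteq> w} p) W = csum (\<lambda>w'. f p * indicator {w} w') W"
        unfolding csum_count_space by (intro nn_integral_cong) simp
      also have "\<dots> = f p"
        using w(1) by (simp add: csum_count_space nn_integral_cmult_indicator)
      finally show ?thesis using True by simp
    next
      case False
      then have "csum (\<lambda>w. f p * indicator {p. p \<subseteq> w} p) W = csum (\<lambda>w. 0) W"
        unfolding csum_count_space by (intro nn_integral_cong) (auto split: split_indicator)
      then show ?thesis by (simp add: csum_count_space)
    qed
  qed
  also have "\<dots> = csum f {p \<in> C. \<exists>w\<in>W. p \<subseteq> w}"
    unfolding csum_def
    by (intro nn_integral_cong) (auto split: split_indicator)
  finally show ?thesis .
qed

section \<open>Fine parts of covers, and lower bounds for contents\<close>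

definition tail_cubes :: "int \<Rightarrow> 'a::euclidean_space set set \<Rightarrow> 'a set set" where
  "tail_cubes J C = {p \<in> C. \<exists>k\<ge>J. \<exists>y. p = dcube k y}"

lemma tail_cubes_antimono: "J \<le> J' \<Longrightarrow> tail_cubes J' C \<subseteq> tail_cubes J C"
  unfolding tail_cubes_def using order_trans by blast

text \<open>This is continuity from above for the finite measure with density f on C: the fine parts
  decrease to the empty set, because each cube has only one generation.\<close>

lemma csum_tail_cubes:
  assumes fin: "csum f C < top" and C: "C \<subseteq> dyadic_cubes" and e: "e > 0"
  shows "\<exists>J\<ge>J0. csum f (tail_cubes J C) < e"
proof -
  let ?M = "density (count_space C) f"
  have em: "emeasure ?M A = csum f A" if "A \<subseteq> C" for A
    using that nn_integral_count_space_indicator[of A f]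
    by (simp add: emeasure_density csum_count_space restrict_count_space Int_absorb1 Int_absorb2 flip: nn_integral_restrict_space)
  let ?A = "\<lambda>n. tail_cubes (J0 + int n) C"
  have "(\<Inter>n. ?A n) = {}"
  proof (rule ccontr)
    assume "(\<Inter>n. ?A n) \<noteq> {}"
    then obtain p where p: "\<And>n. p \<in> ?A n" by blast
    then have "p \<in> C" unfolding tail_cubes_def by blast
    then obtain k y where k: "p = dcube k y" using C by (meson dyadic_cubesE subsetD)
    \<comment> \<open>This index pushes the threshold to at least k + 1, past the generation of
      p.\<close>
    obtain k' y' where "k' \<ge> J0 + int (nat (k - J0 + 1))" "p = dcube k' y'"
      using p[of "nat (k - J0 + 1)"] by (auto simp: tail_cubes_def)
    moreover have "k' \<le> k" using k calculation(2) dcube_gen_inj by blast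
    ultimately show False by linarith
  qed
  moreover have "(\<lambda>n. emeasure ?M (?A n)) \<longlonglongrightarrow> emeasure ?M (\<Inter>n. ?A n)"
  proof (rule Lim_emeasure_decseq)
    show "decseq ?A" by (auto simp: decseq_def intro!: tail_cubes_antimono)
    show "emeasure ?M (?A n) \<noteq> \<infinity>" for n
      using csum_mono_set[of "?A n" C f] fin by (subst em) (auto simp: tail_cubes_def top_unique)
  qed (auto simp: tail_cubes_def)
  ultimately have "(\<lambda>n. csum f (?A n)) \<longlonglongrightarrow> 0"
    by (subst (asm) em) (auto simp: tail_cubes_def)
  then have "\<forall>\<^sub>F n in sequentially. csum f (?A n) < e"
    using e by (rule order_tendstoD)
  then obtain n where "csum f (?A n) < e" by (meson eventually_sequentially le_refl)
  then show ?thesis by (intro exI[of _ "J0 + int n"]) auto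
qed

lemma dyadic_nonempty: "p \<in> dyadic_cubes \<Longrightarrow> p \<noteq> {}"
  using dcube_refl by (metis dyadic_cubesE empty_iff)

lemma subset_tail_cubes:
  assumes "C \<subseteq> dyadic_cubes" "\<And>w. w \<in> W \<Longrightarrow> \<exists>k\<ge>J. \<exists>y. w = dcube k y"
  shows "{p \<in> C. \<exists>w\<in>W. p \<subseteq> w} \<subseteq> tail_cubes J C"
proof
  fix p assume "p \<in> {p \<in> C. \<exists>w\<in>W. p \<subseteq> w}"
  then obtain w where w: "p \<in> C" "w \<in> W" "p \<subseteq> w" by blast
  obtain k y where k: "k \<ge> J" "w = dcube k y" using assms(2)[OF w(2)] by blast
  obtain l z where l: "p = dcube l z" using assms(1) w(1) by (meson dyadic_cubesE subsetD)
  have "k \<le> l" using dcube_gen_inj w(3) k(2) l by blast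
  then show "p \<in> tail_cubes J C" using k l w by (auto simp: tail_cubes_def intro!: exI[of _ l])
qed

text \<open>Each w is paid for, up to the factor c, by the cubes of C inside it. Disjoint members of
  W share no such cubes, and all these cubes have generation at least J, so the fine part of C pays
  for the whole of W.\<close>

lemma uncovered_whitney:
  fixes f :: "'a::euclidean_space set \<Rightarrow> ennreal"
  assumes C: "C \<subseteq> dyadic_cubes" "csum f C < top"
    and W: "W \<subseteq> dyadic_cubes" "disjoint W" "\<And>w. w \<in> W \<Longrightarrow> \<exists>k\<ge>J. \<exists>y. w = dcube k y"
    and c: "0 < c" and bad: "\<And>w. w \<in> W \<Longrightarrow> ennreal c * f w \<le> csum f {p \<in> C. p \<subseteq> w}"
  shows "csum f W \<le> ennreal (1 / c) * csum f (tail_cubes J C)"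
proof -
  have cC: "countable C" "countable W"
    using C(1) W(1) countable_dyadic_cubes countable_subset by blast+
  have "ennreal c * csum f W = csum (\<lambda>w. ennreal c * f w) W"
    by (simp add: csum_cmult)
  also have "\<dots> \<le> csum (\<lambda>w. csum f {p \<in> C. p \<subseteq> w}) W"
    using bad by (intro csum_mono) auto
  also have "\<dots> \<le> csum f {p \<in> C. \<exists>w\<in>W. p \<subseteq> w}"
    by (rule csum_subordinate_le[OF cC W(2)]) (use C(1) dyadic_nonempty in blast)
  also have "\<dots> \<le> csum f (tail_cubes J C)"
    by (intro csum_mono_set subset_tail_cubes C W)
  finally have "ennreal (1 / c) * (ennreal c * csum f W) \<le> ennreal (1 / c) * csum f (tail_cubes J C)"
    by (intro mult_left_mono) auto
  then show ?thesis using c by (simp add: mult.assoc[symmetric] ennreal_mult[symmetric])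
qed

text \<open>A cover of F Int V is completed to a cover of V at arbitrarily small extra cost, so the
  local constant c disappears from the comparison of contents. Finiteness of the cost of C is needed
  for its fine part to become negligible.\<close>

lemma content_boost:
  fixes f :: "'a::euclidean_space set \<Rightarrow> ennreal"
  assumes V: "open V" and c: "0 < c"
    and loc: "\<And>w k y C. w = dcube k y \<Longrightarrow> k \<ge> J0 \<Longrightarrow> w \<subseteq> V \<Longrightarrow> C \<subseteq> dyadic_cubes \<Longrightarrow> (\<And>p. p \<in> C \<Longrightarrow> p \<subseteq> w) \<Longrightarrow>
       F \<inter> w \<subseteq> \<Union>C \<Longrightarrow> ennreal c * f w \<le> csum f C"
    and C: "C \<subseteq> dyadic_cubes" "F \<inter> V \<subseteq> \<Union>C" "csum f C < top" and e: "e > 0"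
  obtains W where "W \<subseteq> dyadic_cubes" "\<And>w. w \<in> W \<Longrightarrow> \<exists>k\<ge>J0. \<exists>y. w = dcube k y"
    "V \<subseteq> \<Union>(C \<union> W)" "csum f (C \<union> W) \<le> csum f C + e"
proof -
  \<comment> \<open>The fine part is made smaller than c e because it will be multiplied by
    1/c.\<close>
  have "ennreal c * e > 0" using c e by (simp add: ennreal_zero_less_mult_iff)
  then obtain J where J: "J \<ge> J0" "csum f (tail_cubes J C) < ennreal c * e"
    using csum_tail_cubes[OF C(3,1)] by blast
  obtain W where W: "W \<subseteq> dyadic_cubes" "\<And>w. w \<in> W \<Longrightarrow> closure w \<subseteq> V" "\<Union>W = V"
    "disjoint W" "\<And>w. w \<in> W \<Longrightarrow> \<exists>k\<ge>J. \<exists>y. w = dcube k y"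
    by (rule whitney[OF V, of J]) (rule that)
  \<comment> \<open>A Whitney cube inside a member of C is covered already. For any other w,
    trichotomy shows that the members of C covering points of F in w lie inside w, so the local
    bound applies to them.\<close>
  define B where "B = {w \<in> W. \<not> (\<exists>p\<in>C. w \<subseteq> p)}"
  have WV: "w \<subseteq> V" if "w \<in> W" for w using W(2)[OF that] closure_subset by blast
  have B: "B \<subseteq> W" by (auto simp: B_def)
  have bad: "ennreal c * f w \<le> csum f {p \<in> C. p \<subseteq> w}" if w: "w \<in> B" for w
  proof -
    obtain k y where k: "k \<ge> J" "w = dcube k y" using W(5) B w by blast
    show ?thesis
    proof (rule loc[OF k(2)])
      show "F \<inter> w \<subseteq> \<Union>{p \<in> C. p \<subseteq> w}"
      proof
        fix x assume x: "x \<in> F \<inter> w"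
        then obtain p where p: "p \<in> C" "x \<in> p" using WV B w C(2) by blast
        then have "p \<subseteq> w \<or> w \<subseteq> p" using C(1) W(1) B w x by (intro dyadic_trichotomy) auto
        then show "x \<in> \<Union>{p \<in> C. p \<subseteq> w}" using p w by (auto simp: B_def)
      qed
    qed (use k J C WV B w in auto)
  qed
  have "csum f B \<le> ennreal (1 / c) * csum f (tail_cubes J C)"
    using B W C bad c by (intro uncovered_whitney[of C]) (auto simp: pairwise_subset)
  also have "\<dots> \<le> ennreal (1 / c) * (ennreal c * e)"
    using J by (intro mult_left_mono) auto
  also have "\<dots> = e" using c by (simp add: mult.assoc[symmetric] ennreal_mult[symmetric])
  finally have "csum f (C \<union> B) \<le> csum f C + e"
    using csum_Un_le[of f C B] by (meson add_left_mono order_trans)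
  moreover have "V \<subseteq> \<Union>(C \<union> B)" using W(3) by (auto simp: B_def)
  moreover have "\<exists>k\<ge>J0. \<exists>y. w = dcube k y" if "w \<in> B" for w
    using W(5) B that J(1) by (meson order_trans subsetD)
  ultimately show ?thesis using that[of B] B W(1) by blast
qed

text \<open>A nested-cube (Baire type) argument: among the Whitney cubes of \<open>A m \<inter> interior q\<close> there is
  always one on which the proposed cover \<open>C\<close> is again too cheap, and the limit point escapes \<open>C\<close>.\<close>

lemma content_Inter:
  fixes f :: "'a::euclidean_space set \<Rightarrow> ennreal" and A :: "nat \<Rightarrow> 'a set"
  assumes A: "\<And>m. open (A m)" and c: "0 < c" "c \<le> 1" and L: "L \<in> dyadic_cubes"
    and base: "\<And>m q C. q \<in> dyadic_cubes \<Longrightarrow> q \<subseteq> L \<Longrightarrow> C \<subseteq> dyadic_cubes \<Longrightarrow> (\<And>p. p \<in> C \<Longrightarrow> p \<subseteq> q) \<Longrightarrow>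
       A m \<inter> interior q \<subseteq> \<Union>C \<Longrightarrow> ennreal c * f q \<le> csum f C"
    and pos: "\<And>q. q \<in> dyadic_cubes \<Longrightarrow> q \<subseteq> L \<Longrightarrow> 0 < f q \<and> f q < top"
    and C: "C \<subseteq> dyadic_cubes" "\<And>p. p \<in> C \<Longrightarrow> p \<subseteq> L" "(\<Inter>m. A m) \<inter> L \<subseteq> \<Union>C"
  shows "ennreal (c / 2) * f L \<le> csum f C"
proof (rule ccontr)
  assume "\<not> ?thesis"
  then have lt: "csum f C < ennreal (c / 2) * f L" by simp
  have fL: "0 < f L" "f L < top" using pos[OF L] by auto
  have half: "ennreal (c / 2) * f q + ennreal (c / 2) * f q = ennreal c * f q" for q
    using c by (simp flip: distrib_right ennreal_plus)
  have "ennreal (c / 2) * f L \<le> 1 * f L" using c by (intro mult_right_mono) auto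
  then have lt1: "csum f C < f L" and fin: "csum f C < top" using lt fL by (auto intro: less_trans less_le_trans)
  \<comment> \<open>A good cube is not swallowed by C, and the part of C inside it costs less than
    half of what \<open>base\<close> demands. The property reproduces itself on a Whitney cube at
    the next stage.\<close>
  define good where "good q \<longleftrightarrow> q \<in> dyadic_cubes \<and> q \<subseteq> L \<and> \<not> (\<exists>p\<in>C. q \<subseteq> p) \<and>
      csum f {p \<in> C. p \<subseteq> q} < ennreal (c / 2) * f q" for q
  have "good L"
  proof -
    have "{p \<in> C. p \<subseteq> L} = C" using C(2) by blast
    moreover have False if "p \<in> C" "L \<subseteq> p" for p
    proof -
      have "p = L" using that C(2) by blast
      then have "f L \<le> csum f C" using that csum_member[of L C f] by blast
      then show False using lt1 by simp
    qed
    ultimately show ?thesis using L lt by (auto simp: good_def)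
  qed
  have step: "\<exists>q'. good q' \<and> closure q' \<subseteq> A m \<inter> interior q" if q: "good q" for q m
  proof (rule ccontr)
    assume none: "\<not> ?thesis"
    have qd: "q \<in> dyadic_cubes" "q \<subseteq> L" using q by (auto simp: good_def)
    define D where "D = {p \<in> C. p \<subseteq> q}"
    have D: "csum f D < ennreal (c / 2) * f q" using q by (simp add: good_def D_def)
    \<comment> \<open>The unspent budget of q. If no Whitney cube were good, those not swallowed by
      C could be added to D for less than e, and the result would cover A m Int interior q for at
      most (c/2) f q, against \<open>base\<close>.\<close>
    define e where "e = ennreal (c / 2) * f q - csum f D"
    have e: "e > 0" unfolding e_def using D by (simp add: diff_gr0_ennreal)
    have finD: "csum f D < top" using D by (rule order_less_le_trans) simp
    have Dd: "D \<subseteq> dyadic_cubes" using C by (auto simp: D_def)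
    have "ennreal (c / 2) * e > 0" using e c by (simp add: ennreal_zero_less_mult_iff)
    then obtain J where J: "csum f (tail_cubes J D) < ennreal (c / 2) * e"
      using csum_tail_cubes[OF finD Dd] by blast
    have "open (A m \<inter> interior q)" using A by auto
    then obtain W where W: "W \<subseteq> dyadic_cubes" "\<And>w. w \<in> W \<Longrightarrow> closure w \<subseteq> A m \<inter> interior q"
      "\<Union>W = A m \<inter> interior q" "disjoint W" "\<And>w. w \<in> W \<Longrightarrow> \<exists>k\<ge>J. \<exists>y. w = dcube k y"
      by (rule whitney[of "A m \<inter> interior q" J]) (rule that)
    define B where "B = {w \<in> W. \<not> (\<exists>p\<in>C. w \<subseteq> p)}"
    have B: "B \<subseteq> W" by (auto simp: B_def)
    have Wq: "w \<subseteq> q" if "w \<in> W" for w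
      using W(2)[OF that] closure_subset interior_subset by blast
    have bad: "ennreal (c / 2) * f w \<le> csum f {p \<in> D. p \<subseteq> w}" if w: "w \<in> B" for w
    proof -
      have "\<not> good w" using none W(2) B w by blast
      moreover have "{p \<in> D. p \<subseteq> w} = {p \<in> C. p \<subseteq> w}"
        using Wq B w by (auto simp: D_def)
      moreover have "w \<in> dyadic_cubes" "w \<subseteq> L" "\<not> (\<exists>p\<in>C. w \<subseteq> p)"
        using w B W(1) Wq qd(2) by (auto simp: B_def)
      ultimately show ?thesis by (simp add: good_def not_less)
    qed
    have cov: "A m \<inter> interior q \<subseteq> \<Union>(D \<union> B)"
    proof
      fix x assume "x \<in> A m \<inter> interior q"
      then obtain w where w: "w \<in> W" "x \<in> w" using W(3) by blast
      show "x \<in> \<Union>(D \<union> B)"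
      proof (cases "w \<in> B")
        case False
        then obtain p where p: "p \<in> C" "w \<subseteq> p" using w by (auto simp: B_def)
        have "p \<subseteq> q \<or> q \<subseteq> p"
          using p w Wq[OF w(1)] C(1) qd(1) by (intro dyadic_trichotomy) auto
        then have "p \<in> D" using p q by (auto simp: good_def D_def)
        then show ?thesis using p w by blast
      qed (use w in blast)
    qed
    have "csum f B \<le> ennreal (1 / (c / 2)) * csum f (tail_cubes J D)"
      using B W Dd bad c finD by (intro uncovered_whitney[of D]) (auto simp: pairwise_subset)
    also have "\<dots> < ennreal (1 / (c / 2)) * (ennreal (c / 2) * e)"
      using J c by (intro ennreal_mult_strict_left_mono) auto
    also have "\<dots> = e" using c by (simp add: mult.assoc[symmetric] ennreal_mult[symmetric])
    finally have Be: "csum f B < e" .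
    have "ennreal c * f q \<le> csum f (D \<union> B)"
      by (rule base[OF qd _ _ cov]) (use Dd B W(1) Wq D_def in blast)+
    also have "\<dots> \<le> csum f D + csum f B" by (rule csum_Un_le)
    also have "\<dots> \<le> csum f D + e" using Be by (intro add_left_mono) auto
    also have "\<dots> = ennreal (c / 2) * f q"
      unfolding e_def using diff_add_cancel_ennreal[OF less_imp_le[OF D]] by (simp add: add.commute)
    finally have "ennreal (c / 2) * f q + ennreal (c / 2) * f q \<le> ennreal (c / 2) * f q"
      by (simp only: half)
    moreover have "0 < ennreal (c / 2) * f q" "ennreal (c / 2) * f q < top"
      using pos[OF qd] c by (auto simp: ennreal_zero_less_mult_iff ennreal_mult_less_top)
    ultimately show False
      using ennreal_add_left_cancel_le[of "ennreal (c / 2) * f q" "ennreal (c / 2) * f q" 0] by auto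
  qed
  define nxt where "nxt q m = (SOME q'. good q' \<and> closure q' \<subseteq> A m \<inter> interior q)" for q m
  define S where "S = rec_nat L (\<lambda>m q. nxt q m)"
  have S: "S 0 = L" "S (Suc m) = nxt (S m) m" for m by (auto simp: S_def)
  have nxt: "good (nxt q m) \<and> closure (nxt q m) \<subseteq> A m \<inter> interior q" if "good q" for q m
    unfolding nxt_def using step[OF that] by (rule someI_ex)
  have gS: "good (S m)" for m
    by (induction m) (auto simp: S nxt \<open>good L\<close>)
  have cl: "closure (S (Suc m)) \<subseteq> A m \<inter> interior (S m)" for m
    unfolding S using nxt[OF gS] by blast
  have ne: "S m \<noteq> {}" for m using gS[of m] dyadic_nonempty by (auto simp: good_def)
  \<comment> \<open>Generations increase strictly along the chain: if two consecutive cubes were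
    equal, the closure of a cube would lie in its own interior, and a nonempty clopen set is the
    whole space, which has infinite volume.\<close>
  have gen: "\<exists>k y. S m = dcube k y \<and> k \<ge> k0 + int m" if k0: "L = dcube k0 y0" for m k0 y0
  proof (induction m)
    case 0
    then show ?case using k0 S by auto
  next
    case (Suc m)
    then obtain k y where k: "S m = dcube k y" "k \<ge> k0 + int m" by blast
    obtain l z where l: "S (Suc m) = dcube l z" using gS unfolding good_def by (meson dyadic_cubesE)
    have sub: "S (Suc m) \<subseteq> interior (S m)" using cl[of m] closure_subset by blast
    then have "k \<le> l" using l k interior_subset dcube_gen_inj by (metis subset_trans)
    moreover have "k \<noteq> l"
    proof
      assume "k = l"
      then have "S (Suc m) = S m" using l k sub interior_subset dcube_refl dcube_eqI by (metis subsetD)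
      then have "closure (S m) \<subseteq> interior (S m)" using cl[of m] by auto
      then have "closure (S m) = interior (S m)" using closure_subset interior_subset by blast
      then have "open (S m) \<and> closed (S m)"
        using closure_subset interior_subset
        by (metis closed_closure open_interior subset_antisym)
      then have "S m = UNIV" using ne clopen by auto
      then have "emeasure lborel (UNIV :: 'a set) < top" using k(1) emeasure_dcube[of k y] by simp
      then show False by (simp add: emeasure_lborel_UNIV)
    qed
    ultimately show ?case using l k by (intro exI[of _ l] exI[of _ z]) auto
  qed
  obtain k0 y0 where k0: "L = dcube k0 y0" using L by (rule dyadic_cubesE)
  have "\<exists>x. \<forall>m. x \<in> closure (S m)"
  proof -
    have "bounded L" unfolding k0 using dcube_box(2) bounded_cbox bounded_subset by blast
    then have "compact (closure L)" by simp
    have mono: "closure (S n) \<subseteq> closure (S m)" if "m \<le> n" for m n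
      using that
    proof (induction n rule: dec_induct)
      case (step n)
      have "closure (S (Suc n)) \<subseteq> closure (S n)"
        using cl[of n] interior_subset closure_subset by blast
      then show ?case using step by blast
    qed simp
    have "\<Inter>(range (\<lambda>m. closure (S m))) \<noteq> {}"
    proof (rule compact_nest)
      show "compact (closure (S m))" for m
        using mono[of 0 m] \<open>compact (closure L)\<close> S closed_closure compact_closure
        by (metis bounded_subset closure_closure compact_imp_bounded le0)
      show "closure (S m) \<noteq> {}" for m using ne by simp
      show "closure (S n) \<subseteq> closure (S m)" if "m \<le> n" for m n using mono[OF that] .
    qed
    then show ?thesis by blast
  qed
  then obtain x where x: "\<And>m. x \<in> closure (S m)" by blast
  have xx: "x \<in> A m" "x \<in> S m" for m using x[of "Suc m"] cl[of m] interior_subset by blast+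
  then have "x \<in> L" using S(1) by metis
  then obtain p where p: "p \<in> C" "x \<in> p" using C(3) xx(1) by blast
  obtain l z where l: "p = dcube l z" using p C(1) by (meson dyadic_cubesE subsetD)
  \<comment> \<open>The chain starts at generation k0 and gains at least 1 per step, so this cube is
    at least as fine as p. It contains x as well, hence lies inside p, which a good cube must not
    do.\<close>
  obtain k y where k: "S (nat (l - k0)) = dcube k y" "k \<ge> k0 + int (nat (l - k0))"
    using gen[OF k0] by blast
  have "dcube k y \<subseteq> dcube l z"
  proof (rule dcube_subset)
    show "l \<le> k" using k(2) by linarith
    show "dcube k y \<inter> dcube l z \<noteq> {}" using k(1) p xx(2)[of "nat (l - k0)"] l by auto
  qed
  then show False using gS[of "nat (l - k0)"] p l k by (auto simp: good_def)
qed

section \<open>The mass distribution argument\<close>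

text \<open>Indices are scanned in increasing order and accepted when compatible with all accepted
  earlier ones, so each rejection is blamed on a smaller index. With decreasing radii this means a
  ball at least as large, as in Vitali's covering lemma.\<close>

lemma greedy_selection:
  fixes J :: "nat set" and P :: "nat \<Rightarrow> nat \<Rightarrow> bool"
  obtains I where "I \<subseteq> J" "\<And>i k. i \<in> I \<Longrightarrow> k \<in> I \<Longrightarrow> i < k \<Longrightarrow> P i k"
    "\<And>j. j \<in> J \<Longrightarrow> j \<notin> I \<Longrightarrow> \<exists>i\<in>I. i < j \<and> \<not> P i j"
proof -
  define S where "S = rec_nat {} (\<lambda>n A. if n \<in> J \<and> (\<forall>i\<in>A. P i n) then insert n A else A)"
  have S: "S 0 = {}" "S (Suc n) = (if n \<in> J \<and> (\<forall>i\<in>S n. P i n) then insert n (S n) else S n)" for n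
    by (auto simp: S_def)
  define I where "I = {n \<in> J. \<forall>i\<in>S n. P i n}"
  have SI: "S n = I \<inter> {..<n}" for n
  proof (induction n)
    case (Suc n)
    have "{..<Suc n} = insert n {..<n}" by auto
    then show ?case unfolding S(2) Suc by (auto simp: I_def Suc)
  qed (simp add: S)
  show ?thesis
  proof
    show "I \<subseteq> J" by (auto simp: I_def)
    show "P i k" if "i \<in> I" "k \<in> I" "i < k" for i k
      using that SI[of k] by (auto simp: I_def)
    show "\<exists>i\<in>I. i < j \<and> \<not> P i j" if "j \<in> J" "j \<notin> I" for j
      using that SI[of j] by (auto simp: I_def)
  qed
qed

lemma emeasure_le_csum:
  assumes "countable C" "\<And>q. q \<in> C \<Longrightarrow> q \<in> sets M" "A \<in> sets M" "A \<subseteq> \<Union>C"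
  shows "emeasure M A \<le> csum (\<lambda>q. emeasure M (q \<inter> A)) C"
proof -
  have "emeasure M A = (\<integral>\<^sup>+x. indicator A x \<partial>M)" using assms by simp
  also have "\<dots> \<le> (\<integral>\<^sup>+x. csum (\<lambda>q. indicator (q \<inter> A) x) C \<partial>M)"
  proof (rule nn_integral_mono)
    fix x show "indicator A x \<le> csum (\<lambda>q. indicator (q \<inter> A) x :: ennreal) C"
    proof (cases "x \<in> A")
      case True
      then obtain q where "q \<in> C" "x \<in> q" using assms by blast
      then show ?thesis using csum_member[of q C "\<lambda>q. indicator (q \<inter> A) x"] True by simp
    qed simp
  qed
  also have "\<dots> = csum (\<lambda>q. \<integral>\<^sup>+x. indicator (q \<inter> A) x \<partial>M) C"
    unfolding csum_count_space using assms
    by (intro nn_integral_count_space_nn_integral) auto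
  also have "\<dots> = csum (\<lambda>q. emeasure M (q \<inter> A)) C"
    unfolding csum_count_space using assms by (intro nn_integral_cong) auto
  finally show ?thesis .
qed

lemma csum_sum:
  "csum (\<lambda>q. \<Sum>n\<in>I. f n q) C = (\<Sum>n\<in>I. csum (f n) C)"
  unfolding csum_count_space by (rule nn_integral_sum) simp

text \<open>The real profile of a d-normalized gauge with infinite \<open>ell\<close>. The product
  inequality says that \<phi> t / t^d is nonincreasing, cleared of denominators.\<close>

definition dim_gauge :: "nat \<Rightarrow> (real \<Rightarrow> real) \<Rightarrow> real \<Rightarrow> bool" where
  "dim_gauge d \<phi> \<epsilon> \<longleftrightarrow> \<epsilon> > 0 \<and> (\<forall>t. 0 < t \<and> t \<le> \<epsilon> \<longrightarrow> 0 < \<phi> t)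
     \<and> (\<forall>s t. 0 < s \<and> s \<le> t \<and> t \<le> \<epsilon> \<longrightarrow> \<phi> s \<le> \<phi> t \<and> \<phi> t * s ^ d \<le> \<phi> s * t ^ d)
     \<and> (\<phi> \<longlongrightarrow> 0) (at_right 0) \<and> filterlim (\<lambda>t. \<phi> t / t ^ d) at_top (at_right 0)"

context euclidean_norm
begin

lemma vN_nonzero [simp]: "vN \<noteq> 0" and kap_nonzero [simp]: "kap \<noteq> 0"
  using vN_pos kap_pos by linarith+

lemma disjoint_nball_measure:
  assumes I: "finite I" and R: "\<And>i. i \<in> I \<Longrightarrow> 0 < R i"
    and sep: "\<And>i k. i \<in> I \<Longrightarrow> k \<in> I \<Longrightarrow> i \<noteq> k \<Longrightarrow> R i + R k \<le> N (x i - x k)"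
    and sub: "\<And>i. i \<in> I \<Longrightarrow> nball (x i) (R i) \<subseteq> nball z \<rho>" and \<rho>: "\<rho> > 0"
  shows "(\<Sum>i\<in>I. R i ^ DIM('a)) \<le> \<rho> ^ DIM('a)"
proof -
  have "disjoint_family_on (\<lambda>i. nball (x i) (R i)) I"
    unfolding disjoint_family_on_def
  proof (intro ballI impI)
    fix i k assume ik: "i \<in> I" "k \<in> I" "i \<noteq> k"
    have False if "N (y - x i) < R i" "N (y - x k) < R k" for y
      using N_diff_triangle[of "x i" "x k" y] N_diff_commute[of "x i" y] that sep[OF ik] by linarith
    then show "nball (x i) (R i) \<inter> nball (x k) (R k) = {}" by auto
  qed
  then have "(\<Sum>i\<in>I. emeasure lborel (nball (x i) (R i))) = emeasure lborel (\<Union>i\<in>I. nball (x i) (R i))"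
    using I by (intro sum_emeasure) auto
  also have "\<dots> \<le> emeasure lborel (nball z \<rho>)"
    using sub by (intro emeasure_mono) auto
  also have "\<dots> = ennreal (vN * \<rho> ^ DIM('a))" using \<rho> by (rule emeasure_nball)
  also have "(\<Sum>i\<in>I. emeasure lborel (nball (x i) (R i))) = (\<Sum>i\<in>I. ennreal (vN * R i ^ DIM('a)))"
    using R by (intro sum.cong emeasure_nball) auto
  also have "\<dots> = ennreal (vN * (\<Sum>i\<in>I. R i ^ DIM('a)))"
    using R vN_pos by (subst sum_ennreal) (auto simp: sum_distrib_left less_imp_le)
  finally show ?thesis using vN_pos \<rho> by (simp add: less_imp_le)
qed

text \<open>Vitali selection in index order: a rejected ball meeting the half-size ball lies in the
  threefold enlargement of an earlier selected one. Radii at most \<rho>/4 keep every selected ball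
  inside radius \<rho>/2 + 2 \<rho>/4 = \<rho>.\<close>

lemma ball_selection:
  fixes x :: "nat \<Rightarrow> 'a" and R :: "nat \<Rightarrow> real"
  assumes \<rho>: "\<rho> > 0"
    and cov: "AE y in lborel. y \<in> nball z (\<rho> / 2) \<longrightarrow> (\<exists>n\<ge>m. N (y - x n) < R n)"
    and R: "decseq R" "\<And>n. n \<ge> m \<Longrightarrow> 0 < R n" "\<And>n. n \<ge> m \<Longrightarrow> R n \<le> \<rho> / 4"
  shows "\<exists>I. finite I \<and> I \<subseteq> {m..} \<and> (\<forall>i\<in>I. nball (x i) (R i) \<subseteq> nball z \<rho>)
    \<and> (\<forall>i\<in>I. \<forall>k\<in>I. i \<noteq> k \<longrightarrow> R i + R k \<le> N (x i - x k))
    \<and> (\<rho> / 12) ^ DIM('a) \<le> (\<Sum>i\<in>I. R i ^ DIM('a))"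
proof -
  define J where "J = {n. n \<ge> m \<and> nball (x n) (R n) \<inter> nball z (\<rho> / 2) \<noteq> {}}"
  obtain I where I: "I \<subseteq> J" "\<And>i k. i \<in> I \<Longrightarrow> k \<in> I \<Longrightarrow> i < k \<Longrightarrow> R i + R k \<le> N (x i - x k)"
    "\<And>j. j \<in> J \<Longrightarrow> j \<notin> I \<Longrightarrow> \<exists>i\<in>I. i < j \<and> \<not> R i + R j \<le> N (x i - x j)"
    by (rule greedy_selection[of J "\<lambda>i k. R i + R k \<le> N (x i - x k)"]) (rule that)
  have Im: "i \<ge> m" if "i \<in> I" for i using that I(1) by (auto simp: J_def)
  have sub: "nball (x i) (R i) \<subseteq> nball z \<rho>" if i: "i \<in> I" for i
  proof
    fix y assume y: "y \<in> nball (x i) (R i)"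
    have "nball (x i) (R i) \<inter> nball z (\<rho> / 2) \<noteq> {}" using i I(1) by (auto simp: J_def)
    then obtain w where w: "N (w - x i) < R i" "N (w - z) < \<rho> / 2"
      unfolding nball_def by blast
    have "N (y - z) \<le> N (y - x i) + (N (w - x i) + N (w - z))"
      using N_diff_triangle[of y z "x i"] N_diff_triangle[of "x i" z w] N_diff_commute[of w "x i"] by linarith
    then show "y \<in> nball z \<rho>" using y w R(3)[OF Im[OF i]] by auto
  qed
  define B where "B n = (if n \<in> I then nball (x n) (3 * R n) else {})" for n
  have "AE y in lborel. y \<in> nball z (\<rho> / 2) \<longrightarrow> y \<in> (\<Union>n. B n)"
    using cov
  proof eventually_elim
    case (elim y)
    show ?case
    proof
      assume y: "y \<in> nball z (\<rho> / 2)"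
      then obtain n where n: "n \<ge> m" "N (y - x n) < R n" using elim by blast
      have nJ: "n \<in> J" using n y by (auto simp: J_def)
      show "y \<in> (\<Union>n. B n)"
      proof (cases "n \<in> I")
        case True
        then show ?thesis using n R(2)[OF n(1)] by (auto simp: B_def intro!: bexI[of _ n])
      next
        case False
        then obtain i where i: "i \<in> I" "i < n" "N (x i - x n) < R i + R n" using I(3)[OF nJ] by auto
        have "R n \<le> R i" using R(1) i(2) by (simp add: decseqD)
        then have "N (y - x i) < 3 * R i"
          using i n N_diff_triangle[of y "x i" "x n"] N_diff_commute[of "x i" "x n"] by linarith
        then show ?thesis using i by (auto simp: B_def intro!: exI[of _ i])
      qed
    qed
  qed
  then have "emeasure lborel (nball z (\<rho> / 2)) \<le> emeasure lborel (\<Union>n. B n)"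
    by (intro emeasure_mono_AE) (auto simp: B_def)
  also have "\<dots> \<le> (\<Sum>n. emeasure lborel (B n))"
    by (intro emeasure_subadditive_countably) (auto simp: B_def)
  finally have le: "ennreal (vN * (\<rho> / 2) ^ DIM('a)) \<le> (\<Sum>n. emeasure lborel (B n))"
    using \<rho> by (simp add: emeasure_nball)
  have eB: "emeasure lborel (B n) = ennreal (if n \<in> I then vN * (3 * R n) ^ DIM('a) else 0)" for n
    using R(2)[OF Im] by (auto simp: B_def emeasure_nball)
  \<comment> \<open>The enlarged balls have total volume at least that of radius \<rho>/2. Giving
    away part of it, down to \<rho>/4, makes the inequality strict, so a finite partial sum
    suffices; division by the enlargement factor 3 leaves \<rho>/12.\<close>
  have "(\<rho> / 4) ^ DIM('a) < (\<rho> / 2) ^ DIM('a)" using \<rho> by (intro power_strict_mono) auto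
  then have "ennreal (vN * (\<rho> / 4) ^ DIM('a)) < ennreal (vN * (\<rho> / 2) ^ DIM('a))"
    using vN_pos \<rho> by (intro ennreal_lessI) auto
  also note le
  also have "(\<Sum>n. emeasure lborel (B n)) = (SUP K. \<Sum>n<K. emeasure lborel (B n))" by (rule suminf_eq_SUP)
  finally obtain K where "ennreal (vN * (\<rho> / 4) ^ DIM('a)) < (\<Sum>n<K. emeasure lborel (B n))"
    unfolding less_SUP_iff by blast
  also have "\<dots> = ennreal (\<Sum>n<K. if n \<in> I then vN * (3 * R n) ^ DIM('a) else 0)"
    unfolding eB using R(2)[OF Im] vN_pos by (intro sum_ennreal) (auto simp: less_imp_le)
  also have "(\<Sum>n<K. if n \<in> I then vN * (3 * R n) ^ DIM('a) else 0)
      = (\<Sum>n\<in>I \<inter> {..<K}. vN * (3 * R n) ^ DIM('a))"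
    by (simp add: sum.If_cases Int_commute)
  also have "\<dots> = vN * (3 ^ DIM('a) * (\<Sum>n\<in>I \<inter> {..<K}. R n ^ DIM('a)))"
    by (simp add: sum_distrib_left power_mult_distrib mult.assoc)
  finally have "vN * (\<rho> / 4) ^ DIM('a) \<le> vN * (3 ^ DIM('a) * (\<Sum>n\<in>I \<inter> {..<K}. R n ^ DIM('a)))"
    using vN_pos \<rho> by (simp add: ennreal_less_iff less_imp_le)
  then have "(\<rho> / 4) ^ DIM('a) \<le> 3 ^ DIM('a) * (\<Sum>n\<in>I \<inter> {..<K}. R n ^ DIM('a))"
    using vN_pos by simp
  moreover have "(\<rho> / 4) ^ DIM('a) = 3 ^ DIM('a) * (\<rho> / 12) ^ DIM('a)"
    by (simp flip: power_mult_distrib)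
  ultimately have "(\<rho> / 12) ^ DIM('a) \<le> (\<Sum>n\<in>I \<inter> {..<K}. R n ^ DIM('a))" by simp
  moreover have "R i + R k \<le> N (x i - x k)" if "i \<in> I \<inter> {..<K}" "k \<in> I \<inter> {..<K}" "i \<noteq> k" for i k
    using I(2)[of i k] I(2)[of k i] that N_diff_commute[of "x i" "x k"] by (cases i k rule: linorder_cases) auto
  ultimately show ?thesis using Im sub by (intro exI[of _ "I \<inter> {..<K}"]) auto
qed

text \<open>If \<open>q\<close> meets two of the small balls, it is at least as large as the gaps between them, hence
  the disjoint big balls around them are packed in a neighbourhood of \<open>q\<close> of comparable size.\<close>

lemma mass_dcube_le:
  fixes x :: "nat \<Rightarrow> 'a" and R r :: "nat \<Rightarrow> real" and k :: int
  defines "t \<equiv> cube_diam k"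
  assumes \<phi>: "dim_gauge DIM('a) \<phi> \<epsilon>" and I: "finite I" and a: "a > 0"
    and r: "\<And>i. i \<in> I \<Longrightarrow> 0 < r i \<and> r i \<le> \<epsilon> \<and> 2 * r i \<le> R i \<and> R i ^ DIM('a) = a * \<phi> (r i)"
    and sep: "\<And>i k. i \<in> I \<Longrightarrow> k \<in> I \<Longrightarrow> i \<noteq> k \<Longrightarrow> R i + R k \<le> N (x i - x k)"
    and t: "t \<le> \<epsilon>" "t ^ DIM('a) \<le> a * \<phi> t"
  shows "(\<Sum>i\<in>I. ennreal (R i ^ DIM('a) / (vN * r i ^ DIM('a))) * emeasure lborel (dcube k w \<inter> nball (x i) (r i)))
     \<le> ennreal ((1 + 1 / (vN * kap ^ DIM('a)) + 4 ^ DIM('a)) * a * \<phi> t)"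
proof -
  let ?d = "DIM('a)"
  define I' where "I' = {i \<in> I. dcube k w \<inter> nball (x i) (r i) \<noteq> {}}"
  define T where "T i = ennreal (R i ^ ?d / (vN * r i ^ ?d)) * emeasure lborel (dcube k w \<inter> nball (x i) (r i))" for i
  have tpos: "t > 0" by (simp add: t_def)
  have \<phi>t: "\<phi> t > 0" using \<phi> tpos t by (auto simp: dim_gauge_def)
  have rp: "0 < r i" "r i \<le> \<epsilon>" "2 * r i \<le> R i" "R i ^ ?d = a * \<phi> (r i)" "0 < R i" if "i \<in> I" for i
    using r[OF that] by auto
  have sumI': "sum T I = sum T I'"
    using I by (intro sum.mono_neutral_right) (auto simp: I'_def T_def)
  \<comment> \<open>Two bounds for the mass that one ball puts into the cube: its whole mass
    (\<open>T1\<close>), or its density times the volume of the cube (\<open>T2\<close>).\<close>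
  have T1: "T i \<le> ennreal (R i ^ ?d)" if i: "i \<in> I" for i
  proof -
    have "T i \<le> ennreal (R i ^ ?d / (vN * r i ^ ?d)) * emeasure lborel (nball (x i) (r i))"
      unfolding T_def by (intro mult_left_mono emeasure_mono) auto
    also have "\<dots> = ennreal (R i ^ ?d / (vN * r i ^ ?d) * (vN * r i ^ ?d))"
      unfolding emeasure_nball[OF rp(1)[OF i]] using rp(1,5)[OF i] vN_pos
      by (intro ennreal_mult[symmetric]) (auto simp: less_imp_le)
    also have "R i ^ ?d / (vN * r i ^ ?d) * (vN * r i ^ ?d) = R i ^ ?d"
      using rp(1)[OF i] less_imp_neq[OF vN_pos] by simp
    finally show ?thesis .
  qed
  have T2: "T i \<le> ennreal (R i ^ ?d / (vN * r i ^ ?d) * (t ^ ?d / kap ^ ?d))" if i: "i \<in> I" for i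
  proof -
    have "T i \<le> ennreal (R i ^ ?d / (vN * r i ^ ?d)) * emeasure lborel (dcube k w)"
      unfolding T_def by (intro mult_left_mono emeasure_mono) auto
    also have "\<dots> = ennreal (R i ^ ?d / (vN * r i ^ ?d) * (2 powr - of_int k) ^ ?d)"
      unfolding emeasure_dcube using rp(1,5)[OF i] vN_pos
      by (intro ennreal_mult[symmetric]) (auto simp: less_imp_le)
    also have "(2 powr - of_int k) ^ ?d = t ^ ?d / kap ^ ?d"
      using less_imp_neq[OF kap_pos] by (simp add: t_def power_mult_distrib)
    finally show ?thesis .
  qed
  \<comment> \<open>A ball with r_i <= t is bounded by its whole mass and monotonicity of \<phi>; a
    larger one by its density and monotonicity of \<phi> t / t^d.\<close>
  have single: "T i \<le> ennreal ((1 + 1 / (vN * kap ^ ?d)) * a * \<phi> t)" if i: "i \<in> I" for i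
  proof (cases "r i \<le> t")
    case True
    then have "\<phi> (r i) \<le> \<phi> t" using \<phi> t rp[OF i] by (auto simp: dim_gauge_def)
    then have "R i ^ ?d \<le> 1 * (a * \<phi> t)" using rp[OF i] a by simp
    also have "\<dots> \<le> (1 + 1 / (vN * kap ^ ?d)) * (a * \<phi> t)"
      using a \<phi>t by (intro mult_right_mono) (auto simp: less_imp_le)
    finally have "R i ^ ?d \<le> (1 + 1 / (vN * kap ^ ?d)) * a * \<phi> t" by (simp only: mult.assoc)
    then show ?thesis by (rule order_trans[OF T1[OF i] ennreal_leI])
  next
    case False
    then have "\<phi> (r i) * t ^ ?d \<le> \<phi> t * r i ^ ?d" using \<phi> tpos rp[OF i] by (auto simp: dim_gauge_def)
    then have "\<phi> (r i) / r i ^ ?d * t ^ ?d \<le> \<phi> t" using rp[OF i] by (simp add: field_simps)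
    then have "a * (\<phi> (r i) / r i ^ ?d * t ^ ?d) \<le> a * \<phi> t" using a by (intro mult_left_mono) auto
    then have "R i ^ ?d / r i ^ ?d * t ^ ?d \<le> a * \<phi> t" using rp(4)[OF i] by simp
    then have "(1 / (vN * kap ^ ?d)) * (R i ^ ?d / r i ^ ?d * t ^ ?d) \<le> (1 / (vN * kap ^ ?d)) * (a * \<phi> t)"
      by (intro mult_left_mono) (auto simp: less_imp_le)
    moreover have "(1 / (vN * kap ^ ?d)) * (R i ^ ?d / r i ^ ?d * t ^ ?d)
        = R i ^ ?d / (vN * r i ^ ?d) * (t ^ ?d / kap ^ ?d)" by simp
    ultimately have "R i ^ ?d / (vN * r i ^ ?d) * (t ^ ?d / kap ^ ?d) \<le> (1 / (vN * kap ^ ?d)) * (a * \<phi> t)"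
      by (simp only:)
    also have "\<dots> \<le> (1 + 1 / (vN * kap ^ ?d)) * (a * \<phi> t)"
      using a \<phi>t by (intro mult_right_mono) (auto simp: less_imp_le)
    finally have "R i ^ ?d / (vN * r i ^ ?d) * (t ^ ?d / kap ^ ?d) \<le> (1 + 1 / (vN * kap ^ ?d)) * a * \<phi> t"
      by (simp only: mult.assoc)
    then show ?thesis by (rule order_trans[OF T2[OF i] ennreal_leI])
  qed
  have K: "(1 + 1 / (vN * kap ^ ?d)) * a * \<phi> t \<le> (1 + 1 / (vN * kap ^ ?d) + 4 ^ ?d) * a * \<phi> t"
    "4 ^ ?d * (a * \<phi> t) \<le> (1 + 1 / (vN * kap ^ ?d) + 4 ^ ?d) * a * \<phi> t"
    unfolding mult.assoc using a \<phi>t by (auto intro!: mult_right_mono simp: less_imp_le)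
  have "sum T I' \<le> ennreal ((1 + 1 / (vN * kap ^ ?d) + 4 ^ ?d) * a * \<phi> t)"
  proof (cases "\<exists>i. I' \<subseteq> {i}")
    case True
    then consider "I' = {}" | i where "I' = {i}" by blast
    then show ?thesis
    proof cases
      case 2
      then have "i \<in> I" by (auto simp: I'_def)
      then show ?thesis using 2 single[of i] K(1) by (simp add: order_trans[OF _ ennreal_leI])
    qed simp
  next
    case False
    \<comment> \<open>Separation gives R_i + R_l <= r_i + r_l + t, and each r is at most half of its
      R, so R_i + R_l <= 2 t.\<close>
    have small: "R i \<le> 2 * t" "r i \<le> t" if i: "i \<in> I'" for i
    proof -
      obtain l where l: "l \<in> I'" "l \<noteq> i" using False by blast
      obtain u v where uv: "u \<in> dcube k w" "N (u - x i) < r i" "v \<in> dcube k w" "N (v - x l) < r l"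
        using i l by (auto simp: I'_def)
      have il: "i \<in> I" "l \<in> I" using i l by (auto simp: I'_def)
      have "N (x i - x l) \<le> N (u - x i) + (t + N (v - x l))"
        using N_diff_triangle[of "x i" "x l" u] N_diff_triangle[of u "x l" v] N_diff_commute[of "x i" u]
          N_diff_dcube[OF uv(1,3)] unfolding t_def by linarith
      then have "R i + R l \<le> r i + r l + t" using sep[OF il] l uv by auto
      then show "R i \<le> 2 * t" "r i \<le> t" using rp[OF il(1)] rp[OF il(2)] by auto
    qed
    have "(\<Sum>i\<in>I'. R i ^ ?d) \<le> (4 * t) ^ ?d"
    proof (rule disjoint_nball_measure)
      \<comment> \<open>The distance to w is below R_i + r_i + t, at most 2 t + t + t.\<close>
      show "nball (x i) (R i) \<subseteq> nball w (4 * t)" if i: "i \<in> I'" for i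
      proof
        fix y assume y: "y \<in> nball (x i) (R i)"
        obtain u where u: "u \<in> dcube k w" "N (u - x i) < r i" using i by (auto simp: I'_def)
        have "N (y - w) \<le> N (y - x i) + (N (u - x i) + t)"
          using N_diff_triangle[of y w "x i"] N_diff_triangle[of "x i" w u] N_diff_commute[of "x i" u]
            N_diff_dcube[OF u(1) dcube_refl] unfolding t_def by linarith
        then show "y \<in> nball w (4 * t)" using y u small[OF i] by auto
      qed
    qed (use I tpos rp sep in \<open>auto simp: I'_def\<close>)
    also have "\<dots> = 4 ^ ?d * t ^ ?d" by (simp add: power_mult_distrib)
    also have "\<dots> \<le> 4 ^ ?d * (a * \<phi> t)" using t by simp
    also note K(2)
    finally have "ennreal (\<Sum>i\<in>I'. R i ^ ?d) \<le> ennreal ((1 + 1 / (vN * kap ^ ?d) + 4 ^ ?d) * a * \<phi> t)"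
      by (rule ennreal_leI)
    moreover have "sum T I' \<le> ennreal (\<Sum>i\<in>I'. R i ^ ?d)"
    proof -
      have "sum T I' \<le> (\<Sum>i\<in>I'. ennreal (R i ^ ?d))"
        by (intro sum_mono T1) (auto simp: I'_def)
      also have "\<dots> = ennreal (\<Sum>i\<in>I'. R i ^ ?d)"
        using rp(5) by (intro sum_ennreal) (auto simp: I'_def less_imp_le)
      finally show ?thesis .
    qed
    ultimately show ?thesis by (rule order_trans[rotated])
  qed
  then show ?thesis using sumI' by (simp add: T_def)
qed

text \<open>The cost of a cube read off from the real profile; cubes have finite diameter, so
  \<open>enn2real\<close> loses nothing on them.\<close>

definition wt :: "(real \<Rightarrow> real) \<Rightarrow> 'a set \<Rightarrow> ennreal" where
  "wt \<phi> q = ennreal (\<phi> (enn2real (ediam N q)))"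

lemma wt_dcube [simp]: "wt \<phi> (dcube k w) = ennreal (\<phi> (cube_diam k))"
  by (simp add: wt_def ediam_dcube less_imp_le)

text \<open>The cost of a cover bounds the mass from above, since each cube carries at most K a
  times its weight, while the selected balls carry at least (\<rho>/12)^d. The quotient is
  proportional to \<phi> of the diameter, with a factor that depends only on the norm and the
  dimension.\<close>

lemma ball_content:
  assumes \<phi>: "dim_gauge DIM('a) \<phi> \<epsilon>" and eut: "uniformly_eutaxic N U x"
    and r: "decseq r" "\<And>n. 0 < r n" "r \<longlonglongrightarrow> 0" and nsum: "\<not> summable (\<lambda>n. \<phi> (min (r n) \<epsilon>))"
  obtains c where "0 < c" "c \<le> 1"
    "\<And>j y m C. dcube j y \<subseteq> U \<Longrightarrow> cube_diam j \<le> \<epsilon> \<Longrightarrow> C \<subseteq> dyadic_cubes \<Longrightarrow>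
      (\<And>p. p \<in> C \<Longrightarrow> p \<subseteq> dcube j y) \<Longrightarrow>
      (\<Union>n\<in>{m..}. nball (x n) (r n)) \<inter> interior (dcube j y) \<subseteq> \<Union>C \<Longrightarrow>
      ennreal c * wt \<phi> (dcube j y) \<le> csum (wt \<phi>) C"
proof -
  let ?d = "DIM('a)"
  obtain b where b: "b > 0" "\<And>j y. \<exists>z. nball z (b * 2 powr - of_int j) \<subseteq> interior (dcube j (y::'a))"
    using center_ball by blast
  \<comment> \<open>The constant of \<open>mass_dcube_le\<close>: two terms for the case of a single
    ball, and 4^d for a packing of several.\<close>
  define K where "K = 1 + 1 / (vN * kap ^ ?d) + 4 ^ ?d"
  have K: "K > 0" unfolding K_def by (intro add_pos_pos) (auto intro!: divide_pos_pos mult_pos_pos)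
  \<comment> \<open>This is (\<rho>/12)^d / (K a \<phi> D) with \<rho> = b D / \<open>kap\<close>
    and a = D^d / \<phi> D; the dependence on D cancels.\<close>
  define c where "c = min 1 ((b / (12 * kap)) ^ ?d / K)"
  have c: "0 < c" "c \<le> 1" using b K by (auto simp: c_def)
  have main: "ennreal c * wt \<phi> (dcube j y) \<le> csum (wt \<phi>) C"
    if jU: "dcube j y \<subseteq> U" and D\<epsilon>: "cube_diam j \<le> \<epsilon>" and C: "C \<subseteq> dyadic_cubes"
      "\<And>p. p \<in> C \<Longrightarrow> p \<subseteq> dcube j y" "(\<Union>n\<in>{m..}. nball (x n) (r n)) \<inter> interior (dcube j y) \<subseteq> \<Union>C"
    for j y m C
  proof -
    define D where "D = cube_diam j"
    have D: "0 < D" "D \<le> \<epsilon>" using D\<epsilon> by (auto simp: D_def)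
    have g: "0 < \<epsilon>" "\<And>t. 0 < t \<Longrightarrow> t \<le> \<epsilon> \<Longrightarrow> 0 < \<phi> t"
      "\<And>s t. 0 < s \<Longrightarrow> s \<le> t \<Longrightarrow> t \<le> \<epsilon> \<Longrightarrow> \<phi> s \<le> \<phi> t"
      "\<And>s t. 0 < s \<Longrightarrow> s \<le> t \<Longrightarrow> t \<le> \<epsilon> \<Longrightarrow> \<phi> t * s ^ ?d \<le> \<phi> s * t ^ ?d"
      "(\<phi> \<longlongrightarrow> 0) (at_right 0)" "filterlim (\<lambda>t. \<phi> t / t ^ ?d) at_top (at_right 0)"
      using \<phi> by (auto simp: dim_gauge_def)
    define a where "a = D ^ ?d / \<phi> D"
    have a: "a > 0" using D g(2)[OF D] by (simp add: a_def)
    define \<rho> where "\<rho> = b * 2 powr - of_int j"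
    have \<rho>: "\<rho> > 0" using b by (simp add: \<rho>_def)
    obtain z where z: "nball z \<rho> \<subseteq> interior (dcube j y)" unfolding \<rho>_def using b(2) by blast
    \<comment> \<open>Truncation at \<epsilon> keeps all arguments where \<phi> is monotone, so that
      the enlarged radii form a decreasing sequence from the first index on, as membership in
      \<open>Pd\<close> requires.\<close>
    define s where "s n = min (r n) \<epsilon>" for n
    have s: "0 < s n" "s n \<le> \<epsilon>" for n using r g by (auto simp: s_def)
    define R where "R n = root ?d (a * \<phi> (s n))" for n
    have Rpos: "R n > 0" for n using a g(2)[OF s] by (simp add: R_def)
    have Rd: "R n ^ ?d = a * \<phi> (s n)" for n
      unfolding R_def using a g(2)[OF s] by (intro real_root_pow_pos2) (auto simp: less_imp_le)
    have r0: "filterlim r (at_right 0) sequentially"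
      using r(2,3) by (auto simp: filterlim_at intro!: always_eventually less_imp_neq[symmetric])
    have ev\<epsilon>: "\<forall>\<^sub>F n in sequentially. r n < \<epsilon>" using r(3) g(1) by (rule order_tendstoD)
    then have evs: "\<forall>\<^sub>F n in sequentially. s n = r n" by eventually_elim (auto simp: s_def)
    have "(\<lambda>n. \<phi> (r n)) \<longlonglongrightarrow> 0" using g(5) r0 by (rule filterlim_compose)
    then have "(\<lambda>n. \<phi> (s n)) \<longlonglongrightarrow> 0"
      by (rule Lim_transform_eventually) (use evs in \<open>auto elim: eventually_mono\<close>)
    then have "(\<lambda>n. root ?d (a * \<phi> (s n))) \<longlonglongrightarrow> root ?d (a * 0)" by (intro tendsto_intros)
    then have R0: "R \<longlonglongrightarrow> 0" by (simp add: R_def[abs_def])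
    have Rdec: "decseq R"
    proof (rule decseq_SucI)
      fix n
      have "s (Suc n) \<le> s n" using r(1) by (auto simp: s_def min_le_iff_disj decseq_Suc_iff)
      then show "R (Suc n) \<le> R n"
        unfolding R_def using a g(3)[OF s(1) _ s(2)] by (intro real_root_le_mono mult_left_mono) auto
    qed
    have "R \<in> Pd ?d"
    proof -
      have "\<not> summable (\<lambda>n. a * \<phi> (s n))" using nsum a by (simp add: s_def)
      then show ?thesis using Rdec R0 by (simp add: Pd_def Rd)
    qed
    then have AE: "AE y in lborel. y \<in> U \<longrightarrow> infinite {n. N (y - x n) < R n}"
      using eut by (auto simp: uniformly_eutaxic_def)
    have "\<forall>\<^sub>F n in sequentially. \<phi> (r n) / r n ^ ?d \<ge> 2 ^ ?d / a"
      using filterlim_compose[OF g(6) r0] by (simp add: filterlim_at_top)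
    then have "\<forall>\<^sub>F n in sequentially. 2 * r n \<le> R n"
      using evs
    proof eventually_elim
      case (elim n)
      then have "2 ^ ?d * r n ^ ?d \<le> a * \<phi> (r n)" using a r(2)[of n] by (simp add: field_simps)
      then have "(2 * r n) ^ ?d \<le> R n ^ ?d" using elim by (simp add: Rd power_mult_distrib)
      then show ?case using Rpos[of n] r(2)[of n] by (subst (asm) power_mono_iff) (auto simp: less_imp_le)
    qed
    moreover have "\<forall>\<^sub>F n in sequentially. R n < \<rho> / 4" using R0 \<rho> by (intro order_tendstoD) auto
    ultimately have "\<forall>\<^sub>F n in sequentially. 2 * r n \<le> R n \<and> R n \<le> \<rho> / 4 \<and> s n = r n \<and> n \<ge> m"
      using evs eventually_ge_at_top[of m] by eventually_elim auto
    then obtain m' where m': "\<And>n. n \<ge> m' \<Longrightarrow> 2 * r n \<le> R n \<and> R n \<le> \<rho> / 4 \<and> s n = r n \<and> n \<ge> m"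
      by (auto simp: eventually_sequentially)
    have "AE y in lborel. y \<in> nball z (\<rho> / 2) \<longrightarrow> (\<exists>n\<ge>m'. N (y - x n) < R n)"
      using AE
    proof eventually_elim
      case (elim w)
      show ?case
      proof
        assume "w \<in> nball z (\<rho> / 2)"
        then have "w \<in> nball z \<rho>" using \<rho> by simp
        then have "w \<in> U" using z jU interior_subset by blast
        then have "infinite {n. N (w - x n) < R n}" using elim by simp
        then show "\<exists>n\<ge>m'. N (w - x n) < R n"
          unfolding infinite_nat_iff_unbounded_le by blast
      qed
    qed
    moreover have "R n \<le> \<rho> / 4" if "m' \<le> n" for n using m'[OF that] by simp
    ultimately have sel: "\<exists>I. finite I \<and> I \<subseteq> {m'..} \<and> (\<forall>i\<in>I. nball (x i) (R i) \<subseteq> nball z \<rho>)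
        \<and> (\<forall>i\<in>I. \<forall>k\<in>I. i \<noteq> k \<longrightarrow> R i + R k \<le> N (x i - x k))
        \<and> (\<rho> / 12) ^ ?d \<le> (\<Sum>i\<in>I. R i ^ ?d)"
      by (intro ball_selection \<rho> Rdec Rpos)
    obtain I where I: "finite I" "I \<subseteq> {m'..}" "\<And>i. i \<in> I \<Longrightarrow> nball (x i) (R i) \<subseteq> nball z \<rho>"
      "\<And>i k. i \<in> I \<Longrightarrow> k \<in> I \<Longrightarrow> i \<noteq> k \<Longrightarrow> R i + R k \<le> N (x i - x k)"
      "(\<rho> / 12) ^ ?d \<le> (\<Sum>i\<in>I. R i ^ ?d)"
      by (rule exE[OF sel], elim conjE) (rule that, simp_all)
    have Im: "2 * r i \<le> R i" "s i = r i" "i \<ge> m" if "i \<in> I" for i using m'[of i] I(2) that by auto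
    have Ir: "0 < r i \<and> r i \<le> \<epsilon> \<and> 2 * r i \<le> R i \<and> R i ^ ?d = a * \<phi> (r i)" if "i \<in> I" for i
      using Im[OF that] r(2)[of i] s(2)[of i] Rd[of i] by simp
    define \<nu> where "\<nu> q = (\<Sum>i\<in>I. ennreal (R i ^ ?d / (vN * r i ^ ?d)) * emeasure lborel (q \<inter> nball (x i) (r i)))" for q
    have \<nu>le: "\<nu> q \<le> ennreal (K * a) * wt \<phi> q" if q: "q \<in> C" for q
    proof -
      obtain k w where k: "q = dcube k w" using q C(1) by (meson dyadic_cubesE subsetD)
      define t where "t = cube_diam k"
      have "j \<le> k" using C(2)[OF q] dcube_gen_inj k by blast
      then have t: "0 < t" "t \<le> D" using kap_pos by (auto simp: t_def D_def)
      then have t\<epsilon>: "t \<le> \<epsilon>" using D by simp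
      have "\<phi> D * t ^ ?d \<le> \<phi> t * D ^ ?d" using g(4) t D by blast
      then have "t ^ ?d \<le> a * \<phi> t" using g(2)[OF D] by (simp add: a_def field_simps)
      then have "\<nu> q \<le> ennreal (K * a * \<phi> t)"
        unfolding \<nu>_def k K_def t_def using t\<epsilon>
        by (intro mass_dcube_le[OF \<phi> I(1) a Ir I(4)]) (simp_all add: t_def)
      also have "\<dots> = ennreal (K * a) * wt \<phi> q"
        using K a g(2)[OF t(1) t\<epsilon>] by (simp add: k t_def ennreal_mult less_imp_le)
      finally show ?thesis .
    qed
    have cC: "countable C" using C(1) countable_dyadic_cubes countable_subset by blast
    have "ennreal ((\<rho> / 12) ^ ?d) \<le> (\<Sum>i\<in>I. ennreal (R i ^ ?d))"
      using I(5) Rpos by (subst sum_ennreal) (auto simp: ennreal_leI less_imp_le)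
    also have "\<dots> \<le> (\<Sum>i\<in>I. ennreal (R i ^ ?d / (vN * r i ^ ?d)) * csum (\<lambda>q. emeasure lborel (q \<inter> nball (x i) (r i))) C)"
    proof (rule sum_mono)
      fix i assume i: "i \<in> I"
      have "nball (x i) (r i) \<subseteq> nball (x i) (R i)" using Im[OF i] r(2)[of i] by auto
      then have "nball (x i) (r i) \<subseteq> \<Union>C" using I(3)[OF i] z C(3) Im(3)[OF i] by blast
      then have "emeasure lborel (nball (x i) (r i)) \<le> csum (\<lambda>q. emeasure lborel (q \<inter> nball (x i) (r i))) C"
        using cC C(1) by (intro emeasure_le_csum) (auto elim!: dyadic_cubesE dest!: subsetD)
      then have "ennreal (R i ^ ?d / (vN * r i ^ ?d)) * ennreal (vN * r i ^ ?d)
          \<le> ennreal (R i ^ ?d / (vN * r i ^ ?d)) * csum (\<lambda>q. emeasure lborel (q \<inter> nball (x i) (r i))) C"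
        using r(2) by (intro mult_left_mono) (auto simp: emeasure_nball)
      moreover have "ennreal (R i ^ ?d / (vN * r i ^ ?d)) * ennreal (vN * r i ^ ?d) = ennreal (R i ^ ?d)"
        using r(2)[of i] Rpos[of i] less_imp_neq[OF vN_pos] vN_pos by (simp add: ennreal_mult[symmetric] less_imp_le)
      ultimately show "ennreal (R i ^ ?d) \<le> ennreal (R i ^ ?d / (vN * r i ^ ?d)) * csum (\<lambda>q. emeasure lborel (q \<inter> nball (x i) (r i))) C"
        by simp
    qed
    also have "\<dots> = csum \<nu> C"
      unfolding \<nu>_def by (simp add: csum_sum csum_cmult)
    also have "\<dots> \<le> csum (\<lambda>q. ennreal (K * a) * wt \<phi> q) C"
      using \<nu>le by (intro csum_mono)
    also have "\<dots> = ennreal (K * a) * csum (wt \<phi>) C" by (rule csum_cmult)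
    finally have "ennreal (1 / (K * a)) * ennreal ((\<rho> / 12) ^ ?d) \<le> ennreal (1 / (K * a)) * (ennreal (K * a) * csum (wt \<phi>) C)"
      by (intro mult_left_mono) auto
    also have "\<dots> = csum (wt \<phi>) C"
      using K a by (simp add: mult.assoc[symmetric] ennreal_mult[symmetric])
    also have "ennreal (1 / (K * a)) * ennreal ((\<rho> / 12) ^ ?d) = ennreal ((\<rho> / 12) ^ ?d / (K * a))"
      using K a \<rho> by (simp add: ennreal_mult[symmetric])
    also have "(\<rho> / 12) ^ ?d / (K * a) = ((b / (12 * kap)) ^ ?d / K) * \<phi> D"
      using g(2)[OF D] K by (simp add: a_def \<rho>_def D_def power_divide power_mult_distrib field_simps)
    finally have "ennreal (((b / (12 * kap)) ^ ?d / K) * \<phi> D) \<le> csum (wt \<phi>) C" .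
    moreover have "ennreal (c * \<phi> D) \<le> ennreal (((b / (12 * kap)) ^ ?d / K) * \<phi> D)"
      using g(2)[OF D] by (intro ennreal_leI mult_right_mono) (auto simp: c_def)
    moreover have "ennreal c * wt \<phi> (dcube j y) = ennreal (c * \<phi> D)"
      using g(2)[OF D] c by (simp add: D_def ennreal_mult)
    ultimately show ?thesis by simp
  qed
  show ?thesis by (rule that[OF c]) (rule main)
qed

end

section \<open>Hausdorff measures and dyadic covers\<close>

lemma csum_UN_le: "csum f (\<Union>n. Q n) \<le> (\<Sum>n::nat. csum f (Q n))"
proof -
  have "csum f (\<Union>n. Q n) \<le> (\<integral>\<^sup>+p. (\<Sum>n. f p * indicator (Q n) p) \<partial>count_space UNIV)"
    unfolding csum_def
  proof (rule nn_integral_mono)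
    fix p show "f p * indicator (\<Union>n. Q n) p \<le> (\<Sum>n. f p * indicator (Q n) p)"
    proof (cases "\<exists>n. p \<in> Q n")
      case True
      then obtain n where "p \<in> Q n" ..
      then have "f p * indicator (\<Union>n. Q n) p = (\<Sum>n\<in>{n}. f p * indicator (Q n) p)" by (auto simp: indicator_def)
      also have "\<dots> \<le> (\<Sum>n. f p * indicator (Q n) p)" by (rule sum_le_suminf) auto
      finally show ?thesis .
    qed auto
  qed
  also have "\<dots> = (\<Sum>n. csum f (Q n))"
    unfolding csum_def by (rule nn_integral_suminf) simp
  finally show ?thesis .
qed

lemma csum_cong: "(\<And>q. q \<in> C \<Longrightarrow> f q = g q) \<Longrightarrow> csum f C = csum g C"
  unfolding csum_count_space by (intro nn_integral_cong) auto

lemma dim_gaugeD: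
  assumes "dim_gauge d \<phi> \<epsilon>"
  shows "0 < \<epsilon>" "\<And>t. 0 < t \<Longrightarrow> t \<le> \<epsilon> \<Longrightarrow> 0 < \<phi> t"
    "\<And>s t. 0 < s \<Longrightarrow> s \<le> t \<Longrightarrow> t \<le> \<epsilon> \<Longrightarrow> \<phi> s \<le> \<phi> t"
    "\<And>s t. 0 < s \<Longrightarrow> s \<le> t \<Longrightarrow> t \<le> \<epsilon> \<Longrightarrow> \<phi> t * s ^ d \<le> \<phi> s * t ^ d"
    "(\<phi> \<longlongrightarrow> 0) (at_right 0)" "filterlim (\<lambda>t. \<phi> t / t ^ d) at_top (at_right 0)"
  using assms by (auto simp: dim_gauge_def)

definition hausdorff_pre :: "('a::euclidean_space \<Rightarrow> real) \<Rightarrow> (ennreal \<Rightarrow> ennreal) \<Rightarrow> real \<Rightarrow> 'a set \<Rightarrow> ennreal" where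
  "hausdorff_pre N g \<delta> E = (INF C\<in>{C::nat \<Rightarrow> 'a set. E \<subseteq> (\<Union>n. C n) \<and> (\<forall>n. ediam N (C n) \<le> ennreal \<delta>)}.
    (\<Sum>n. g (ediam N (C n))))"

lemma hausdorff_g_eq: "hausdorff_g N g E = (SUP \<delta>\<in>{0<..}. hausdorff_pre N g \<delta> E)"
  by (simp add: hausdorff_g_def hausdorff_pre_def)

lemma hausdorff_le_csum:
  assumes C: "countable C" "E \<subseteq> \<Union>C" "\<And>p. p \<in> C \<Longrightarrow> ediam N p \<le> ennreal \<delta>" and g: "g 0 = 0"
  shows "hausdorff_pre N g \<delta> E \<le> csum (\<lambda>p. g (ediam N p)) C"
proof -
  define e where "e = to_nat_on C"
  have inj: "inj_on e C" unfolding e_def by (rule inj_on_to_nat_on[OF C(1)])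
  define D where "D n = (if n \<in> e ` C then the_inv_into C e n else {})" for n
  have D: "D (e p) = p" if "p \<in> C" for p using that inj by (simp add: D_def the_inv_into_f_f)
  have D0: "D n = {}" if "n \<notin> e ` C" for n using that by (simp add: D_def)
  have em: "ediam N {} = 0" by (simp add: ediam_def bot_ennreal)
  have cov: "E \<subseteq> (\<Union>n. D n)"
  proof
    fix x assume "x \<in> E"
    then obtain p where "p \<in> C" "x \<in> p" using C(2) by blast
    then show "x \<in> (\<Union>n. D n)" using D by (intro UN_I[of "e p"]) auto
  qed
  have diam: "ediam N (D n) \<le> ennreal \<delta>" for n
    by (cases "n \<in> e ` C") (auto simp: D D0 em C(3))
  have "(\<Sum>n. g (ediam N (D n))) = csum (\<lambda>n. g (ediam N (D n))) UNIV"
    by (simp add: csum_count_space nn_integral_count_space_nat)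
  also have "\<dots> = csum (\<lambda>n. g (ediam N (D n))) (e ` C)"
    unfolding csum_count_space using D0 em g by (intro nn_integral_count_space_eq) auto
  also have "\<dots> = csum (\<lambda>p. g (ediam N (D (e p)))) C"
    unfolding csum_count_space using inj by (intro nn_integral_bij_count_space[symmetric]) (simp add: bij_betw_def)
  also have "\<dots> = csum (\<lambda>p. g (ediam N p)) C" using D by (intro csum_cong) simp
  finally show ?thesis unfolding hausdorff_pre_def using cov diam by (intro INF_lower2[of D]) auto
qed

context euclidean_norm
begin

section \<open>Lower bounds for covers of the limsup set\<close>

definition limsup_balls :: "(nat \<Rightarrow> 'a) \<Rightarrow> (nat \<Rightarrow> real) \<Rightarrow> 'a set" where
  "limsup_balls x r = {y. infinite {n. N (y - x n) < r n}}"

lemma limsup_balls_eq: "limsup_balls x r = (\<Inter>m. \<Union>n\<in>{m..}. nball (x n) (r n))"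
  unfolding limsup_balls_def infinite_nat_iff_unbounded_le by (simp add: set_eq_iff Bex_def)

text \<open>The bound for the open unions holds with one constant for all m and for all subcubes,
  which remain small and inside U; this uniformity is what lets \<open>content_Inter\<close> pass to
  the intersection, at the price of a factor 1/2.\<close>

lemma limsup_content:
  assumes \<phi>: "dim_gauge DIM('a) \<phi> \<epsilon>" and x: "uniformly_eutaxic N U x"
    and r: "decseq r" "\<And>n. 0 < r n" "r \<longlonglongrightarrow> 0" "\<not> summable (\<lambda>n. \<phi> (min (r n) \<epsilon>))"
  obtains c where "0 < c"
    "\<And>j y C. dcube j y \<subseteq> U \<Longrightarrow> cube_diam j \<le> \<epsilon> \<Longrightarrow> C \<subseteq> dyadic_cubes \<Longrightarrow>
      (\<And>p. p \<in> C \<Longrightarrow> p \<subseteq> dcube j y) \<Longrightarrow> limsup_balls x r \<inter> dcube j y \<subseteq> \<Union>C \<Longrightarrow>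
      ennreal c * wt \<phi> (dcube j y) \<le> csum (wt \<phi>) C"
proof (rule ball_content[OF \<phi> x r])
  fix c :: real
  assume c: "0 < c" "c \<le> 1"
    and content: "\<And>j y m C. dcube j y \<subseteq> U \<Longrightarrow> cube_diam j \<le> \<epsilon> \<Longrightarrow> C \<subseteq> dyadic_cubes \<Longrightarrow>
      (\<And>p. p \<in> C \<Longrightarrow> p \<subseteq> dcube j y) \<Longrightarrow>
      (\<Union>n\<in>{m..}. nball (x n) (r n)) \<inter> interior (dcube j y) \<subseteq> \<Union>C \<Longrightarrow>
      ennreal c * wt \<phi> (dcube j y) \<le> csum (wt \<phi>) C"
  show ?thesis
  proof (rule that[of "c / 2"])
    fix j y C
    assume jU: "dcube j y \<subseteq> U" and j: "cube_diam j \<le> \<epsilon>"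
      and C: "C \<subseteq> dyadic_cubes" "\<And>p. p \<in> C \<Longrightarrow> p \<subseteq> dcube j y" "limsup_balls x r \<inter> dcube j y \<subseteq> \<Union>C"
    have sub: "\<exists>k w. q = dcube k w \<and> cube_diam k \<le> \<epsilon>" if "q \<in> dyadic_cubes" "q \<subseteq> dcube j y" for q
    proof -
      obtain k w where k: "q = dcube k w" using \<open>q \<in> dyadic_cubes\<close> by (rule dyadic_cubesE)
      then have "j \<le> k" using dcube_gen_inj that(2) by blast
      then have "cube_diam k \<le> cube_diam j" by simp
      from order_trans[OF this j] show ?thesis using k by blast
    qed
    show "ennreal (c / 2) * wt \<phi> (dcube j y) \<le> csum (wt \<phi>) C"
    proof (rule content_Inter[where A = "\<lambda>m. \<Union>n\<in>{m..}. nball (x n) (r n)"])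
      show "open (\<Union>n\<in>{m..}. nball (x n) (r n))" for m by auto
      show "ennreal c * wt \<phi> q \<le> csum (wt \<phi>) C"
        if q: "q \<in> dyadic_cubes" "q \<subseteq> dcube j y" and "C \<subseteq> dyadic_cubes" "\<And>p. p \<in> C \<Longrightarrow> p \<subseteq> q"
          "(\<Union>n\<in>{m..}. nball (x n) (r n)) \<inter> interior q \<subseteq> \<Union>C" for m q C
      proof -
        obtain k w where k: "q = dcube k w" "cube_diam k \<le> \<epsilon>" using sub[OF q] by blast
        show ?thesis using that(3-5) q(2) jU unfolding k(1)
          by (intro content[OF _ k(2)]) auto
      qed
      show "0 < wt \<phi> q \<and> wt \<phi> q < top" if q: "q \<in> dyadic_cubes" "q \<subseteq> dcube j y" for q
        using sub[OF q] dim_gaugeD(2)[OF \<phi>] by auto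
      show "(\<Inter>m. \<Union>n\<in>{m..}. nball (x n) (r n)) \<inter> dcube j y \<subseteq> \<Union>C"
        using C(3) by (simp add: limsup_balls_eq)
    qed (use c C in auto)
  qed (use c in auto)
qed

text \<open>The generation is log2(kap / \<rho>) rounded up, so cube diameters meet any scale up to
  a factor 2.\<close>

lemma generation_exists:
  assumes "0 < \<rho>"
  obtains k :: int where "cube_diam k \<le> \<rho>" "\<rho> < 2 * (cube_diam k)"
proof
  define l where "l = log 2 (kap / \<rho>)"
  have l: "2 powr l = kap / \<rho>" using assms by (simp add: l_def)
  have "2 powr l \<le> 2 powr of_int \<lceil>l\<rceil>" by simp
  then show "kap * 2 powr - of_int \<lceil>l\<rceil> \<le> \<rho>"
    using assms by (simp add: l powr_minus field_simps)
  have "2 powr of_int \<lceil>l\<rceil> < 2 powr (l + 1)"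
    by (subst powr_less_cancel_iff) linarith+
  then have "2 powr of_int \<lceil>l\<rceil> < 2 * (kap / \<rho>)" by (simp add: l powr_add mult.commute)
  then show "\<rho> < 2 * (kap * 2 powr - of_int \<lceil>l\<rceil>)"
    using assms by (simp add: powr_minus field_simps)
qed

lemma card_cubes_meeting_le:
  assumes "0 < R" "0 < \<rho>" "cube_diam k \<le> \<rho>" "\<rho> < 2 * (cube_diam k)"
  shows "real (card (cubes_meeting k (nball x R))) \<le> vN * (2 * kap) ^ DIM('a) * ((R + \<rho>) / \<rho>) ^ DIM('a)"
proof -
  let ?d = "DIM('a)" and ?s = "2 powr - of_int k :: real" and ?n = "real (card (cubes_meeting k (nball x R)))"
  have "?n * (\<rho> / (2 * kap)) ^ ?d \<le> ?n * ?s ^ ?d"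
    using assms by (intro mult_left_mono power_mono) (auto simp: field_simps less_imp_le)
  also have "\<dots> \<le> vN * (R + kap * ?s) ^ ?d" by (rule cubes_meeting_nball(2)[OF assms(1)])
  also have "\<dots> \<le> vN * (R + \<rho>) ^ ?d"
    using assms vN_pos kap_pos by (intro mult_left_mono power_mono) (auto simp: less_imp_le)
  finally show ?thesis using assms(2) less_imp_neq[OF kap_pos] kap_pos
    by (simp add: power_divide power_mult_distrib field_simps)
qed

lemma ediam_subset_nball:
  assumes "ediam N A = ennreal t" "0 < t" "x \<in> A"
  shows "A \<subseteq> nball x (2 * t)"
proof
  fix y assume "y \<in> A"
  then have "ennreal (N (y - x)) \<le> ediam N A"
    unfolding ediam_def using assms(3) by (intro SUP_upper2[of "(y, x)"]) auto
  then show "y \<in> nball x (2 * t)" using assms by simp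
qed

lemma exists_small_cube:
  assumes \<phi>: "dim_gauge d \<phi> \<epsilon>" and "\<delta> > 0" "e > 0"
  obtains k where "cube_diam k \<le> \<delta>" "\<phi> (cube_diam k) \<le> e"
proof -
  have "\<forall>\<^sub>F t in at_right 0. \<phi> t < e" using dim_gaugeD(5)[OF \<phi>] assms(3) by (rule order_tendstoD)
  then obtain b where b: "b > 0" "\<And>t. 0 < t \<Longrightarrow> t < b \<Longrightarrow> \<phi> t < e"
    unfolding eventually_at_right_field by auto
  obtain k where k: "cube_diam k \<le> min (b / 2) \<delta>"
    using generation_exists[of "min (b / 2) \<delta>"] b assms by auto
  then have "\<phi> (cube_diam k) < e" using b by (intro b(2)) auto
  then show ?thesis using that[of k] k by auto
qed

text \<open>A set of diameter t > 0 lies in a ball of radius 2 t, which meets boundedly many cubes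
  of diameter in (t/2, t]. Replacing sets by cubes thus costs a constant factor, and a null measure
  permits absorbing it. Only \<phi> <= g near 0 enters, so g need not be d-normalized.\<close>

lemma hausdorff_to_cubes:
  assumes H: "hausdorff_g N g E = 0" and \<phi>: "dim_gauge DIM('a) \<phi> \<epsilon>"
    and g: "\<And>t. 0 < t \<Longrightarrow> t \<le> \<epsilon> \<Longrightarrow> ennreal (\<phi> t) \<le> g (ennreal t)" and pos: "\<delta> > 0" "e > 0"
  obtains C where "C \<subseteq> dyadic_cubes" "E \<subseteq> \<Union>C" "\<And>p. p \<in> C \<Longrightarrow> ediam N p \<le> ennreal \<delta>"
    "csum (wt \<phi>) C \<le> ennreal e"
proof -
  let ?d = "DIM('a)"
  \<comment> \<open>The count in \<open>card_cubes_meeting_le\<close> for radius 2 t at scale t: (2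
    t + t) / t = 3.\<close>
  define K where "K = vN * (2 * kap) ^ ?d * 3 ^ ?d"
  have K: "K > 0" unfolding K_def by (intro mult_pos_pos zero_less_power) auto
  define \<delta>' where "\<delta>' = min \<delta> \<epsilon>"
  have \<delta>': "\<delta>' > 0" "\<delta>' \<le> \<delta>" "\<delta>' \<le> \<epsilon>" using pos dim_gaugeD(1)[OF \<phi>] by (auto simp: \<delta>'_def)
  have "hausdorff_pre N g \<delta>' E \<le> hausdorff_g N g E"
    unfolding hausdorff_g_eq using \<delta>' by (intro SUP_upper) auto
  also have "\<dots> < ennreal (e / (2 * K))" using H pos K by simp
  finally obtain A :: "nat \<Rightarrow> 'a set" where A: "E \<subseteq> (\<Union>n. A n)" "\<And>n. ediam N (A n) \<le> ennreal \<delta>'"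
      "(\<Sum>n. g (ediam N (A n))) < ennreal (e / (2 * K))"
    unfolding hausdorff_pre_def INF_less_iff by blast
  have ex: "\<exists>Q. Q \<subseteq> dyadic_cubes \<and> A n \<subseteq> \<Union>Q \<and> (\<forall>p\<in>Q. ediam N p \<le> ennreal \<delta>) \<and>
     csum (wt \<phi>) Q \<le> ennreal K * g (ediam N (A n)) + ennreal (e / 2 * (1/2) ^ Suc n)" for n
  proof -
    obtain t where t: "ediam N (A n) = ennreal t" "t \<ge> 0"
      using A(2)[of n] by (cases "ediam N (A n)") (auto simp: top_unique)
    show ?thesis
    \<comment> \<open>A set of diameter 0 is free for g, but a cube around its point is not; the
      geometric terms e/2 * (1/2)^(n+1) pay for such cubes.\<close>
    proof (cases "t = 0")
      case True
      have "\<exists>x. A n \<subseteq> {x}"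
      proof (cases "A n = {}")
        case False
        then obtain x where x: "x \<in> A n" by blast
        have "y = x" if "y \<in> A n" for y
        proof -
          have "ennreal (N (y - x)) \<le> ediam N (A n)"
            unfolding ediam_def using x that by (intro SUP_upper2[of "(y, x)"]) auto
          then have "N (y - x) \<le> 0" using t True by simp
          then have "N (y - x) = 0" using N_nonneg[of "y - x"] by linarith
          then show ?thesis by simp
        qed
        then show ?thesis by blast
      qed auto
      then obtain x where x: "A n \<subseteq> {x}" ..
      have "e / 2 * (1/2) ^ Suc n > 0" using pos by simp
      then obtain k where k: "cube_diam k \<le> \<delta>" "\<phi> (cube_diam k) \<le> e / 2 * (1/2) ^ Suc n"
        using exists_small_cube[OF \<phi> pos(1)] by blast
      show ?thesis
      proof (intro exI[of _ "{dcube k x}"] conjI)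
        show "csum (wt \<phi>) {dcube k x} \<le> ennreal K * g (ediam N (A n)) + ennreal (e / 2 * (1/2) ^ Suc n)"
          using k(2) by (simp add: csum_finite add_increasing ennreal_leI)
      qed (use x k in \<open>auto simp: ediam_dcube ennreal_leI\<close>)
    next
      case False
      then have tp: "t > 0" using t by simp
      have t\<epsilon>: "t \<le> \<delta>'" using A(2)[of n] t tp \<delta>'(1) by (simp add: ennreal_le_iff less_imp_le)
      have "A n \<noteq> {}" using t False by (auto simp: ediam_def bot_ennreal)
      then obtain x where x: "x \<in> A n" by blast
      obtain k where k: "cube_diam k \<le> t" "t < 2 * (cube_diam k)"
        using generation_exists[OF tp] by blast
      let ?Q = "cubes_meeting k (nball x (2 * t))"
      have fin: "finite ?Q" using tp by (intro cubes_meeting_nball) auto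
      have card: "real (card ?Q) \<le> K"
        using card_cubes_meeting_le[of "2 * t" t k x] tp k by (simp add: K_def)
      have "\<phi> (cube_diam k) \<le> \<phi> t"
        using k t\<epsilon> \<delta>' by (intro dim_gaugeD(3)[OF \<phi>]) auto
      moreover have "0 < \<phi> (cube_diam k)" using k t\<epsilon> \<delta>' by (intro dim_gaugeD(2)[OF \<phi>]) auto
      ultimately have wt: "wt \<phi> p \<le> ennreal (\<phi> t)" if "p \<in> ?Q" for p
        using that by (auto simp: cubes_meeting_def ennreal_leI)
      have "csum (wt \<phi>) ?Q = (\<Sum>p\<in>?Q. wt \<phi> p)" using fin by (rule csum_finite)
      also have "\<dots> \<le> of_nat (card ?Q) * ennreal (\<phi> t)" using wt by (rule sum_bounded_above)
      also have "\<dots> \<le> ennreal K * g (ediam N (A n))"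
        using card g[OF tp] t\<epsilon> \<delta>' t(1) by (intro mult_mono) (auto simp: ennreal_of_nat_eq_real_of_nat ennreal_leI)
      also have "\<dots> \<le> ennreal K * g (ediam N (A n)) + ennreal (e / 2 * (1/2) ^ Suc n)" by simp
      finally have "csum (wt \<phi>) ?Q \<le> ennreal K * g (ediam N (A n)) + ennreal (e / 2 * (1/2) ^ Suc n)" .
      moreover have "A n \<subseteq> \<Union>?Q"
        using ediam_subset_nball[OF t(1) tp x] cubes_meeting_cover by blast
      moreover have "ediam N p \<le> ennreal \<delta>" if "p \<in> ?Q" for p
        using that k(1) t\<epsilon> \<delta>' by (auto simp: cubes_meeting_def ediam_dcube intro!: ennreal_leI)
      ultimately show ?thesis by (intro exI[of _ ?Q]) (simp add: cubes_meeting_dyadic)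
    qed
  qed
  obtain Q where "\<forall>n. Q n \<subseteq> dyadic_cubes \<and> A n \<subseteq> \<Union>(Q n) \<and> (\<forall>p\<in>Q n. ediam N p \<le> ennreal \<delta>) \<and>
     csum (wt \<phi>) (Q n) \<le> ennreal K * g (ediam N (A n)) + ennreal (e / 2 * (1/2) ^ Suc n)"
    using choice[OF allI, OF ex] by (rule exE)
  then have Q: "\<And>n. Q n \<subseteq> dyadic_cubes" "\<And>n. A n \<subseteq> \<Union>(Q n)" "\<And>n p. p \<in> Q n \<Longrightarrow> ediam N p \<le> ennreal \<delta>"
     "\<And>n. csum (wt \<phi>) (Q n) \<le> ennreal K * g (ediam N (A n)) + ennreal (e / 2 * (1/2) ^ Suc n)"
    by simp_all
  have "csum (wt \<phi>) (\<Union>n. Q n) \<le> (\<Sum>n. ennreal K * g (ediam N (A n)) + ennreal (e / 2 * (1/2) ^ Suc n))"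
    by (rule order_trans[OF csum_UN_le suminf_le]) (rule Q(4), auto)
  also have "\<dots> = (\<Sum>n. ennreal K * g (ediam N (A n))) + (\<Sum>n. ennreal (e / 2 * (1/2) ^ Suc n))"
    by (rule suminf_add[symmetric]) auto
  also have "(\<Sum>n. ennreal K * g (ediam N (A n))) = ennreal K * (\<Sum>n. g (ediam N (A n)))"
    by (rule ennreal_suminf_cmult)
  also have "(\<Sum>n. ennreal (e / 2 * (1/2) ^ Suc n)) = ennreal (e / 2)"
    using pos sums_mult[OF power_half_series, of "e / 2"]
    by (intro suminf_ennreal_eq) auto
  also have "ennreal K * (\<Sum>n. g (ediam N (A n))) + ennreal (e / 2) \<le> ennreal K * ennreal (e / (2 * K)) + ennreal (e / 2)"
    using A(3) by (intro add_right_mono mult_left_mono) auto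
  also have "\<dots> = ennreal e" using K pos by (simp add: ennreal_mult[symmetric] flip: ennreal_plus)
  finally have le: "csum (wt \<phi>) (\<Union>n. Q n) \<le> ennreal e" .
  show ?thesis
  proof (rule that[OF _ _ _ le])
    show "(\<Union>n. Q n) \<subseteq> dyadic_cubes" using Q(1) by (rule UN_least)
    have "(\<Union>n. A n) \<subseteq> \<Union>(\<Union>n. Q n)"
      by (intro UN_least order_trans[OF Q(2)] Union_mono UN_upper) simp
    with A(1) show "E \<subseteq> \<Union>(\<Union>n. Q n)" by (rule order_trans)
    show "ediam N p \<le> ennreal \<delta>" if "p \<in> (\<Union>n. Q n)" for p
      using that Q(3) by (elim UN_E)
  qed
qed

end

section \<open>Profiles of gauges\<close>

lemma at_0_ennreal: "at (0::ennreal) = at_right 0"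
proof -
  have "UNIV - {0::ennreal} = {0<..} - {0}" by (auto simp: zero_less_iff_neq_zero)
  then show ?thesis by (simp add: at_within_def)
qed

lemma ennreal_pos_real_below:
  assumes "0 < (b::ennreal)" obtains e :: real where "0 < e" "ennreal e < b"
proof (cases b)
  case (real t)
  then show ?thesis using assms that[of "t / 2"] by (auto simp: ennreal_less_iff)
next
  case top
  then show ?thesis using that[of 1] by simp
qed

lemma eventually_at_0_ennreal:
  "eventually P (at (0::ennreal)) \<longleftrightarrow> (\<exists>e>0. \<forall>t. 0 < t \<and> t \<le> e \<longrightarrow> P (ennreal t))"
  unfolding at_0_ennreal eventually_at_right[OF zero_less_one]
proof
  assume "\<exists>b>0. \<forall>y>0. y < b \<longrightarrow> P y"
  then obtain b where b: "b > 0" "\<And>y. 0 < y \<Longrightarrow> y < b \<Longrightarrow> P y" by blast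
  obtain e where e: "0 < e" "ennreal e < b" using ennreal_pos_real_below[OF b(1)] by blast
  have "P (ennreal t)" if "0 < t" "t \<le> e" for t
    using that order_le_less_trans[OF ennreal_leI[OF that(2)] e(2)] by (intro b(2)) auto
  then show "\<exists>e>0. \<forall>t. 0 < t \<and> t \<le> e \<longrightarrow> P (ennreal t)" using e(1) by blast
next
  assume "\<exists>e>0. \<forall>t. 0 < t \<and> t \<le> e \<longrightarrow> P (ennreal t)"
  then obtain e where e: "e > 0" "\<And>t. 0 < t \<Longrightarrow> t \<le> e \<Longrightarrow> P (ennreal t)" by blast
  have "P y" if "0 < y" "y < ennreal e" for y
  proof (cases y)
    case (real t)
    then show ?thesis using that e(2)[of t] by (auto simp: ennreal_less_iff)
  qed (use that in auto)
  then show "\<exists>b>0. \<forall>y>0. y < b \<longrightarrow> P y" using e(1) by (intro exI[of _ "ennreal e"]) auto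
qed

lemma mem_ennreal_IocE:
  assumes "\<rho>' \<in> {0<..ennreal t}" obtains \<rho> where "\<rho>' = ennreal \<rho>" "0 < \<rho>" "\<rho> \<le> t"
  using assms by (cases \<rho>') (auto simp: ennreal_le_iff2 top_unique)

definition dratio :: "nat \<Rightarrow> (ennreal \<Rightarrow> ennreal) \<Rightarrow> real \<Rightarrow> ennreal" where
  "dratio d g t = (INF \<rho>\<in>{0<..ennreal t}. g \<rho> / \<rho> ^ d)"

lemma dnorm_eq_dratio: "0 < t \<Longrightarrow> dnorm d g (ennreal t) = ennreal (t ^ d) * dratio d g t"
  by (simp add: dnorm_def dratio_def ennreal_power)

lemma dratio_alt: "0 < t \<Longrightarrow> dratio d g t = dnorm d g (ennreal t) / ennreal (t ^ d)"
  using ennreal_mult_divide_eq[of "ennreal (t ^ d)" "dratio d g t"]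
  by (simp add: dnorm_eq_dratio mult.commute[of "ennreal _"])

lemma dratio_antimono: "s \<le> t \<Longrightarrow> dratio d g t \<le> dratio d g s"
  unfolding dratio_def using ennreal_leI[of s t] by (intro INF_superset_mono) (auto intro: order_trans)

lemma dratio_le: "0 < s \<Longrightarrow> s \<le> t \<Longrightarrow> dratio d g t \<le> g (ennreal s) / ennreal (s ^ d)"
  unfolding dratio_def by (rule INF_lower2[of "ennreal s"]) (auto simp: ennreal_power ennreal_leI)

lemma ennreal_divide_mult_cancel: "0 < c \<Longrightarrow> ennreal c * (x / ennreal c) = x"
  by (simp add: ennreal_times_divide mult.commute ennreal_mult_divide_eq)

lemma dnorm_le:
  assumes "0 < t" shows "dnorm d g (ennreal t) \<le> g (ennreal t)"
proof -
  have "ennreal (t ^ d) * dratio d g t \<le> ennreal (t ^ d) * (g (ennreal t) / ennreal (t ^ d))"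
    using dratio_le[OF assms order_refl] by (intro mult_left_mono) auto
  then show ?thesis using assms by (simp add: dnorm_eq_dratio ennreal_divide_mult_cancel)
qed

lemma inverse_antimono_ennreal: "d \<le> b \<Longrightarrow> inverse b \<le> inverse (d :: ennreal)"
  by (simp add: less_eq_ennreal.rep_eq inverse_ennreal.rep_eq ereal_inverse_antimono)

lemma divide_mono_ennreal:
  fixes a b c d :: ennreal
  assumes "a \<le> c" "d \<le> b" shows "a / b \<le> c / d"
  using assms by (simp add: divide_ennreal_def mult_mono inverse_antimono_ennreal)

text \<open>A competitor \<rho> for the infimum at t is also one for s when \<rho> <= s. Otherwise
  g_d(s) <= g(s) <= g(\<rho>) by monotonicity of g, and \<rho> <= t settles the
  denominators.\<close>

lemma dnorm_mono:
  assumes g: "mono_on {0..ennreal \<epsilon>} g" and st: "0 < s" "s \<le> t" "t \<le> \<epsilon>"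
  shows "dnorm d g (ennreal s) \<le> dnorm d g (ennreal t)"
proof -
  have "dnorm d g (ennreal s) / ennreal (t ^ d) \<le> dratio d g t"
    unfolding dratio_def[of d g t]
  proof (rule INF_greatest)
    fix \<rho>' assume \<rho>': "\<rho>' \<in> {0<..ennreal t}"
    then obtain \<rho> where \<rho>: "\<rho>' = ennreal \<rho>" "0 < \<rho>" "\<rho> \<le> t"
      by (rule mem_ennreal_IocE)
    show "dnorm d g (ennreal s) / ennreal (t ^ d) \<le> g \<rho>' / \<rho>' ^ d"
    proof (cases "\<rho> \<le> s")
      case True
      have "dnorm d g (ennreal s) / ennreal (t ^ d) \<le> dnorm d g (ennreal s) / ennreal (s ^ d)"
        using st by (intro divide_mono_ennreal ennreal_leI power_mono) auto
      also have "\<dots> = dratio d g s"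
        using st by (simp add: dratio_alt)
      also have "\<dots> \<le> g \<rho>' / \<rho>' ^ d"
        using dratio_le[OF \<rho>(2) True, of d g] \<rho> by (simp add: ennreal_power)
      finally show ?thesis .
    next
      case False
      have "dnorm d g (ennreal s) \<le> g (ennreal s)" by (rule dnorm_le[OF st(1)])
      also have "\<dots> \<le> g \<rho>'"
        using False st \<rho> by (intro mono_onD[OF g]) (auto intro!: ennreal_leI)
      finally show ?thesis
        using \<rho> by (intro divide_mono_ennreal) (auto simp: ennreal_power intro!: ennreal_leI power_mono)
    qed
  qed
  then have "ennreal (t ^ d) * (dnorm d g (ennreal s) / ennreal (t ^ d)) \<le> ennreal (t ^ d) * dratio d g t"
    by (intro mult_left_mono) auto
  then show ?thesis using st by (simp add: dnorm_eq_dratio[of t] ennreal_divide_mult_cancel)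
qed

lemma ell_top_iff:
  "ell d g = top \<longleftrightarrow> (\<forall>M. \<exists>e>0. \<forall>t. 0 < t \<and> t \<le> e \<longrightarrow> ennreal M < g (ennreal t) / ennreal (t ^ d))"
proof -
  have "ell d g = top \<longleftrightarrow> (\<forall>y<top. eventually (\<lambda>r. y < g r / r ^ d) (at 0))"
    unfolding ell_def top_unique[symmetric] le_Liminf_iff ..
  also have "\<dots> \<longleftrightarrow> (\<forall>M. eventually (\<lambda>r. ennreal M < g r / r ^ d) (at 0))"
  proof (intro iffI allI impI)
    fix y :: ennreal assume *: "\<forall>M. eventually (\<lambda>r. ennreal M < g r / r ^ d) (at 0)" and "y < top"
    then show "eventually (\<lambda>r. y < g r / r ^ d) (at 0)" by (cases y) auto
  qed auto
  also have "\<dots> \<longleftrightarrow> (\<forall>M. \<exists>e>0. \<forall>t. 0 < t \<and> t \<le> e \<longrightarrow> ennreal M < g (ennreal t) / ennreal (t ^ d))"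
    unfolding eventually_at_0_ennreal by (intro iff_allI ex_cong1) (auto simp: ennreal_power)
  finally show ?thesis .
qed

lemma dratio_ge:
  assumes "ell d g = top"
  obtains e where "0 < e" "\<And>t. 0 < t \<Longrightarrow> t \<le> e \<Longrightarrow> ennreal M \<le> dratio d g t"
proof -
  obtain e where e: "e > 0" "\<And>t. 0 < t \<Longrightarrow> t \<le> e \<Longrightarrow> ennreal M < g (ennreal t) / ennreal (t ^ d)"
    using assms unfolding ell_top_iff by blast
  have "ennreal M \<le> dratio d g t" if "0 < t" "t \<le> e" for t
    unfolding dratio_def
  proof (rule INF_greatest)
    fix \<rho>' assume "\<rho>' \<in> {0<..ennreal t}"
    then obtain \<rho> where \<rho>: "\<rho>' = ennreal \<rho>" "0 < \<rho>" "\<rho> \<le> t"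
      by (rule mem_ennreal_IocE)
    then show "ennreal M \<le> g \<rho>' / \<rho>' ^ d" using e(2)[of \<rho>] that by (auto simp: ennreal_power)
  qed
  then show ?thesis using that e(1) by blast
qed

lemma gauge_small:
  assumes "gauge g" "0 < c"
  obtains e where "0 < e" "\<And>t. 0 < t \<Longrightarrow> t \<le> e \<Longrightarrow> g (ennreal t) < c"
proof -
  have "eventually (\<lambda>r. g r < c) (at 0)"
    using assms by (auto simp: gauge_def intro: order_tendstoD)
  then show ?thesis using that unfolding eventually_at_0_ennreal by blast
qed

text \<open>The gauge may be infinite away from 0, but the infimum runs over all smaller scales,
  where g is below 1.\<close>

lemma dnorm_finite:
  assumes "gauge g" "0 < t" shows "dnorm d g (ennreal t) < top"
proof -
  obtain e where e: "0 < e" "\<And>t. 0 < t \<Longrightarrow> t \<le> e \<Longrightarrow> g (ennreal t) < 1"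
    using gauge_small[OF assms(1) zero_less_one] by blast
  have "g (ennreal (min e t)) < 1" using e assms by auto
  then have "g (ennreal (min e t)) / ennreal (min e t ^ d) < top"
    using e(1) assms(2) by (auto simp: less_top[symmetric] ennreal_divide_eq_top_iff)
  moreover have "dratio d g t \<le> g (ennreal (min e t)) / ennreal (min e t ^ d)"
    using e(1) assms(2) by (intro dratio_le) auto
  ultimately have "dratio d g t < top" by (rule order_le_less_trans[rotated])
  then show ?thesis using assms(2) by (simp add: dnorm_eq_dratio ennreal_mult_less_top)
qed

text \<open>With infinite \<open>ell\<close> the infimum defining g_d is at least 1 at small scales
  and tends to infinity, which gives positivity and the divergence of \<phi> t / t^d; the rest is
  the monotonicity of g_d and of that infimum.\<close>

lemma gauge_profile:
  assumes g: "gauge g" "ell d g = top" and \<epsilon>0: "0 < \<epsilon>0"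
  obtains \<phi> \<epsilon> where "dim_gauge d \<phi> \<epsilon>" "\<epsilon> \<le> \<epsilon>0"
    "\<And>t. 0 < t \<Longrightarrow> t \<le> \<epsilon> \<Longrightarrow> dnorm d g (ennreal t) = ennreal (\<phi> t)" "mono_on {0..ennreal \<epsilon>} g"
proof -
  obtain b where "b > 0" "mono_on {0..b} g" using g(1) by (auto simp: gauge_def)
  then obtain e1 where e1: "0 < e1" "mono_on {0..ennreal e1} g"
    using ennreal_pos_real_below[OF \<open>b > 0\<close>] by (metis atLeastatMost_subset_iff less_imp_le mono_on_subset order_refl)
  obtain e3 where e3: "0 < e3" "\<And>t. 0 < t \<Longrightarrow> t \<le> e3 \<Longrightarrow> ennreal 1 \<le> dratio d g t"
    by (rule dratio_ge[OF g(2), of 1]) (rule that)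
  define \<epsilon> where "\<epsilon> = min \<epsilon>0 (min e1 e3)"
  have \<epsilon>: "0 < \<epsilon>" "\<epsilon> \<le> \<epsilon>0" "\<epsilon> \<le> e1" "\<epsilon> \<le> e3" using e1 e3 \<epsilon>0 by (auto simp: \<epsilon>_def)
  have mono: "mono_on {0..ennreal \<epsilon>} g"
    by (rule mono_on_subset[OF e1(2)]) (use ennreal_leI[OF \<epsilon>(3)] in \<open>auto intro: order_trans\<close>)
  define i where "i t = enn2real (dratio d g t)" for t
  define \<phi> where "\<phi> t = t ^ d * i t" for t
  have i: "dratio d g t = ennreal (i t)" if "0 < t" for t
    using dnorm_finite[OF g(1) that, of d] that
    by (auto simp: i_def dnorm_eq_dratio ennreal_mult_less_top)
  have i0: "0 \<le> i t" for t by (simp add: i_def)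
  have \<phi>: "dnorm d g (ennreal t) = ennreal (\<phi> t)" if "0 < t" for t
    using that i[OF that] i0[of t] by (simp add: \<phi>_def dnorm_eq_dratio ennreal_mult)
  have \<phi>0: "0 \<le> \<phi> t" if "0 < t" for t using that i0[of t] by (simp add: \<phi>_def)
  have "dim_gauge d \<phi> \<epsilon>"
    unfolding dim_gauge_def
  proof (intro conjI allI impI)
    show "0 < \<epsilon>" by (rule \<epsilon>)
    show "0 < \<phi> t" if "0 < t \<and> t \<le> \<epsilon>" for t
    proof -
      have "ennreal 1 \<le> ennreal (i t)" using that e3(2)[of t] i[of t] \<epsilon> by auto
      then have "1 \<le> i t" using i0[of t] by (simp add: ennreal_le_iff)
      then show ?thesis using that by (simp add: \<phi>_def)
    qed
    fix s t assume st: "0 < s \<and> s \<le> t \<and> t \<le> \<epsilon>"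
    show "\<phi> s \<le> \<phi> t"
      using dnorm_mono[OF mono, of s t d] st \<phi>[of s] \<phi>[of t] \<phi>0[of t] by (simp add: ennreal_le_iff)
    have "i t \<le> i s" using dratio_antimono[of s t d g] i[of s] i[of t] i0[of s] st by (simp add: ennreal_le_iff)
    then have "(t ^ d * s ^ d) * i t \<le> (t ^ d * s ^ d) * i s" using st by (intro mult_left_mono) auto
    then show "\<phi> t * s ^ d \<le> \<phi> s * t ^ d" by (simp add: \<phi>_def ac_simps)
  next
    show "(\<phi> \<longlongrightarrow> 0) (at_right 0)"
    proof (rule tendstoI)
      fix e :: real assume e: "e > 0"
      then obtain b where b: "0 < b" "\<And>t. 0 < t \<Longrightarrow> t \<le> b \<Longrightarrow> g (ennreal t) < ennreal e"
        using gauge_small[OF g(1), of "ennreal e"] by auto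
      have "dist (\<phi> t) 0 < e" if "0 < t" "t < b" for t
      proof -
        have "ennreal (\<phi> t) < ennreal e"
          using dnorm_le[of t d g] \<phi>[of t] that b(2)[of t] by (simp add: order_le_less_trans)
        then show ?thesis using \<phi>0[of t] that by (simp add: ennreal_less_iff)
      qed
      then show "\<forall>\<^sub>F t in at_right 0. dist (\<phi> t) 0 < e"
        unfolding eventually_at_right_field using b(1) by blast
    qed
    show "filterlim (\<lambda>t. \<phi> t / t ^ d) at_top (at_right 0)"
      unfolding filterlim_at_top
    proof
      fix Z :: real
      obtain b where b: "0 < b" "\<And>t. 0 < t \<Longrightarrow> t \<le> b \<Longrightarrow> ennreal Z \<le> dratio d g t"
        by (rule dratio_ge[OF g(2), of Z]) (rule that)
      have "Z \<le> \<phi> t / t ^ d" if "0 < t" "t < b" for t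
        using b(2)[of t] i[of t] i0[of t] that by (auto simp: \<phi>_def ennreal_le_iff2)
      then show "\<forall>\<^sub>F t in at_right 0. Z \<le> \<phi> t / t ^ d"
        unfolding eventually_at_right_field using b(1) by blast
    qed
  qed
  then show ?thesis using that[of \<phi> \<epsilon>] \<epsilon>(2) \<phi> mono by blast
qed

text \<open>Infinite \<open>ell\<close> prevents g_d from vanishing near 0 and so rules out the
  conventional branch of \<open>gprec\<close>. What remains is a quotient tending to infinity, hence
  eventually above 1.\<close>

lemma gprec_imp_ge:
  assumes g: "gauge g" "ell d g = top" and h: "gprec h (dnorm d g)"
  obtains e where "0 < e" "\<And>t. 0 < t \<Longrightarrow> t \<le> e \<Longrightarrow> dnorm d g (ennreal t) \<le> h (ennreal t)"
proof -
  obtain \<phi> \<epsilon> where \<phi>: "dim_gauge d \<phi> \<epsilon>" "\<epsilon> \<le> 1"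
    "\<And>t. 0 < t \<Longrightarrow> t \<le> \<epsilon> \<Longrightarrow> dnorm d g (ennreal t) = ennreal (\<phi> t)" "mono_on {0..ennreal \<epsilon>} g"
    by (rule gauge_profile[OF g zero_less_one]) (rule that)
  have "\<not> (\<exists>\<epsilon>>0. \<forall>r\<in>{0..<\<epsilon>}. dnorm d g r = 0)"
  proof
    assume "\<exists>\<epsilon>>0. \<forall>r\<in>{0..<\<epsilon>}. dnorm d g r = 0"
    then obtain b where b: "b > 0" "\<And>r. r < b \<Longrightarrow> dnorm d g r = 0" by auto
    obtain e where e: "0 < e" "ennreal e < b" using ennreal_pos_real_below[OF b(1)] by blast
    have "ennreal (min e \<epsilon>) < b" using e(2) ennreal_leI[of "min e \<epsilon>" e] by (simp add: order_le_less_trans)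
    then have "ennreal (\<phi> (min e \<epsilon>)) = 0"
      using b(2) \<phi>(3)[of "min e \<epsilon>"] e(1) dim_gaugeD(1)[OF \<phi>(1)] by simp
    then show False using dim_gaugeD(2)[OF \<phi>(1), of "min e \<epsilon>"] dim_gaugeD(1)[OF \<phi>(1)] e(1) by (simp add: ennreal_eq_0_iff)
  qed
  then have "((\<lambda>r. h r / dnorm d g r) \<longlongrightarrow> top) (at 0)"
    using h unfolding gprec_def at_0_ennreal by blast
  then have "eventually (\<lambda>r. 1 < h r / dnorm d g r) (at 0)" by (rule order_tendstoD) simp
  then obtain b where b: "b > 0" "\<And>t. 0 < t \<Longrightarrow> t \<le> b \<Longrightarrow> 1 < h (ennreal t) / dnorm d g (ennreal t)"
    unfolding eventually_at_0_ennreal by blast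
  show ?thesis
  proof (rule that[of "min b \<epsilon>"])
    show "0 < min b \<epsilon>" using b dim_gaugeD(1)[OF \<phi>(1)] by simp
    fix t assume t: "0 < t" "t \<le> min b \<epsilon>"
    have p: "0 < \<phi> t" using dim_gaugeD(2)[OF \<phi>(1)] t by simp
    have "1 \<le> h (ennreal t) / ennreal (\<phi> t)" using b(2)[of t] t \<phi>(3)[of t] by (simp add: less_imp_le)
    then have "ennreal (\<phi> t) * 1 \<le> ennreal (\<phi> t) * (h (ennreal t) / ennreal (\<phi> t))" by (intro mult_left_mono) auto
    then show "dnorm d g (ennreal t) \<le> h (ennreal t)"
      using t \<phi>(3)[of t] ennreal_divide_mult_cancel[OF p] by simp
  qed
qed

lemma gprec_ell_top:
  assumes g: "gauge g" "ell d g = top" and h: "gprec h (dnorm d g)"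
  shows "ell d h = top"
  unfolding ell_top_iff
proof
  fix M :: real
  obtain e where e: "0 < e" "\<And>t. 0 < t \<Longrightarrow> t \<le> e \<Longrightarrow> dnorm d g (ennreal t) \<le> h (ennreal t)"
    by (rule gprec_imp_ge[OF assms]) (rule that)
  obtain b where b: "0 < b" "\<And>t. 0 < t \<Longrightarrow> t \<le> b \<Longrightarrow> ennreal (max M 0 + 1) \<le> dratio d g t"
    by (rule dratio_ge[OF g(2), of "max M 0 + 1"]) (rule that)
  have "ennreal M < h (ennreal t) / ennreal (t ^ d)" if t: "0 < t" "t \<le> min b e" for t
  proof -
    have "ennreal M < ennreal (max M 0 + 1)" by (rule ennreal_lessI) auto
    also have "\<dots> \<le> dratio d g t" using b t by simp
    also have "\<dots> = dnorm d g (ennreal t) / ennreal (t ^ d)"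
      using t by (simp add: dratio_alt)
    also have "\<dots> \<le> h (ennreal t) / ennreal (t ^ d)"
      using e(2) t by (intro divide_right_mono_ennreal) auto
    finally show ?thesis .
  qed
  then show "\<exists>e>0. \<forall>t. 0 < t \<and> t \<le> e \<longrightarrow> ennreal M < h (ennreal t) / ennreal (t ^ d)"
    using b(1) e(1) by (intro exI[of _ "min b e"]) auto
qed

text \<open>Near 0 the gauge equals its own normalization, so the profile describes h itself. The
  bound by \<open>eps_h\<close> makes cubes of diameter below \<epsilon> admissible in the net
  content.\<close>

lemma d_normalized_profile:
  assumes h: "gauge h" "ell d h = top" "d_normalized d h" and \<epsilon>0: "0 < \<epsilon>0"
  obtains \<phi> \<epsilon> where "dim_gauge d \<phi> \<epsilon>" "\<epsilon> \<le> \<epsilon>0"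
    "\<And>t. 0 < t \<Longrightarrow> t \<le> \<epsilon> \<Longrightarrow> h (ennreal t) = ennreal (\<phi> t)" "ennreal \<epsilon> \<le> eps_h d h"
proof -
  have "eventually (\<lambda>r. h r = dnorm d h r) (at 0)"
    using h(3) by (auto simp: d_normalized_def eventually_nhds_conv_at)
  then obtain e where e: "0 < e" "\<And>t. 0 < t \<Longrightarrow> t \<le> e \<Longrightarrow> h (ennreal t) = dnorm d h (ennreal t)"
    unfolding eventually_at_0_ennreal by blast
  have "0 < min e \<epsilon>0" using e \<epsilon>0 by simp
  then obtain \<phi> \<epsilon> where \<phi>: "dim_gauge d \<phi> \<epsilon>" "\<epsilon> \<le> min e \<epsilon>0"
    "\<And>t. 0 < t \<Longrightarrow> t \<le> \<epsilon> \<Longrightarrow> dnorm d h (ennreal t) = ennreal (\<phi> t)" "mono_on {0..ennreal \<epsilon>} h"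
    by (rule gauge_profile[OF h(1,2)]) (rule that)
  have eq: "h (ennreal t) = ennreal (\<phi> t)" if "0 < t" "t \<le> \<epsilon>" for t using that \<phi> e by simp
  have "antimono_on {0<..ennreal \<epsilon>} (\<lambda>r. h r / r ^ d)"
  proof (rule monotone_onI)
    fix a b assume ab: "a \<in> {0<..ennreal \<epsilon>}" "b \<in> {0<..ennreal \<epsilon>}" "a \<le> b"
    obtain s where s: "a = ennreal s" "0 < s" "s \<le> \<epsilon>" using ab(1) by (rule mem_ennreal_IocE)
    obtain t where t: "b = ennreal t" "0 < t" "t \<le> \<epsilon>" using ab(2) by (rule mem_ennreal_IocE)
    have "s \<le> t" using ab(3) s t by simp
    then have "\<phi> t * s ^ d \<le> \<phi> s * t ^ d" using dim_gaugeD(4)[OF \<phi>(1)] s t by simp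
    then have "\<phi> t / t ^ d \<le> \<phi> s / s ^ d" using s t by (simp add: field_simps)
    then show "h b / b ^ d \<le> h a / a ^ d"
      using s t eq[of s] eq[of t] dim_gaugeD(2)[OF \<phi>(1), of s] dim_gaugeD(2)[OF \<phi>(1), of t]
      by (simp add: ennreal_power divide_ennreal ennreal_leI less_imp_le)
  qed
  then have "ennreal \<epsilon> \<le> eps_h d h"
    unfolding eps_h_def using \<phi>(4) dim_gaugeD(1)[OF \<phi>(1)] by (intro SUP_upper) auto
  then show ?thesis using that[of \<phi> \<epsilon>] \<phi>(1,2) eq by auto
qed

section \<open>Slow modification of gauges\<close>

text \<open>Take \<open>\<psi> t = (\<Sum>k. min t (\<tau> k))\<close> with \<open>\<tau> k\<close> so small that \<open>(\<Sum>n. min (a n) (\<tau> k)) \<le> 2 ^ - k\<close>;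
  every summand \<open>min t (\<tau> k) / t\<close> increases to \<open>1\<close> as \<open>t\<close> decreases to \<open>0\<close>.\<close>

lemma slow_modification:
  fixes a :: "nat \<Rightarrow> real"
  assumes a: "\<And>n. 0 < a n" "summable a"
  obtains \<psi> :: "real \<Rightarrow> real" where "\<And>t. 0 < t \<Longrightarrow> 0 < \<psi> t" "\<And>s t. 0 < s \<Longrightarrow> s \<le> t \<Longrightarrow> \<psi> s \<le> \<psi> t"
    "\<And>s t. 0 < s \<Longrightarrow> s \<le> t \<Longrightarrow> \<psi> t * s \<le> \<psi> s * t"
    "filterlim (\<lambda>t. \<psi> t / t) at_top (at_right 0)" "summable (\<lambda>n. \<psi> (a n))"
proof -
  have ex: "\<exists>\<tau>. 0 < \<tau> \<and> \<tau> \<le> (1/2) ^ k \<and> (\<forall>P. (\<Sum>n<P. min (a n) \<tau>) \<le> (1/2) ^ k)" for k :: nat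
  proof -
    define e :: real where "e = (1/2) ^ k / 2"
    have e: "e > 0" by (simp add: e_def)
    then obtain M where M: "norm (\<Sum>i. a (i + M)) < e"
      using suminf_exist_split[OF e a(2)] by blast
    \<comment> \<open>Half of the allowance (1/2)^k covers the tail of the series from M on, the
      other half the first M terms, each cut down to \<tau>.\<close>
    define \<tau> where "\<tau> = e / (real M + 1)"
    have \<tau>: "0 < \<tau>" "\<tau> \<le> e" "real M * \<tau> \<le> e" using e by (auto simp: \<tau>_def field_simps)
    have sm: "summable (\<lambda>n. min (a n) \<tau>)"
      using a \<tau> by (intro summable_comparison_test'[OF a(2)]) (auto simp: less_imp_le)
    have "(\<Sum>n<P. min (a n) \<tau>) \<le> (1/2) ^ k" for P
    proof -
      have "(\<Sum>n<P. min (a n) \<tau>) \<le> (\<Sum>n. min (a n) \<tau>)"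
        using a \<tau> by (intro sum_le_suminf sm) (auto simp: less_imp_le)
      also have "\<dots> = (\<Sum>n. min (a (n + M)) \<tau>) + (\<Sum>n<M. min (a n) \<tau>)"
        by (rule suminf_split_initial_segment[OF sm])
      also have "\<dots> \<le> (\<Sum>n. a (n + M)) + real M * \<tau>"
      proof (rule add_mono)
        show "(\<Sum>n. min (a (n + M)) \<tau>) \<le> (\<Sum>n. a (n + M))"
          using sm a(2) by (intro suminf_le) (simp_all add: summable_iff_shift[of "\<lambda>n. min (a n) \<tau>"])
        show "(\<Sum>n<M. min (a n) \<tau>) \<le> real M * \<tau>"
          using sum_bounded_above[of "{..<M}" "\<lambda>n. min (a n) \<tau>" \<tau>] by simp
      qed
      also have "\<dots> \<le> e + e" using M \<tau>(3) by (intro add_mono) auto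
      also have "\<dots> = (1/2) ^ k" by (simp add: e_def)
      finally show ?thesis .
    qed
    moreover have "\<tau> \<le> (1/2) ^ k" using \<tau>(2) e unfolding e_def by linarith
    ultimately show ?thesis using \<tau>(1) by blast
  qed
  obtain \<tau> :: "nat \<Rightarrow> real"
    where "\<forall>k. 0 < \<tau> k \<and> \<tau> k \<le> (1/2) ^ k \<and> (\<forall>P. (\<Sum>n<P. min (a n) (\<tau> k)) \<le> (1/2) ^ k)"
    using choice[OF allI, OF ex] by (rule exE)
  then have \<tau>: "\<And>k. 0 < \<tau> k" "\<And>k. \<tau> k \<le> (1/2) ^ k"
    "\<And>k P. (\<Sum>n<P. min (a n) (\<tau> k)) \<le> (1/2) ^ k"
    by simp_all
  have geo: "summable (\<lambda>k. (1/2::real) ^ k)" by (rule summable_geometric) simp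
  have sm: "summable (\<lambda>k. min t (\<tau> k))" if "0 < t" for t
    using that \<tau>(1,2) by (intro summable_comparison_test'[OF geo]) (auto simp: min_le_iff_disj less_imp_le)
  define \<psi> where "\<psi> t = (\<Sum>k. min t (\<tau> k))" for t
  show ?thesis
  proof (rule that[of \<psi>])
    show pos: "0 < \<psi> t" if "0 < t" for t
      unfolding \<psi>_def using that \<tau>(1) by (intro suminf_pos sm) auto
    show "\<psi> s \<le> \<psi> t" if "0 < s" "s \<le> t" for s t
      unfolding \<psi>_def using that by (intro suminf_le sm) auto
    show "\<psi> t * s \<le> \<psi> s * t" if st: "0 < s" "s \<le> t" for s t
    proof -
      have "\<psi> t * s = (\<Sum>k. min t (\<tau> k) * s)"
        unfolding \<psi>_def using st by (intro suminf_mult2 sm) auto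
      also have "\<dots> \<le> (\<Sum>k. min s (\<tau> k) * t)"
      proof (intro suminf_le summable_mult2 sm)
        fix k show "min t (\<tau> k) * s \<le> min s (\<tau> k) * t"
        proof (cases "\<tau> k \<le> s")
          case True
          then show ?thesis using st \<tau>(1)[of k] by (simp add: min_def mult_left_mono)
        next
          case False
          have "min t (\<tau> k) * s \<le> t * s" using st by (intro mult_right_mono) auto
          then show ?thesis using False by (simp add: min_def mult.commute)
        qed
      qed (use st in auto)
      also have "\<dots> = \<psi> s * t"
        unfolding \<psi>_def using st by (intro suminf_mult2[symmetric] sm) auto
      finally show ?thesis .
    qed
    show "filterlim (\<lambda>t. \<psi> t / t) at_top (at_right 0)"
      unfolding filterlim_at_top
    proof
      fix Z :: real
      define K where "K = nat \<lceil>Z\<rceil>"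
      have K: "Z \<le> real K" unfolding K_def by linarith
      have "\<forall>\<^sub>F t in at_right 0. t < \<tau> k" for k
        using \<tau>(1)[of k] unfolding eventually_at_right_field by blast
      then have "\<forall>\<^sub>F t in at_right 0. \<forall>k\<in>{..<K}. t < \<tau> k"
        by (intro eventually_ball_finite) auto
      moreover have "\<forall>\<^sub>F t in at_right 0. 0 < (t::real)" by (rule eventually_at_right_less)
      ultimately show "\<forall>\<^sub>F t in at_right 0. Z \<le> \<psi> t / t"
      proof eventually_elim
        case (elim t)
        \<comment> \<open>Below the first K thresholds, the first K summands of \<psi> all equal
          t.\<close>
        have "real K * t = (\<Sum>k<K. min t (\<tau> k))" using elim by (simp add: min_def less_imp_le)
        also have "\<dots> \<le> \<psi> t"
          unfolding \<psi>_def using elim(2) \<tau>(1) by (intro sum_le_suminf sm) (auto simp: less_imp_le)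
        finally have "real K \<le> \<psi> t / t" using elim(2) by (simp add: field_simps)
        then show ?case using K by simp
      qed
    qed
    show "summable (\<lambda>n. \<psi> (a n))"
    proof (rule summableI_nonneg_bounded)
      show "0 \<le> \<psi> (a n)" for n using pos[OF a(1)] by (simp add: less_imp_le)
      show "(\<Sum>n<P. \<psi> (a n)) \<le> (\<Sum>k. (1/2::real) ^ k)" for P
      proof -
        \<comment> \<open>Exchanging the sums lets the choice of each threshold bound the k-th row
          by (1/2)^k, uniformly in P.\<close>
        have "(\<Sum>n<P. \<psi> (a n)) = (\<Sum>k. \<Sum>n<P. min (a n) (\<tau> k))"
          unfolding \<psi>_def by (intro suminf_sum[symmetric] sm a(1))
        also have "\<dots> \<le> (\<Sum>k. (1/2) ^ k)"
          by (intro suminf_le \<tau>(3) geo summable_sum sm a(1))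
        finally show ?thesis .
      qed
    qed
  qed
qed

lemma dim_gauge_at_right:
  assumes "dim_gauge d \<phi> \<epsilon>" shows "filterlim \<phi> (at_right 0) (at_right 0)"
proof -
  have "\<forall>\<^sub>F t in at_right 0. t < \<epsilon>"
    unfolding eventually_at_right_field using dim_gaugeD(1)[OF assms] by blast
  moreover have "\<forall>\<^sub>F t in at_right 0. 0 < (t::real)" by (rule eventually_at_right_less)
  ultimately have "\<forall>\<^sub>F t in at_right 0. \<phi> t \<in> {0<..} \<and> \<phi> t \<noteq> 0"
  proof eventually_elim
    case (elim t)
    then have "0 < \<phi> t" by (intro dim_gaugeD(2)[OF assms]) auto
    then show ?case by simp
  qed
  then show ?thesis unfolding filterlim_at using dim_gaugeD(5)[OF assms] by simp
qed

text \<open>Only the behaviour near 0 matters; the value \<open>top\<close> beyond \<epsilon> meets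
  the condition at infinity.\<close>

definition gauge_of :: "(real \<Rightarrow> real) \<Rightarrow> real \<Rightarrow> ennreal \<Rightarrow> ennreal" where
  "gauge_of \<phi> \<epsilon> r = (if r = 0 then 0 else if r \<le> ennreal \<epsilon> then ennreal (\<phi> (enn2real r)) else top)"

lemma gauge_of_0 [simp]: "gauge_of \<phi> \<epsilon> 0 = 0"
  by (simp add: gauge_of_def)

lemma gauge_of_ennreal: "0 < t \<Longrightarrow> t \<le> \<epsilon> \<Longrightarrow> gauge_of \<phi> \<epsilon> (ennreal t) = ennreal (\<phi> t)"
  by (simp add: gauge_of_def ennreal_leI)

context
  fixes d \<phi> \<epsilon> assumes \<phi>: "dim_gauge d \<phi> \<epsilon>"
begin

lemma gauge_of_mono_on: "mono_on {0..ennreal \<epsilon>} (gauge_of \<phi> \<epsilon>)"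
proof (rule monotone_onI)
  fix a b assume ab: "a \<in> {0..ennreal \<epsilon>}" "b \<in> {0..ennreal \<epsilon>}" "a \<le> b"
  show "gauge_of \<phi> \<epsilon> a \<le> gauge_of \<phi> \<epsilon> b"
  proof (cases "a = 0")
    case False
    then have "a \<in> {0<..ennreal \<epsilon>}" "b \<in> {0<..ennreal \<epsilon>}" using ab by (auto simp: zero_less_iff_neq_zero)
    then obtain s t where "a = ennreal s" "0 < s" "s \<le> \<epsilon>" "b = ennreal t" "0 < t" "t \<le> \<epsilon>"
      by (metis mem_ennreal_IocE)
    then show ?thesis using ab(3) dim_gaugeD(3)[OF \<phi>, of s t] by (simp add: gauge_of_ennreal ennreal_leI)
  qed simp
qed

lemma gauge_gauge_of: "gauge (gauge_of \<phi> \<epsilon>)"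
proof -
  have "(gauge_of \<phi> \<epsilon> \<longlongrightarrow> 0) (at 0)"
  proof (rule order_tendstoI)
    fix c :: ennreal assume "0 < c"
    then obtain e where e: "0 < e" "ennreal e < c" by (rule ennreal_pos_real_below)
    have "\<forall>\<^sub>F t in at_right 0. \<phi> t < e" using dim_gaugeD(5)[OF \<phi>] e(1) by (rule order_tendstoD)
    then obtain b where b: "b > 0" "\<And>t. 0 < t \<Longrightarrow> t < b \<Longrightarrow> \<phi> t < e"
      unfolding eventually_at_right_field by auto
    have "gauge_of \<phi> \<epsilon> (ennreal t) < c" if "0 < t" "t \<le> min (b / 2) \<epsilon>" for t
    proof -
      have "\<phi> t < e" using that b by (intro b(2)) auto
      then show ?thesis
        using that e by (auto simp: gauge_of_ennreal intro!: order_le_less_trans[OF ennreal_leI e(2)])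
    qed
    then show "\<forall>\<^sub>F r in at 0. gauge_of \<phi> \<epsilon> r < c"
      unfolding eventually_at_0_ennreal using b(1) dim_gaugeD(1)[OF \<phi>]
      by (intro exI[of _ "min (b / 2) \<epsilon>"]) auto
  qed simp
  moreover have "ennreal \<epsilon> > 0" using dim_gaugeD(1)[OF \<phi>] by simp
  ultimately show ?thesis
    unfolding gauge_def using gauge_of_mono_on
    by (intro conjI exI[of _ "ennreal \<epsilon>"]) (simp_all add: gauge_of_def top_unique)
qed

text \<open>As \<phi> t / t^d is nonincreasing, the infimum over (0, t] is attained at t
  itself.\<close>

lemma dnorm_gauge_of:
  assumes t: "0 < t" "t \<le> \<epsilon>"
  shows "dnorm d (gauge_of \<phi> \<epsilon>) (ennreal t) = ennreal (\<phi> t)"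
proof -
  have "dratio d (gauge_of \<phi> \<epsilon>) t \<ge> ennreal (\<phi> t / t ^ d)"
    unfolding dratio_def
  proof (rule INF_greatest)
    fix \<rho>' assume "\<rho>' \<in> {0<..ennreal t}"
    then obtain \<rho> where \<rho>: "\<rho>' = ennreal \<rho>" "0 < \<rho>" "\<rho> \<le> t" by (rule mem_ennreal_IocE)
    have "\<phi> t * \<rho> ^ d \<le> \<phi> \<rho> * t ^ d" using dim_gaugeD(4)[OF \<phi>] \<rho> t by simp
    then have "\<phi> t / t ^ d \<le> \<phi> \<rho> / \<rho> ^ d" using \<rho> t by (simp add: field_simps)
    then show "ennreal (\<phi> t / t ^ d) \<le> gauge_of \<phi> \<epsilon> \<rho>' / \<rho>' ^ d"
      using \<rho> t dim_gaugeD(2)[OF \<phi>, of \<rho>]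
      by (simp add: gauge_of_ennreal ennreal_power divide_ennreal ennreal_leI less_imp_le)
  qed
  then have "ennreal (t ^ d) * ennreal (\<phi> t / t ^ d) \<le> dnorm d (gauge_of \<phi> \<epsilon>) (ennreal t)"
    unfolding dnorm_eq_dratio[OF t(1)] by (intro mult_left_mono) auto
  then have "ennreal (\<phi> t) \<le> dnorm d (gauge_of \<phi> \<epsilon>) (ennreal t)"
    using t dim_gaugeD(2)[OF \<phi> t] by (simp add: ennreal_mult[symmetric] less_imp_le)
  moreover have "dnorm d (gauge_of \<phi> \<epsilon>) (ennreal t) \<le> ennreal (\<phi> t)"
    using dnorm_le[OF t(1), of d "gauge_of \<phi> \<epsilon>"] t by (simp add: gauge_of_ennreal)
  ultimately show ?thesis by (rule antisym[rotated])
qed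

lemma d_normalized_gauge_of: "d_normalized d (gauge_of \<phi> \<epsilon>)"
  unfolding d_normalized_def eventually_nhds_conv_at eventually_at_0_ennreal
  using dim_gaugeD(1)[OF \<phi>] by (auto simp: dnorm_gauge_of gauge_of_ennreal dnorm_def[of _ _ 0] intro!: exI[of _ \<epsilon>])

end

text \<open>The quotient of the two gauges is \<psi> u / u at u = \<phi> t. It is nonincreasing in
  u, \<phi> is nondecreasing, and \<phi> t tends to 0 from above, so monotonicity and divergence
  both transfer.\<close>

lemma gprec_gauge_of:
  assumes \<phi>: "dim_gauge d \<phi> \<epsilon>"
    and g: "\<And>t. 0 < t \<Longrightarrow> t \<le> \<epsilon> \<Longrightarrow> dnorm d g (ennreal t) = ennreal (\<phi> t)"
    and \<psi>: "\<And>t. 0 < t \<Longrightarrow> 0 < \<psi> t" "\<And>s t. 0 < s \<Longrightarrow> s \<le> t \<Longrightarrow> \<psi> t * s \<le> \<psi> s * t"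
      "filterlim (\<lambda>t. \<psi> t / t) at_top (at_right 0)"
  shows "gprec (gauge_of (\<lambda>t. \<psi> (\<phi> t)) \<epsilon>) (dnorm d g)"
proof -
  define q where "q r = gauge_of (\<lambda>t. \<psi> (\<phi> t)) \<epsilon> r / dnorm d g r" for r
  have q: "q (ennreal t) = ennreal (\<psi> (\<phi> t) / \<phi> t)" if t: "0 < t" "t \<le> \<epsilon>" for t
    using t dim_gaugeD(2)[OF \<phi> t] \<psi>(1)[of "\<phi> t"]
    by (simp add: q_def g gauge_of_ennreal divide_ennreal less_imp_le)
  have "antimono_on {0<..ennreal \<epsilon>} q"
  proof (rule monotone_onI)
    fix a b assume ab: "a \<in> {0<..ennreal \<epsilon>}" "b \<in> {0<..ennreal \<epsilon>}" "a \<le> b"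
    obtain s where s: "a = ennreal s" "0 < s" "s \<le> \<epsilon>" using ab(1) by (rule mem_ennreal_IocE)
    obtain t where t: "b = ennreal t" "0 < t" "t \<le> \<epsilon>" using ab(2) by (rule mem_ennreal_IocE)
    have "s \<le> t" using ab(3) s t by simp
    then have "\<psi> (\<phi> t) * \<phi> s \<le> \<psi> (\<phi> s) * \<phi> t"
      using dim_gaugeD(2,3)[OF \<phi>] s t by (intro \<psi>(2)) auto
    then have "\<psi> (\<phi> t) / \<phi> t \<le> \<psi> (\<phi> s) / \<phi> s"
      using dim_gaugeD(2)[OF \<phi>, of s] dim_gaugeD(2)[OF \<phi>, of t] s t by (simp add: field_simps)
    then show "q b \<le> q a" using s t q by (simp add: ennreal_leI)
  qed
  moreover have "(q \<longlongrightarrow> top) (at_right 0)"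
    unfolding at_0_ennreal[symmetric]
  proof (rule order_tendstoI)
    fix c :: ennreal assume "c < top"
    then obtain z where z: "c = ennreal z" "0 \<le> z" by (cases c) auto
    from dim_gauge_at_right[OF \<phi>] have "filterlim (\<lambda>t. \<psi> (\<phi> t) / \<phi> t) at_top (at_right 0)"
      by (rule filterlim_compose[OF \<psi>(3)])
    then have "\<forall>\<^sub>F t in at_right 0. z + 1 \<le> \<psi> (\<phi> t) / \<phi> t" by (simp add: filterlim_at_top)
    then obtain b where b: "b > 0" "\<And>t. 0 < t \<Longrightarrow> t < b \<Longrightarrow> z + 1 \<le> \<psi> (\<phi> t) / \<phi> t"
      unfolding eventually_at_right_field by auto
    have "c < q (ennreal t)" if "0 < t" "t \<le> min (b / 2) \<epsilon>" for t
    proof -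
      have "z + 1 \<le> \<psi> (\<phi> t) / \<phi> t" using that b by (intro b(2)) auto
      then show ?thesis unfolding z(1) using that z(2) by (simp add: q ennreal_less_iff)
    qed
    then show "\<forall>\<^sub>F r in at 0. c < q r"
      unfolding eventually_at_0_ennreal using b(1) dim_gaugeD(1)[OF \<phi>]
      by (intro exI[of _ "min (b / 2) \<epsilon>"]) auto
  qed simp
  moreover have "ennreal \<epsilon> > 0" using dim_gaugeD(1)[OF \<phi>] by simp
  ultimately show ?thesis unfolding gprec_def q_def by blast
qed

text \<open>The quotient by t^d factors into \<psi>(\<phi> t) / \<phi> t and \<phi> t / t^d, both
  nonincreasing, the first one eventually at least 1. Convergence to 0 comes from summability: a
  single small value at some s n bounds all values to its left.\<close>

lemma dim_gauge_slow_modification: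
  assumes \<phi>: "dim_gauge d \<phi> \<epsilon>"
    and s: "\<And>n::nat. 0 < s n" "\<And>n. s n \<le> \<epsilon>"
    and \<psi>: "\<And>t. 0 < t \<Longrightarrow> 0 < \<psi> t" "\<And>s t. 0 < s \<Longrightarrow> s \<le> t \<Longrightarrow> \<psi> s \<le> \<psi> t"
      "\<And>s t. 0 < s \<Longrightarrow> s \<le> t \<Longrightarrow> \<psi> t * s \<le> \<psi> s * t"
      "filterlim (\<lambda>t. \<psi> t / t) at_top (at_right 0)" "summable (\<lambda>n. \<psi> (\<phi> (s n)))"
  shows "dim_gauge d (\<lambda>t. \<psi> (\<phi> t)) \<epsilon>"
  unfolding dim_gauge_def
proof (intro conjI allI impI)
  note g = dim_gaugeD[OF \<phi>]
  show "0 < \<epsilon>" by (rule g)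
  show "0 < \<psi> (\<phi> t)" if "0 < t \<and> t \<le> \<epsilon>" for t using that g(2) \<psi>(1) by simp
  fix u t assume ut: "0 < u \<and> u \<le> t \<and> t \<le> \<epsilon>"
  have pos: "0 < \<phi> u" "0 < \<phi> t" "\<phi> u \<le> \<phi> t" using ut g(2)[of u] g(2)[of t] g(3)[of u t] by auto
  show "\<psi> (\<phi> u) \<le> \<psi> (\<phi> t)" using pos by (intro \<psi>(2)) auto
  have "\<phi> u * (\<psi> (\<phi> t) * u ^ d) = (\<psi> (\<phi> t) * \<phi> u) * u ^ d" by simp
  also have "\<dots> \<le> (\<psi> (\<phi> u) * \<phi> t) * u ^ d" using \<psi>(3)[OF pos(1,3)] ut by (intro mult_right_mono) auto
  also have "\<dots> = \<psi> (\<phi> u) * (\<phi> t * u ^ d)" by simp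
  also have "\<dots> \<le> \<psi> (\<phi> u) * (\<phi> u * t ^ d)"
    using g(4)[of u t] ut \<psi>(1)[OF pos(1)] by (intro mult_left_mono) (auto simp: less_imp_le)
  also have "\<dots> = \<phi> u * (\<psi> (\<phi> u) * t ^ d)" by simp
  finally show "\<psi> (\<phi> t) * u ^ d \<le> \<psi> (\<phi> u) * t ^ d" using pos(1) by simp
next
  note g = dim_gaugeD[OF \<phi>]
  show "((\<lambda>t. \<psi> (\<phi> t)) \<longlongrightarrow> 0) (at_right 0)"
  proof (rule tendstoI)
    fix e :: real assume "e > 0"
    then have "\<forall>\<^sub>F n in sequentially. \<psi> (\<phi> (s n)) < e"
      by (rule order_tendstoD(2)[OF summable_LIMSEQ_zero[OF \<psi>(5)]])
    then obtain n where n: "\<psi> (\<phi> (s n)) < e" by (meson eventually_sequentially le_refl)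
    have "dist (\<psi> (\<phi> t)) 0 < e" if t: "0 < t" "t < s n" for t
    proof -
      have p: "0 < \<phi> t" "\<phi> t \<le> \<phi> (s n)" using t g(2)[of t] g(3)[of t "s n"] s(2)[of n] by auto
      then show ?thesis using \<psi>(1)[OF p(1)] \<psi>(2)[OF p] n by simp
    qed
    then show "\<forall>\<^sub>F t in at_right 0. dist (\<psi> (\<phi> t)) 0 < e"
      unfolding eventually_at_right_field using s(1) by blast
  qed
  have pos: "\<forall>\<^sub>F t in at_right 0. 0 < t \<and> t \<le> \<epsilon>"
    unfolding eventually_at_right_field using g(1) by (intro exI[of _ \<epsilon>]) auto
  from dim_gauge_at_right[OF \<phi>] have "filterlim (\<lambda>t. \<psi> (\<phi> t) / \<phi> t) at_top (at_right 0)"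
    by (rule filterlim_compose[OF \<psi>(4)])
  then have "\<forall>\<^sub>F t in at_right 0. 1 \<le> \<psi> (\<phi> t) / \<phi> t" by (simp add: filterlim_at_top)
  then have "\<forall>\<^sub>F t in at_right 0. \<phi> t / t ^ d \<le> \<psi> (\<phi> t) / t ^ d"
    using pos
  proof eventually_elim
    case (elim t)
    then have "\<phi> t \<le> \<psi> (\<phi> t)" using g(2)[of t] by (simp add: field_simps)
    then show ?case using elim by (intro divide_right_mono) auto
  qed
  then show "filterlim (\<lambda>t. \<psi> (\<phi> t) / t ^ d) at_top (at_right 0)"
    by (rule filterlim_at_top_mono[OF g(6)])
qed

section \<open>Net contents\<close>

context euclidean_norm
begin

text \<open>A scale \<rho> <= r almost attaining the infimum in g_d(r) is chosen. About (r/\<rho>)^d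
  cubes of that size cover the ball, and their total cost is comparable with g_d(r). The slack
  \<eta> is there because the infimum need not be attained. The factor 4 \<open>kap\<close> combines
  2 \<open>kap\<close> from the choice of generation with r + \<rho> <= 2 r.\<close>

lemma ball_cover:
  assumes g: "mono_on {0..ennreal \<epsilon>} g" and r: "0 < r" "r \<le> \<epsilon>" and a: "0 \<le> a" "0 < \<eta>"
    and dn: "dnorm DIM('a) g (ennreal r) \<le> ennreal a"
  shows "\<exists>Q. Q \<subseteq> dyadic_cubes \<and> nball x r \<subseteq> \<Union>Q \<and> (\<forall>q\<in>Q. ediam N q \<le> ennreal r) \<and>
      csum (\<lambda>p. g (ediam N p)) Q \<le> ennreal (vN * (4 * kap) ^ DIM('a) * (a + \<eta>))"
proof -
  let ?d = "DIM('a)"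
  have "dratio ?d g r < ennreal ((a + \<eta>) / r ^ ?d)"
  proof (rule ccontr)
    assume "\<not> ?thesis"
    then have "ennreal (r ^ ?d) * ennreal ((a + \<eta>) / r ^ ?d) \<le> dnorm ?d g (ennreal r)"
      unfolding dnorm_eq_dratio[OF r(1)] by (intro mult_left_mono) auto
    then have "ennreal (a + \<eta>) \<le> ennreal a"
      using dn r a by (simp add: ennreal_mult[symmetric] order_trans)
    then show False using a by simp
  qed
  then obtain \<rho>' where \<rho>': "\<rho>' \<in> {0<..ennreal r}" "g \<rho>' / \<rho>' ^ ?d < ennreal ((a + \<eta>) / r ^ ?d)"
    unfolding dratio_def INF_less_iff by blast
  obtain \<rho> where \<rho>: "\<rho>' = ennreal \<rho>" "0 < \<rho>" "\<rho> \<le> r" using \<rho>'(1) by (rule mem_ennreal_IocE)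
  have "g (ennreal \<rho>) / ennreal (\<rho> ^ ?d) \<le> ennreal ((a + \<eta>) / r ^ ?d)"
    using \<rho>'(2) \<rho> by (simp add: ennreal_power less_imp_le)
  then have "ennreal (\<rho> ^ ?d) * (g (ennreal \<rho>) / ennreal (\<rho> ^ ?d)) \<le> ennreal (\<rho> ^ ?d) * ennreal ((a + \<eta>) / r ^ ?d)"
    by (intro mult_left_mono) auto
  also have "\<dots> = ennreal (\<rho> ^ ?d * ((a + \<eta>) / r ^ ?d))"
    using \<rho> r a by (intro ennreal_mult[symmetric]) auto
  finally have g\<rho>: "g (ennreal \<rho>) \<le> ennreal (\<rho> ^ ?d * ((a + \<eta>) / r ^ ?d))"
    using \<rho>(2) by (simp add: ennreal_divide_mult_cancel)
  obtain k where k: "cube_diam k \<le> \<rho>" "\<rho> < 2 * (cube_diam k)"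
    by (rule generation_exists[OF \<rho>(2)]) (rule that)
  let ?Q = "cubes_meeting k (nball x r)"
  have fin: "finite ?Q" by (rule cubes_meeting_nball(1)[OF r(1)])
  have "real (card ?Q) \<le> vN * (2 * kap) ^ ?d * ((r + \<rho>) / \<rho>) ^ ?d"
    by (rule card_cubes_meeting_le[OF r(1) \<rho>(2) k])
  also have "\<dots> \<le> vN * (2 * kap) ^ ?d * ((2 * r) / \<rho>) ^ ?d"
    using \<rho> r vN_pos kap_pos by (intro mult_left_mono power_mono divide_right_mono) (auto simp: less_imp_le)
  finally have card: "real (card ?Q) \<le> vN * (2 * kap) ^ ?d * ((2 * r) / \<rho>) ^ ?d" .
  have gq: "g (ediam N q) \<le> g (ennreal \<rho>)" if "q \<in> ?Q" for q
  proof -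
    have "ediam N q = ennreal (cube_diam k)"
      using that by (auto simp: cubes_meeting_def ediam_dcube)
    then show ?thesis
      using k(1) \<rho> r by (intro mono_onD[OF g]) (auto intro!: ennreal_leI)
  qed
  have "csum (\<lambda>p. g (ediam N p)) ?Q = (\<Sum>p\<in>?Q. g (ediam N p))" using fin by (rule csum_finite)
  also have "\<dots> \<le> of_nat (card ?Q) * g (ennreal \<rho>)" by (rule sum_bounded_above[OF gq])
  also have "\<dots> \<le> ennreal (vN * (2 * kap) ^ ?d * ((2 * r) / \<rho>) ^ ?d) * ennreal (\<rho> ^ ?d * ((a + \<eta>) / r ^ ?d))"
    using card g\<rho> by (intro mult_mono) (auto simp: ennreal_of_nat_eq_real_of_nat ennreal_leI)
  also have "\<dots> = ennreal (vN * (2 * kap) ^ ?d * ((2 * r) / \<rho>) ^ ?d * (\<rho> ^ ?d * ((a + \<eta>) / r ^ ?d)))"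
    using \<rho> r a vN_pos kap_pos by (intro ennreal_mult[symmetric]) (auto simp: less_imp_le)
  also have "vN * (2 * kap) ^ ?d * ((2 * r) / \<rho>) ^ ?d * (\<rho> ^ ?d * ((a + \<eta>) / r ^ ?d))
      = vN * ((2 * kap) * ((2 * r) / \<rho>) * \<rho> * (1 / r)) ^ ?d * (a + \<eta>)"
    by (simp only: power_mult_distrib power_one_over) (simp add: divide_inverse)
  also have "(2 * kap) * ((2 * r) / \<rho>) * \<rho> * (1 / r) = 4 * kap" using \<rho> r by simp
  finally have "csum (\<lambda>p. g (ediam N p)) ?Q \<le> ennreal (vN * (4 * kap) ^ ?d * (a + \<eta>))" .
  moreover have "ediam N q \<le> ennreal r" if "q \<in> ?Q" for q
    using that k(1) \<rho>(3) by (auto simp: cubes_meeting_def ediam_dcube intro!: ennreal_leI)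
  ultimately show ?thesis
    by (intro exI[of _ ?Q]) (simp add: cubes_meeting_dyadic cubes_meeting_cover)
qed

lemma hausdorff_limsup_zero:
  assumes g: "mono_on {0..ennreal \<epsilon>} g" "g 0 = 0" and \<epsilon>: "0 < \<epsilon>"
    and dn: "\<And>t. 0 < t \<Longrightarrow> t \<le> \<epsilon> \<Longrightarrow> dnorm DIM('a) g (ennreal t) = ennreal (\<phi> t) \<and> 0 \<le> \<phi> t"
    and r: "\<And>n. 0 < r n" "r \<longlonglongrightarrow> 0" and sm: "summable (\<lambda>n. \<phi> (min (r n) \<epsilon>))"
  shows "hausdorff_g N g (limsup_balls x r) = 0"
proof -
  let ?d = "DIM('a)"
  define K where "K = vN * (4 * kap) ^ ?d"
  have K: "K > 0" unfolding K_def by (intro mult_pos_pos zero_less_power) auto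
  \<comment> \<open>The slack for the n-th ball is (1/2)^n, so the total cost stays
    summable.\<close>
  define f where "f n = \<phi> (min (r n) \<epsilon>) + (1/2) ^ n" for n
  have smf: "summable f" unfolding f_def[abs_def] by (intro summable_add sm summable_geometric) simp
  have f0: "0 \<le> f n" for n unfolding f_def using dn[of "min (r n) \<epsilon>"] r(1) \<epsilon> by auto
  have "hausdorff_pre N g \<delta> (limsup_balls x r) \<le> 0" if \<delta>: "\<delta> > 0" for \<delta>
  proof (rule ennreal_le_epsilon)
    fix e :: real assume e: "e > 0"
    have "\<forall>\<^sub>F n in sequentially. r n < min \<delta> \<epsilon>" using r(2) \<delta> \<epsilon> by (intro order_tendstoD) auto
    then obtain m1 where m1: "\<And>n. n \<ge> m1 \<Longrightarrow> r n < min \<delta> \<epsilon>" by (auto simp: eventually_sequentially)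
    have "e / K > 0" using e K by simp
    then obtain m2 where m2: "\<And>n. n \<ge> m2 \<Longrightarrow> norm (\<Sum>i. f (i + n)) < e / K"
      using suminf_exist_split[OF _ smf] by blast
    define m where "m = max m1 m2"
    have rm: "r n < \<delta>" "r n < \<epsilon>" if "n \<ge> m" for n using m1[of n] that by (auto simp: m_def)
    have smm: "summable (\<lambda>i. f (i + m))" using smf by (simp add: summable_iff_shift)
    have ex: "\<exists>Q. Q \<subseteq> dyadic_cubes \<and> nball (x (n + m)) (r (n + m)) \<subseteq> \<Union>Q \<and> (\<forall>q\<in>Q. ediam N q \<le> ennreal (r (n + m))) \<and>
      csum (\<lambda>p. g (ediam N p)) Q \<le> ennreal (K * f (n + m))" for n
    proof -
      have "r (n + m) \<le> \<epsilon>" using rm(2)[of "n + m"] by simp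
      then show ?thesis
        using ball_cover[OF g(1) r(1) _ _ _ , of "n + m" "\<phi> (r (n + m))" "(1/2) ^ (n + m)"] dn[OF r(1), of "n + m"]
        by (simp add: f_def K_def min_absorb1)
    qed
    obtain Q where "\<forall>n. Q n \<subseteq> dyadic_cubes \<and> nball (x (n + m)) (r (n + m)) \<subseteq> \<Union>(Q n) \<and>
      (\<forall>q\<in>Q n. ediam N q \<le> ennreal (r (n + m))) \<and> csum (\<lambda>p. g (ediam N p)) (Q n) \<le> ennreal (K * f (n + m))"
      using choice[OF allI, OF ex] by (rule exE)
    then have Q: "\<And>n. Q n \<subseteq> dyadic_cubes" "\<And>n. nball (x (n + m)) (r (n + m)) \<subseteq> \<Union>(Q n)"
      "\<And>n q. q \<in> Q n \<Longrightarrow> ediam N q \<le> ennreal (r (n + m))"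
      "\<And>n. csum (\<lambda>p. g (ediam N p)) (Q n) \<le> ennreal (K * f (n + m))" by simp_all
    have Qd: "(\<Union>n. Q n) \<subseteq> dyadic_cubes" using Q(1) by (rule UN_least)
    have cov: "limsup_balls x r \<subseteq> \<Union>(\<Union>n. Q n)"
    proof
      fix y assume "y \<in> limsup_balls x r"
      then obtain n where n: "n \<ge> m" "y \<in> nball (x n) (r n)"
        unfolding limsup_balls_eq by blast
      then have "y \<in> \<Union>(Q (n - m))" using Q(2)[of "n - m"] by auto
      then show "y \<in> \<Union>(\<Union>n. Q n)" by auto
    qed
    have diam: "ediam N p \<le> ennreal \<delta>" if pQ: "p \<in> (\<Union>n. Q n)" for p
    proof -
      obtain n where n: "p \<in> Q n" using pQ by (rule UN_E)
      then have "ediam N p \<le> ennreal (r (n + m))" by (rule Q(3))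
      also have "\<dots> \<le> ennreal \<delta>" using rm(1)[of "n + m"] by (intro ennreal_leI) simp
      finally show ?thesis .
    qed
    have "hausdorff_pre N g \<delta> (limsup_balls x r) \<le> csum (\<lambda>p. g (ediam N p)) (\<Union>n. Q n)"
      using Qd countable_dyadic_cubes countable_subset by (intro hausdorff_le_csum cov diam g(2)) blast
    also have "\<dots> \<le> (\<Sum>n. ennreal (K * f (n + m)))"
      by (rule order_trans[OF csum_UN_le suminf_le]) (rule Q(4), auto)
    also have "\<dots> = ennreal (K * (\<Sum>n. f (n + m)))"
      using f0 K by (intro suminf_ennreal_eq sums_mult summable_sums smm) (simp add: less_imp_le)
    also have "\<dots> \<le> ennreal e"
    proof (rule ennreal_leI)
      have "(\<Sum>n. f (n + m)) < e / K" using m2[of m] by (simp add: m_def abs_less_iff)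
      then show "K * (\<Sum>n. f (n + m)) \<le> e" using K by (simp add: field_simps)
    qed
    finally show "hausdorff_pre N g \<delta> (limsup_balls x r) \<le> 0 + ennreal e" by simp
  qed
  then have "hausdorff_g N g (limsup_balls x r) \<le> 0"
    unfolding hausdorff_g_eq by (intro SUP_least) auto
  then show ?thesis by simp
qed

lemma hausdorff_mono: "E \<subseteq> E' \<Longrightarrow> hausdorff_g N g E \<le> hausdorff_g N g E'"
  unfolding hausdorff_g_eq hausdorff_pre_def by (intro SUP_mono' INF_superset_mono) auto

lemma open_small_cube:
  assumes "open U" "U \<noteq> {}" "\<epsilon> > 0"
  obtains j y where "dcube j y \<subseteq> U" "cube_diam j \<le> \<epsilon>"
proof -
  obtain k where k: "cube_diam k \<le> \<epsilon>"
    by (rule generation_exists[OF assms(3)]) (rule that)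
  obtain W where W: "W \<subseteq> dyadic_cubes" "\<And>w. w \<in> W \<Longrightarrow> closure w \<subseteq> U" "\<Union>W = U"
    "disjoint W" "\<And>w. w \<in> W \<Longrightarrow> \<exists>j\<ge>k. \<exists>y. w = dcube j y"
    by (rule whitney[OF assms(1), of k]) (rule that)
  obtain w where w: "w \<in> W" using W(3) assms(2) by auto
  obtain j y where j: "j \<ge> k" "w = dcube j y" using W(5)[OF w] by auto
  have "cube_diam j \<le> cube_diam k" using j by simp
  from order_trans[OF this k] show ?thesis
    using that[of j y] W(2)[OF w] closure_subset[of w] j(2) by auto
qed

text \<open>The multiple of Lebesgue measure giving the cube exactly its weight gives every smaller
  cube at most its weight, since \<phi> t / t^d is nonincreasing; subadditivity of volume does the
  rest.\<close>

lemma cube_content_ge: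
  assumes \<phi>: "dim_gauge DIM('a) \<phi> \<epsilon>" and j: "cube_diam j \<le> \<epsilon>"
    and C: "C \<subseteq> dyadic_cubes" "\<And>p. p \<in> C \<Longrightarrow> p \<subseteq> dcube j y" "dcube j y \<subseteq> \<Union>C"
  shows "wt \<phi> (dcube j y) \<le> csum (wt \<phi>) C"
proof -
  let ?d = "DIM('a)" let ?D = "cube_diam j"
  define b where "b = \<phi> ?D / (2 powr - of_int j) ^ ?d"
  have \<phi>D: "0 < \<phi> ?D" using j by (intro dim_gaugeD(2)[OF \<phi>]) auto
  then have b: "b > 0" by (simp add: b_def)
  have le: "ennreal b * emeasure lborel p \<le> wt \<phi> p" if p: "p \<in> C" for p
  proof -
    obtain k w where k: "p = dcube k w" using p C(1) by (meson dyadic_cubesE subsetD)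
    let ?t = "cube_diam k"
    have "j \<le> k" using C(2)[OF p] dcube_gen_inj k by blast
    then have "?t \<le> ?D" by simp
    then have "\<phi> ?D * ?t ^ ?d \<le> \<phi> ?t * ?D ^ ?d" using j by (intro dim_gaugeD(4)[OF \<phi>]) auto
    then have "kap ^ ?d * (\<phi> ?D * (2 powr - of_int k) ^ ?d) \<le> kap ^ ?d * (\<phi> ?t * (2 powr - of_int j) ^ ?d)"
      by (simp add: power_mult_distrib ac_simps)
    then have "\<phi> ?D * (2 powr - of_int k) ^ ?d \<le> \<phi> ?t * (2 powr - of_int j) ^ ?d"
      by (rule mult_left_le_imp_le) simp
    then have "b * (2 powr - of_int k) ^ ?d \<le> \<phi> ?t" by (simp add: b_def field_simps)
    then show ?thesis using b by (simp add: k emeasure_dcube ennreal_mult[symmetric] ennreal_leI)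
  qed
  have cC: "countable C" using C(1) countable_dyadic_cubes countable_subset by blast
  have meas: "p \<in> sets borel" if pC: "p \<in> C" for p
  proof -
    obtain k w where "p = dcube k w" using pC C(1) by (meson dyadic_cubesE subsetD)
    then show ?thesis by simp
  qed
  have "wt \<phi> (dcube j y) = ennreal b * emeasure lborel (dcube j y)"
    using b by (simp add: emeasure_dcube b_def ennreal_mult[symmetric])
  also have "\<dots> \<le> ennreal b * csum (\<lambda>q. emeasure lborel (q \<inter> dcube j y)) C"
    using cC C(3) meas by (intro mult_left_mono emeasure_le_csum) auto
  also have "\<dots> = csum (\<lambda>q. ennreal b * emeasure lborel (q \<inter> dcube j y)) C"
    by (rule csum_cmult[symmetric])
  also have "\<dots> \<le> csum (wt \<phi>) C"
    using C(2) le by (intro csum_mono) (simp add: Int_absorb2)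
  finally show ?thesis .
qed

section \<open>Net contents of open sets and limsup sets\<close>

lemma M_inf_eq:
  "M_inf d N h E = (INF C\<in>{C. C \<subseteq> dyadic_cubes \<and> (\<forall>c\<in>C. ediam N c < eps_h d h) \<and> E \<subseteq> \<Union>C}.
     csum (\<lambda>c. h (ediam N c)) C)"
proof -
  have "countable C" if "C \<subseteq> dyadic_cubes" for C :: "'a set set"
    using that countable_dyadic_cubes countable_subset by blast
  then show ?thesis
    unfolding M_inf_def by (intro INF_cong) (auto simp: infsum_eq_csum)
qed

lemma M_inf_mono: "E \<subseteq> E' \<Longrightarrow> M_inf d N h E \<le> M_inf d N h E'"
  unfolding M_inf_eq by (intro INF_superset_mono) auto

lemma M_inf_open_pos:
  assumes U: "open U" "U \<noteq> {}" and \<phi>: "dim_gauge DIM('a) \<phi> \<epsilon>"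
    and h: "\<And>t. 0 < t \<Longrightarrow> t \<le> \<epsilon> \<Longrightarrow> h (ennreal t) = ennreal (\<phi> t)"
  shows "0 < M_inf DIM('a) N h U"
proof -
  let ?d = "DIM('a)"
  obtain j y where j: "dcube j y \<subseteq> U" "cube_diam j \<le> \<epsilon>"
    by (rule open_small_cube[OF U dim_gaugeD(1)[OF \<phi>]]) (rule that)
  let ?D = "cube_diam j"
  have hw: "h (ediam N q) = wt \<phi> q" if "q \<in> dyadic_cubes" "q \<subseteq> dcube j y" for q
  proof -
    obtain k w where k: "q = dcube k w" using \<open>q \<in> dyadic_cubes\<close> by (rule dyadic_cubesE)
    then have "j \<le> k" using dcube_gen_inj that(2) by blast
    then have "cube_diam k \<le> ?D" by simp
    from order_trans[OF this j(2)] show ?thesis by (simp add: k ediam_dcube h)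
  qed
  have "wt \<phi> (dcube j y) \<le> csum (\<lambda>c. h (ediam N c)) C"
    if C: "C \<subseteq> dyadic_cubes" "\<forall>c\<in>C. ediam N c < eps_h ?d h" "U \<subseteq> \<Union>C" for C
  proof (cases "\<exists>p\<in>C. dcube j y \<subseteq> p")
    case True
    then obtain p where p: "p \<in> C" "dcube j y \<subseteq> p" by blast
    have "ediam N p < eps_h ?d h" using C(2) p(1) by blast
    then obtain \<epsilon>' where \<epsilon>': "mono_on {0..ennreal \<epsilon>'} h" "ediam N p < ennreal \<epsilon>'"
      unfolding eps_h_def less_SUP_iff by blast
    have le: "ediam N (dcube j y) \<le> ediam N p"
      unfolding ediam_def using p(2) by (intro SUP_subset_mono) auto
    have "h (ediam N (dcube j y)) \<le> h (ediam N p)"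
      using le \<epsilon>'(2) by (intro mono_onD[OF \<epsilon>'(1)]) auto
    also have "\<dots> \<le> csum (\<lambda>c. h (ediam N c)) C" using p(1) by (rule csum_member)
    finally show ?thesis using hw[of "dcube j y"] by simp
  next
    case False
    define C' where "C' = {p \<in> C. p \<subseteq> dcube j y}"
    have C': "C' \<subseteq> dyadic_cubes" "\<And>p. p \<in> C' \<Longrightarrow> p \<subseteq> dcube j y" using C(1) by (auto simp: C'_def)
    have "dcube j y \<subseteq> \<Union>C'"
    proof
      fix z assume z: "z \<in> dcube j y"
      then obtain p where p: "p \<in> C" "z \<in> p" using C(3) j(1) by blast
      then have "p \<subseteq> dcube j y" using False dyadic_trichotomy[of p "dcube j y"] C(1) z by auto
      then show "z \<in> \<Union>C'" using p by (auto simp: C'_def)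
    qed
    with C' have "wt \<phi> (dcube j y) \<le> csum (wt \<phi>) C'" by (intro cube_content_ge[OF \<phi> j(2)]) auto
    also have "\<dots> = csum (\<lambda>c. h (ediam N c)) C'" using hw C' by (intro csum_cong) auto
    also have "\<dots> \<le> csum (\<lambda>c. h (ediam N c)) C" by (rule csum_mono_set) (auto simp: C'_def)
    finally show ?thesis .
  qed
  then have "wt \<phi> (dcube j y) \<le> M_inf ?d N h U" unfolding M_inf_eq by (intro INF_greatest) auto
  moreover have "0 < wt \<phi> (dcube j y)" using dim_gaugeD(2)[OF \<phi> _ j(2)] by simp
  ultimately show ?thesis by (rule order_less_le_trans[rotated])
qed

text \<open>Sets of vanishing Hausdorff measure have cheap dyadic covers; taking diameters at most
  \<epsilon>/2 meets the strict bound by \<open>eps_h\<close>.\<close>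

lemma M_inf_zero:
  assumes H: "hausdorff_g N h E = 0" and \<phi>: "dim_gauge DIM('a) \<phi> \<epsilon>"
    and h: "\<And>t. 0 < t \<Longrightarrow> t \<le> \<epsilon> \<Longrightarrow> h (ennreal t) = ennreal (\<phi> t)" and \<epsilon>: "ennreal \<epsilon> \<le> eps_h DIM('a) h"
  shows "M_inf DIM('a) N h E = 0"
proof -
  have "M_inf DIM('a) N h E \<le> 0 + ennreal e" if e: "e > 0" for e
  proof -
    note pos = dim_gaugeD(1)[OF \<phi>]
    have half: "\<epsilon> / 2 > 0" using pos by simp
    have h': "ennreal (\<phi> t) \<le> h (ennreal t)" if "0 < t" "t \<le> \<epsilon>" for t using h that by simp
    obtain C where C: "C \<subseteq> dyadic_cubes" "E \<subseteq> \<Union>C" "\<And>p. p \<in> C \<Longrightarrow> ediam N p \<le> ennreal (\<epsilon> / 2)"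
      "csum (wt \<phi>) C \<le> ennreal e"
      by (rule hausdorff_to_cubes[OF H \<phi> h' half e]) (assumption+, rule that)
    have lt: "ennreal (\<epsilon> / 2) < ennreal \<epsilon>" using pos by (intro ennreal_lessI) auto
    have "csum (\<lambda>c. h (ediam N c)) C = csum (wt \<phi>) C"
    proof (rule csum_cong)
      fix p assume p: "p \<in> C"
      then obtain k w where k: "p = dcube k w" using C(1) by (meson dyadic_cubesE subsetD)
      have "cube_diam k \<le> \<epsilon> / 2" using C(3)[OF p] pos by (simp add: k ediam_dcube)
      then show "h (ediam N p) = wt \<phi> p" using pos by (simp add: k ediam_dcube h)
    qed
    moreover have "ediam N p < eps_h DIM('a) h" if "p \<in> C" for p
      using C(3)[OF that] lt \<epsilon> by simp
    ultimately show ?thesis using C unfolding M_inf_eq by (intro INF_lower2[of C]) auto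
  qed
  then have "M_inf DIM('a) N h E \<le> 0" by (rule ennreal_le_epsilon)
  then show ?thesis by simp
qed

text \<open>The cover completed by \<open>content_boost\<close> competes for the content of V.
  Members of the given cover may be too large for the profile, so weights are compared only inside
  cubes of generation at least J; there the bound \<epsilon>/2 also makes the added cubes
  admissible. A cover of infinite cost needs no argument.\<close>

lemma M_inf_limsup:
  assumes x: "uniformly_eutaxic N U x" and r: "decseq r" "\<And>n. 0 < r n" "r \<longlonglongrightarrow> 0"
    and \<phi>: "dim_gauge DIM('a) \<phi> \<epsilon>" "\<not> summable (\<lambda>n. \<phi> (min (r n) \<epsilon>))"
    and h: "\<And>t. 0 < t \<Longrightarrow> t \<le> \<epsilon> \<Longrightarrow> h (ennreal t) = ennreal (\<phi> t)" and \<epsilon>: "ennreal \<epsilon> \<le> eps_h DIM('a) h"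
    and V: "open V" "V \<subseteq> U"
  shows "M_inf DIM('a) N h (limsup_balls x r \<inter> V) = M_inf DIM('a) N h V"
proof (rule antisym)
  show "M_inf DIM('a) N h (limsup_balls x r \<inter> V) \<le> M_inf DIM('a) N h V"
    by (rule M_inf_mono) simp
next
  let ?f = "\<lambda>p. h (ediam N p)"
  note pos = dim_gaugeD(1)[OF \<phi>(1)]
  have "\<epsilon> / 2 > 0" using pos by simp
  then obtain J where J: "cube_diam J \<le> \<epsilon> / 2"
    using generation_exists by blast
  have small: "cube_diam k \<le> \<epsilon> / 2" if "k \<ge> J" for k
  proof -
    have "cube_diam k \<le> cube_diam J" using that by simp
    from order_trans[OF this J] show ?thesis .
  qed
  have fw: "?f (dcube k w) = wt \<phi> (dcube k w)" if "k \<ge> J" for k w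
    using small[OF that] pos by (simp add: ediam_dcube h)
  show "M_inf DIM('a) N h V \<le> M_inf DIM('a) N h (limsup_balls x r \<inter> V)"
    unfolding M_inf_eq[of _ _ "limsup_balls x r \<inter> V"]
  proof (rule INF_greatest)
    fix C assume "C \<in> {C. C \<subseteq> dyadic_cubes \<and> (\<forall>c\<in>C. ediam N c < eps_h DIM('a) h) \<and> limsup_balls x r \<inter> V \<subseteq> \<Union>C}"
    then have C: "C \<subseteq> dyadic_cubes" "\<And>c. c \<in> C \<Longrightarrow> ediam N c < eps_h DIM('a) h" "limsup_balls x r \<inter> V \<subseteq> \<Union>C"
      by auto
    show "M_inf DIM('a) N h V \<le> csum ?f C"
    proof (cases "csum ?f C = top")
      case False
      then have fin: "csum ?f C < top" by (simp add: less_top)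
      show ?thesis
      proof (rule limsup_content[OF \<phi>(1) x r \<phi>(2)])
        fix c :: real
        assume c: "0 < c" and content: "\<And>j y C. dcube j y \<subseteq> U \<Longrightarrow> cube_diam j \<le> \<epsilon> \<Longrightarrow>
          C \<subseteq> dyadic_cubes \<Longrightarrow> (\<And>p. p \<in> C \<Longrightarrow> p \<subseteq> dcube j y) \<Longrightarrow> limsup_balls x r \<inter> dcube j y \<subseteq> \<Union>C \<Longrightarrow>
          ennreal c * wt \<phi> (dcube j y) \<le> csum (wt \<phi>) C"
        have loc: "ennreal c * ?f w \<le> csum ?f C'"
          if w: "w = dcube k y" and k: "k \<ge> J" and wV: "w \<subseteq> V" and C': "C' \<subseteq> dyadic_cubes"
            "\<And>p. p \<in> C' \<Longrightarrow> p \<subseteq> w" "limsup_balls x r \<inter> w \<subseteq> \<Union>C'" for w k y C'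
        proof -
          have "csum ?f C' = csum (wt \<phi>) C'"
          proof (rule csum_cong)
            fix p assume p: "p \<in> C'"
            then obtain l u where l: "p = dcube l u" using C'(1) by (meson dyadic_cubesE subsetD)
            then have "k \<le> l" using C'(2)[OF p] w dcube_gen_inj by blast
            then show "?f p = wt \<phi> p" using fw[of l u] k l by simp
          qed
          moreover have "cube_diam k \<le> \<epsilon>" using small[OF k] pos by linarith
          then have "ennreal c * wt \<phi> (dcube k y) \<le> csum (wt \<phi>) C'"
            using wV V(2) C' unfolding w by (intro content) auto
          ultimately show ?thesis using fw[OF k] w by simp
        qed
        show ?thesis
        proof (rule ennreal_le_epsilon)
          fix e :: real assume "e > 0"
          then have e: "ennreal e > 0" by simp
          show "M_inf DIM('a) N h V \<le> csum ?f C + ennreal e"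
          proof (rule content_boost[OF V(1) c loc C(1,3) fin e])
            fix W assume W: "W \<subseteq> dyadic_cubes" "\<And>w. w \<in> W \<Longrightarrow> \<exists>k\<ge>J. \<exists>y. w = dcube k y"
              "V \<subseteq> \<Union>(C \<union> W)" "csum ?f (C \<union> W) \<le> csum ?f C + ennreal e"
            have "ediam N w < eps_h DIM('a) h" if w: "w \<in> W" for w
            proof -
              obtain k y where k: "k \<ge> J" "w = dcube k y" using W(2)[OF w] by auto
              have "ennreal (cube_diam k) < ennreal \<epsilon>"
                using small[OF k(1)] pos by (intro ennreal_lessI) auto
              then show ?thesis using \<epsilon> by (simp add: k(2) ediam_dcube)
            qed
            then have "M_inf DIM('a) N h V \<le> csum ?f (C \<union> W)"
              unfolding M_inf_eq using W(1,3) C(1,2) by (intro INF_lower) auto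
            then show ?thesis using W(4) by (rule order_trans)
          qed
        qed
      qed
    qed simp
  qed
qed

end

section \<open>Describability\<close>

text \<open>A gauge need not be measurable, but the infimum over (0, t] is monotone in t, so its
  superlevel sets are intervals.\<close>

lemma dratio_borel [measurable]: "dratio d g \<in> borel_measurable borel"
proof (rule borel_measurableI_greater)
  fix y
  have "is_interval {t. y < dratio d g t}"
    unfolding is_interval_1 using dratio_antimono[of _ _ d g] order_less_le_trans by blast
  then show "{t \<in> space borel. y < dratio d g t} \<in> sets borel"
    by (simp add: real_interval_borel_measurable)
qed

lemma nn_integral_nr:
  assumes f: "(\<lambda>t. indicator {0<..1} t * f t) \<in> borel_measurable borel" and r: "\<And>n. 0 < r n"
  shows "(\<integral>\<^sup>+t. indicator {0<..1} t * f t \<partial>nr r) = csum (\<lambda>n. f (r n)) {n. r n \<le> 1}"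
proof -
  have "(\<integral>\<^sup>+t. indicator {0<..1} t * f t \<partial>nr r)
      = (\<integral>\<^sup>+n. indicator {0<..1} (r n) * f (r n) \<partial>count_space {n. r n \<le> 1})"
    unfolding nr_def by (rule nn_integral_distr) (use f in auto)
  also have "\<dots> = csum (\<lambda>n. f (r n)) {n. r n \<le> 1}"
    unfolding csum_count_space using r by (intro nn_integral_cong) simp
  finally show ?thesis .
qed

text \<open>From some index on r n < \<epsilon> <= 1, and there the two sums have the same terms.
  The finitely many remaining terms are finite by \<open>dnorm_finite\<close>, so divergence is
  decided by the common tail.\<close>

lemma integral_dnorm_nr:
  assumes r: "\<And>n. 0 < r n" "r \<longlonglongrightarrow> 0" and g: "gauge g"
    and \<phi>: "dim_gauge d \<phi> \<epsilon>" "\<epsilon> \<le> 1"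
    and dn: "\<And>t. 0 < t \<Longrightarrow> t \<le> \<epsilon> \<Longrightarrow> dnorm d g (ennreal t) = ennreal (\<phi> t)"
  shows "(\<integral>\<^sup>+t. indicator {0<..1} t * dnorm d g (ennreal t) \<partial>nr r) = top \<longleftrightarrow>
    \<not> summable (\<lambda>n. \<phi> (min (r n) \<epsilon>))"
proof -
  define P where "P = {n. r n \<le> 1}"
  define G where "G n = dnorm d g (ennreal (r n))" for n
  define a where "a n = \<phi> (min (r n) \<epsilon>)" for n
  note pos = dim_gaugeD(1)[OF \<phi>(1)]
  have a: "0 < a n" for n unfolding a_def using r(1)[of n] pos by (intro dim_gaugeD(2)[OF \<phi>(1)]) auto
  have Gfin: "G n < top" for n unfolding G_def by (rule dnorm_finite[OF g r(1)])
  have "(\<lambda>t. indicator {0<..1} t * dnorm d g (ennreal t)) = (\<lambda>t. indicator {0<..1} t * (ennreal (t ^ d) * dratio d g t))"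
    by (auto simp: fun_eq_iff indicator_def dnorm_eq_dratio)
  also have "\<dots> \<in> borel_measurable borel" by measurable
  finally have int: "(\<integral>\<^sup>+t. indicator {0<..1} t * dnorm d g (ennreal t) \<partial>nr r) = csum G P"
    unfolding G_def P_def by (intro nn_integral_nr r(1))
  have "\<forall>\<^sub>F n in sequentially. r n < \<epsilon>" using r(2) pos by (rule order_tendstoD)
  then obtain m where m: "\<And>n. n \<ge> m \<Longrightarrow> r n < \<epsilon>" by (auto simp: eventually_sequentially)
  have Ga: "csum G {m..} = csum (\<lambda>n. ennreal (a n)) {m..}"
  proof (rule csum_cong)
    fix n assume "n \<in> {m..}"
    then have "r n < \<epsilon>" using m by simp
    then show "G n = ennreal (a n)" using dn[OF r(1)] by (simp add: G_def a_def min_absorb1)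
  qed
  have mP: "{m..} \<subseteq> P" unfolding P_def using m \<phi>(2) by (auto intro: order_trans[OF less_imp_le])
  have suma: "csum (\<lambda>n. ennreal (a n)) UNIV = (\<Sum>n. ennreal (a n))"
    by (simp add: csum_count_space nn_integral_count_space_nat)
  show ?thesis
  proof (intro iffI notI)
    assume top: "(\<integral>\<^sup>+t. indicator {0<..1} t * dnorm d g (ennreal t) \<partial>nr r) = top"
      and "summable (\<lambda>n. \<phi> (min (r n) \<epsilon>))"
    then have "(\<Sum>n. ennreal (a n)) \<noteq> top"
      using a by (intro ennreal_suminf_neq_top) (auto simp: a_def less_imp_le)
    then have "csum (\<lambda>n. ennreal (a n)) UNIV < top" by (simp only: suma less_top)
    from order_le_less_trans[OF csum_mono_set[OF subset_UNIV] this]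
    have "csum G {m..} < top" unfolding Ga .
    moreover have "csum G (P \<inter> {..<m}) < top"
      using Gfin by (simp add: csum_finite)
    moreover have "csum G P \<le> csum G (P \<inter> {..<m}) + csum G {m..}"
      by (rule order_trans[OF csum_mono_set csum_Un_le]) auto
    ultimately show False using top int by (auto simp: top_unique)
  next
    assume ns: "\<not> summable (\<lambda>n. \<phi> (min (r n) \<epsilon>))"
    have S: "(\<Sum>n. ennreal (a n)) = top"
    proof (rule ccontr)
      assume "(\<Sum>n. ennreal (a n)) \<noteq> top"
      then have "summable a" using a by (intro summable_suminf_not_top) (auto simp: less_imp_le)
      then show False using ns by (simp add: a_def[abs_def])
    qed
    have "csum (\<lambda>n. ennreal (a n)) UNIV \<le> csum (\<lambda>n. ennreal (a n)) {..<m} + csum (\<lambda>n. ennreal (a n)) {m..}"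
      by (rule order_trans[OF csum_mono_set csum_Un_le]) auto
    then have "csum (\<lambda>n. ennreal (a n)) {..<m} + csum (\<lambda>n. ennreal (a n)) {m..} = top"
      by (simp only: suma S top_unique)
    moreover have "csum (\<lambda>n. ennreal (a n)) {..<m} < top"
      by (subst csum_finite) auto
    ultimately have "csum (\<lambda>n. ennreal (a n)) {m..} = top"
      by (metis ennreal_add_eq_top less_irrefl)
    then have "csum G P = top" using csum_mono_set[OF mP, of G] Ga by (simp add: top_unique)
    then show "(\<integral>\<^sup>+t. indicator {0<..1} t * dnorm d g (ennreal t) \<partial>nr r) = top" using int by simp
  qed
qed

text \<open>As r n tends to 0, only finitely many atoms lie above any \<rho> > 0 while infinitely
  many lie in (0,1].\<close>

lemma Rd_nr:
  assumes r: "\<And>n. 0 < r n" "r \<longlonglongrightarrow> 0" and sm: "summable (\<lambda>n. r n ^ d)"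
  shows "Rd d (nr r)"
proof -
  have fin: "finite {n. \<rho> \<le> r n}" if "\<rho> > 0" for \<rho>
  proof -
    have "\<forall>\<^sub>F n in sequentially. r n < \<rho>" using r(2) that by (rule order_tendstoD)
    then obtain m where m: "\<And>n. n \<ge> m \<Longrightarrow> r n < \<rho>" by (auto simp: eventually_sequentially)
    have "{n. \<rho> \<le> r n} \<subseteq> {..<m}" using m by (auto simp: not_le[symmetric])
    then show ?thesis by (rule finite_subset) simp
  qed
  have inf: "infinite {n. r n \<le> 1}"
  proof
    assume "finite {n. r n \<le> 1}"
    moreover have "finite {n. 1 \<le> r n}" using fin by simp
    ultimately have "finite ({n. r n \<le> 1} \<union> {n. 1 \<le> r n})" by simp
    moreover have "{n. r n \<le> 1} \<union> {n. 1 \<le> r n} = UNIV" by auto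
    ultimately show False by simp
  qed
  have em: "emeasure (nr r) A = emeasure (count_space {n. r n \<le> 1}) {n. r n \<le> 1 \<and> r n \<in> A}" if "A \<in> sets borel" for A
    unfolding nr_def using that by (subst emeasure_distr) (auto intro!: arg_cong2[where f = emeasure])
  have "(\<integral>\<^sup>+ t. indicator {0<..1} t * ennreal (t ^ d) \<partial>nr r) = csum (\<lambda>n. ennreal (r n ^ d)) {n. r n \<le> 1}"
    by (rule nn_integral_nr[OF _ r(1)]) measurable
  also have "\<dots> \<le> csum (\<lambda>n. ennreal (r n ^ d)) UNIV" by (rule csum_mono_set) simp
  also have "\<dots> = (\<Sum>n. ennreal (r n ^ d))"
    by (simp add: csum_count_space nn_integral_count_space_nat)
  also have "\<dots> < top"
    unfolding less_top[symmetric] using r(1) by (intro ennreal_suminf_neq_top[OF sm]) (simp add: less_imp_le)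
  finally have int: "(\<integral>\<^sup>+ t. indicator {0<..1} t * ennreal (t ^ d) \<partial>nr r) < top" .
  show ?thesis
    unfolding Rd_def
  proof (intro conjI ballI int)
    show "sets (nr r) = sets borel" by (simp add: nr_def)
    have "{n. r n \<le> 1 \<and> r n \<in> - {0<..1}} = {}" using r(1) by auto
    with em[of "- {0<..1}"] show "emeasure (nr r) (- {0<..1}) = 0" by (simp only:) simp
    have "{n. r n \<le> 1 \<and> r n \<in> {0<..1}} = {n. r n \<le> 1}" using r(1) by auto
    with em[of "{0<..1}"] show "emeasure (nr r) {0<..1} = top"
      using inf by (simp only:) (simp add: emeasure_count_space)
    fix \<rho> :: real assume "\<rho> \<in> {0<..1}"
    then have "finite {n. r n \<le> 1 \<and> r n \<in> {\<rho>..1}}"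
      by (intro finite_subset[OF _ fin[of \<rho>]]) auto
    then have "emeasure (count_space {n. r n \<le> 1}) {n. r n \<le> 1 \<and> r n \<in> {\<rho>..1}} < top"
      by (subst emeasure_count_space_finite) (auto simp: ennreal_of_nat_eq_real_of_nat)
    then show "emeasure (nr r) {\<rho>..1} < top" by (subst em) simp_all
  qed
qed

context euclidean_norm
begin

section \<open>Lebesgue measure and the two describability cases\<close>

lemma limsup_balls_borel [measurable]: "limsup_balls x r \<in> sets borel"
  unfolding limsup_balls_eq by measurable

lemma gdelta_limsup_balls: "gdelta (limsup_balls x r)"
  unfolding gdelta_def limsup_balls_eq by (intro exI[of _ "\<lambda>m. \<Union>n\<in>{m..}. nball (x n) (r n)"]) auto

lemma emeasure_limsup_balls_eq_0:
  assumes r: "\<And>n. 0 < r n" and sm: "summable (\<lambda>n. r n ^ DIM('a))"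
  shows "emeasure lborel (limsup_balls x r) = 0"
proof -
  have "emeasure lborel (limsup_balls x r) \<le> 0 + ennreal e" if e: "e > 0" for e
  proof -
    have "e / vN > 0" using e by simp
    then obtain m where m: "norm (\<Sum>i. r (i + m) ^ DIM('a)) < e / vN"
      using suminf_exist_split[OF _ sm] by blast
    have smm: "summable (\<lambda>n. r (n + m) ^ DIM('a))"
      using sm by (simp add: summable_iff_shift[of "\<lambda>n. r n ^ DIM('a)"])
    have "limsup_balls x r \<subseteq> (\<Union>n. nball (x (n + m)) (r (n + m)))"
    proof
      fix y assume "y \<in> limsup_balls x r"
      then obtain n where "n \<ge> m" "y \<in> nball (x n) (r n)" unfolding limsup_balls_eq by blast
      then show "y \<in> (\<Union>n. nball (x (n + m)) (r (n + m)))" by (intro UN_I[of "n - m"]) auto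
    qed
    then have "emeasure lborel (limsup_balls x r) \<le> emeasure lborel (\<Union>n. nball (x (n + m)) (r (n + m)))"
      by (intro emeasure_mono) auto
    also have "\<dots> \<le> (\<Sum>n. emeasure lborel (nball (x (n + m)) (r (n + m))))"
      by (intro emeasure_subadditive_countably) auto
    also have "\<dots> = (\<Sum>n. ennreal (vN * r (n + m) ^ DIM('a)))"
      using r by (simp add: emeasure_nball)
    also have "\<dots> = ennreal (vN * (\<Sum>n. r (n + m) ^ DIM('a)))"
      using r vN_pos by (intro suminf_ennreal_eq sums_mult summable_sums smm) (simp add: less_imp_le)
    also have "\<dots> \<le> ennreal e"
    proof (rule ennreal_leI)
      have "(\<Sum>n. r (n + m) ^ DIM('a)) < e / vN" using m by (simp add: abs_less_iff)
      then show "vN * (\<Sum>n. r (n + m) ^ DIM('a)) \<le> e" using vN_pos by (simp add: field_simps)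
    qed
    finally show ?thesis by simp
  qed
  then have "emeasure lborel (limsup_balls x r) \<le> 0" by (rule ennreal_le_epsilon)
  then show ?thesis by simp
qed

text \<open>Eutaxy concerns radii tending to 0 only. If r has a positive limit, smaller radii in
  \<open>Pd\<close> are substituted, which can only shrink the limsup set.\<close>

lemma limsup_balls_full:
  assumes x: "uniformly_eutaxic N U x" and r: "decseq r" "\<And>n. 0 < r n"
    and ns: "\<not> summable (\<lambda>n. r n ^ DIM('a))" and U: "open U"
  shows "emeasure lborel (U - limsup_balls x r) = 0"
proof -
  let ?d = "DIM('a)"
  obtain s where s: "s \<in> Pd ?d" "\<And>n. s n \<le> r n"
  proof (cases "r \<longlonglongrightarrow> 0")
    case True
    then show ?thesis using that[of r] r ns by (simp add: Pd_def)
  next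
    case False
    obtain l where l: "r \<longlonglongrightarrow> l" "\<And>n. l \<le> r n"
      using decseq_convergent[OF r(1), of 0] r(2) less_imp_le by metis
    have "0 \<le> l" by (rule LIMSEQ_le_const[OF l(1)]) (use r(2) less_imp_le in blast)
    then have lp: "l > 0" using False l(1) by (cases "l = 0") auto
    \<comment> \<open>These radii are l * (n+1)^(-1/d): they stay below l, tend to 0, and their d-th
      powers form a harmonic series.\<close>
    define s where "s n = root ?d (l ^ ?d * (1 / real (Suc n)))" for n
    have sd: "s n ^ ?d = l ^ ?d * (1 / real (Suc n))" for n
      unfolding s_def using lp by (intro real_root_pow_pos2) auto
    have "decseq s"
      unfolding s_def using lp by (intro decseq_SucI real_root_le_mono mult_left_mono) (auto simp: frac_le)
    moreover have "(\<lambda>n. root ?d (l ^ ?d * (1 / real (Suc n)))) \<longlonglongrightarrow> root ?d (l ^ ?d * 0)"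
      by (intro tendsto_intros LIMSEQ_Suc[OF lim_1_over_n])
    then have "s \<longlonglongrightarrow> 0" by (simp add: s_def[abs_def])
    moreover have "\<not> summable (\<lambda>n. s n ^ ?d)"
    proof
      assume "summable (\<lambda>n. s n ^ ?d)"
      then have "summable (\<lambda>n. l ^ ?d * (1 / real (Suc n)))" by (simp only: sd)
      then have "summable (\<lambda>n. 1 / real (Suc n))" using lp by (subst (asm) summable_cmult_iff) auto
      then have "summable (\<lambda>n. inverse (real n))"
        using summable_Suc_iff[of "\<lambda>n. inverse (real n)"] by (simp add: inverse_eq_divide)
      then show False using not_summable_harmonic[where 'a = real] by simp
    qed
    ultimately have "s \<in> Pd ?d" by (simp add: Pd_def)
    moreover have "s n \<le> r n" for n
    proof -
      have "l ^ ?d * (1 / real (Suc n)) \<le> l ^ ?d * 1" using lp by (intro mult_left_mono) auto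
      then have "s n \<le> root ?d (l ^ ?d)" unfolding s_def by (intro real_root_le_mono) auto
      also have "\<dots> = l" using lp by (intro real_root_power_cancel) auto
      finally show ?thesis using l(2)[of n] by simp
    qed
    ultimately show ?thesis by (rule that)
  qed
  have "AE y in lborel. y \<in> U \<longrightarrow> infinite {n. N (y - x n) < s n}"
    using x s(1) by (auto simp: uniformly_eutaxic_def)
  then have "AE y in lborel. y \<notin> U - limsup_balls x r"
  proof eventually_elim
    case (elim y)
    have "{n. N (y - x n) < s n} \<subseteq> {n. N (y - x n) < r n}" using s(2) order_less_le_trans by blast
    then show ?case using elim infinite_super by (auto simp: limsup_balls_def)
  qed
  moreover have eq: "{y \<in> space lborel. \<not> y \<notin> U - limsup_balls x r} = U - limsup_balls x r" by auto
  have "U - limsup_balls x r \<in> sets lborel" using U by auto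
  note AE_iff_measurable[OF this eq]
  ultimately show ?thesis by (simp only:)
qed

text \<open>A null measure would give arbitrarily cheap dyadic covers by cubes at most half the size
  of a fixed cube in U. None of them can swallow that cube, so its subcubes alone cover the limsup
  set in it, which has a fixed positive cost.\<close>

lemma hausdorff_limsup_pos:
  assumes U: "open U" "U \<noteq> {}" and x: "uniformly_eutaxic N U x"
    and r: "decseq r" "\<And>n. 0 < r n" "r \<longlonglongrightarrow> 0"
    and \<phi>: "dim_gauge DIM('a) \<phi> \<epsilon>" "\<not> summable (\<lambda>n. \<phi> (min (r n) \<epsilon>))"
    and g: "\<And>t. 0 < t \<Longrightarrow> t \<le> \<epsilon> \<Longrightarrow> ennreal (\<phi> t) \<le> g (ennreal t)"
  shows "hausdorff_g N g (limsup_balls x r \<inter> U) \<noteq> 0"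
proof
  assume H: "hausdorff_g N g (limsup_balls x r \<inter> U) = 0"
  obtain j y where j: "dcube j y \<subseteq> U" "cube_diam j \<le> \<epsilon>"
    by (rule open_small_cube[OF U dim_gaugeD(1)[OF \<phi>(1)]]) (rule that)
  let ?D = "cube_diam j"
  have D: "0 < ?D / 2" by simp
  show False
  proof (rule limsup_content[OF \<phi>(1) x r \<phi>(2)])
    fix c :: real
    assume c: "0 < c" and content: "\<And>j y C. dcube j y \<subseteq> U \<Longrightarrow> cube_diam j \<le> \<epsilon> \<Longrightarrow>
      C \<subseteq> dyadic_cubes \<Longrightarrow> (\<And>p. p \<in> C \<Longrightarrow> p \<subseteq> dcube j y) \<Longrightarrow> limsup_balls x r \<inter> dcube j y \<subseteq> \<Union>C \<Longrightarrow>
      ennreal c * wt \<phi> (dcube j y) \<le> csum (wt \<phi>) C"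
    have "ennreal c * wt \<phi> (dcube j y) \<le> 0 + ennreal e" if e: "e > 0" for e
    proof -
      obtain C where C: "C \<subseteq> dyadic_cubes" "limsup_balls x r \<inter> U \<subseteq> \<Union>C"
        "\<And>p. p \<in> C \<Longrightarrow> ediam N p \<le> ennreal (?D / 2)" "csum (wt \<phi>) C \<le> ennreal e"
        by (rule hausdorff_to_cubes[OF H \<phi>(1) g D e]) (assumption+, rule that)
      define C' where "C' = {p \<in> C. p \<subseteq> dcube j y}"
      have cov: "limsup_balls x r \<inter> dcube j y \<subseteq> \<Union>C'"
      proof
        fix z assume z: "z \<in> limsup_balls x r \<inter> dcube j y"
        then obtain p where p: "p \<in> C" "z \<in> p" using C(2) j(1) by blast
        have "\<not> dcube j y \<subseteq> p"
        proof
          assume "dcube j y \<subseteq> p"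
          then have "ediam N (dcube j y) \<le> ediam N p"
            unfolding ediam_def by (intro SUP_subset_mono) auto
          then have "ennreal ?D \<le> ennreal (?D / 2)"
            using C(3)[OF p(1)] unfolding ediam_dcube by (rule order_trans)
          then have "?D \<le> ?D / 2" by (subst (asm) ennreal_le_iff) (use D in linarith)+
          then show False using D by linarith
        qed
        then have "p \<subseteq> dcube j y"
          using dyadic_trichotomy[of p "dcube j y"] p z C(1) by auto
        then show "z \<in> \<Union>C'" using p by (auto simp: C'_def)
      qed
      have "ennreal c * wt \<phi> (dcube j y) \<le> csum (wt \<phi>) C'"
        using C(1) by (intro content[OF j _ _ cov]) (auto simp: C'_def)
      also have "\<dots> \<le> csum (wt \<phi>) C" by (rule csum_mono_set) (auto simp: C'_def)
      also note C(4)
      finally show ?thesis by simp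
    qed
    then have "ennreal c * wt \<phi> (dcube j y) \<le> 0" by (rule ennreal_le_epsilon)
    moreover have "0 < ennreal c * wt \<phi> (dcube j y)"
      using c dim_gaugeD(2)[OF \<phi>(1) _ j(2)] by (simp add: ennreal_zero_less_mult_iff)
    ultimately show False by (meson leD)
  qed
qed

text \<open>Every tested h dominates g_d near 0 and inherits both the infinite \<open>ell\<close>
  and the divergence of the sum, so the content equality is applied to the profile of h.\<close>

lemma limsup_in_large_int_class:
  assumes x: "uniformly_eutaxic N U x" and r: "decseq r" "\<And>n. 0 < r n" "r \<longlonglongrightarrow> 0"
    and g: "gauge g" "ell DIM('a) g = top"
    and \<phi>: "dim_gauge DIM('a) \<phi> \<epsilon>" "\<not> summable (\<lambda>n. \<phi> (min (r n) \<epsilon>))"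
    and dn: "\<And>t. 0 < t \<Longrightarrow> t \<le> \<epsilon> \<Longrightarrow> dnorm DIM('a) g (ennreal t) = ennreal (\<phi> t)"
  shows "limsup_balls x r \<in> large_int_class N g U"
proof -
  have "M_inf DIM('a) N h (limsup_balls x r \<inter> V) = M_inf DIM('a) N h V"
    if h: "gauge h" "d_normalized DIM('a) h" "gprec h (dnorm DIM('a) g)" and V: "open V" "V \<subseteq> U" for h V
  proof -
    obtain e where e: "0 < e" "\<And>t. 0 < t \<Longrightarrow> t \<le> e \<Longrightarrow> dnorm DIM('a) g (ennreal t) \<le> h (ennreal t)"
      by (rule gprec_imp_ge[OF g h(3)]) (rule that)
    have "0 < min e \<epsilon>" using e(1) dim_gaugeD(1)[OF \<phi>(1)] by simp
    then obtain \<phi>' \<epsilon>' where \<phi>': "dim_gauge DIM('a) \<phi>' \<epsilon>'" "\<epsilon>' \<le> min e \<epsilon>"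
      "\<And>t. 0 < t \<Longrightarrow> t \<le> \<epsilon>' \<Longrightarrow> h (ennreal t) = ennreal (\<phi>' t)" "ennreal \<epsilon>' \<le> eps_h DIM('a) h"
      by (rule d_normalized_profile[OF h(1) gprec_ell_top[OF g h(3)] h(2)]) (rule that)
    have le: "\<phi> t \<le> \<phi>' t" if "0 < t" "t \<le> \<epsilon>'" for t
      using e(2)[of t] dn[of t] \<phi>'(2) \<phi>'(3)[OF that] that dim_gaugeD(2)[OF \<phi>'(1) that]
      by (simp add: ennreal_le_iff)
    have "\<not> summable (\<lambda>n. \<phi>' (min (r n) \<epsilon>'))"
    proof
      assume "summable (\<lambda>n. \<phi>' (min (r n) \<epsilon>'))"
      moreover have "\<forall>\<^sub>F n in sequentially. r n < \<epsilon>'"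
        using r(3) dim_gaugeD(1)[OF \<phi>'(1)] by (rule order_tendstoD)
      then have "\<forall>\<^sub>F n in sequentially. norm (\<phi> (min (r n) \<epsilon>)) \<le> \<phi>' (min (r n) \<epsilon>')"
      proof eventually_elim
        case (elim n)
        have "0 < \<phi> (r n)" using elim \<phi>'(2) r(2)[of n] by (intro dim_gaugeD(2)[OF \<phi>(1)]) auto
        then show ?case using elim \<phi>'(2) le[OF r(2)[of n]] by (simp add: min_absorb1)
      qed
      ultimately have "summable (\<lambda>n. \<phi> (min (r n) \<epsilon>))" by (rule summable_comparison_test_ev[rotated])
      then show False using \<phi>(2) by simp
    qed
    then show ?thesis by (intro M_inf_limsup[OF x r \<phi>'(1) _ \<phi>'(3,4) V])
  qed
  then show ?thesis unfolding large_int_class_def using gdelta_limsup_balls by auto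
qed

text \<open>The slowly modified gauge h precedes g_d and still has a convergent sum. The limsup set
  is then null for h, so its content vanishes, while membership of F would give F Int U the positive
  content of U.\<close>

lemma no_large_subset:
  assumes U: "open U" "U \<noteq> {}" and r: "\<And>n. 0 < r n" "r \<longlonglongrightarrow> 0"
    and g: "gauge g" "ell DIM('a) g = top"
    and \<phi>: "dim_gauge DIM('a) \<phi> \<epsilon>" "summable (\<lambda>n. \<phi> (min (r n) \<epsilon>))"
    and dn: "\<And>t. 0 < t \<Longrightarrow> t \<le> \<epsilon> \<Longrightarrow> dnorm DIM('a) g (ennreal t) = ennreal (\<phi> t)"
    and F: "F \<in> large_int_class N g U" "F \<subseteq> limsup_balls x r"
  shows False
proof -
  let ?d = "DIM('a)"
  define s where "s n = min (r n) \<epsilon>" for n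
  have s: "0 < s n" "s n \<le> \<epsilon>" for n using r(1)[of n] dim_gaugeD(1)[OF \<phi>(1)] by (auto simp: s_def)
  have a: "0 < \<phi> (s n)" for n by (rule dim_gaugeD(2)[OF \<phi>(1) s])
  have sm: "summable (\<lambda>n. \<phi> (s n))" using \<phi>(2) by (simp add: s_def)
  obtain \<psi> :: "real \<Rightarrow> real" where \<psi>: "\<And>t. 0 < t \<Longrightarrow> 0 < \<psi> t" "\<And>s t. 0 < s \<Longrightarrow> s \<le> t \<Longrightarrow> \<psi> s \<le> \<psi> t"
    "\<And>s t. 0 < s \<Longrightarrow> s \<le> t \<Longrightarrow> \<psi> t * s \<le> \<psi> s * t"
    "filterlim (\<lambda>t. \<psi> t / t) at_top (at_right 0)" "summable (\<lambda>n. \<psi> (\<phi> (s n)))"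
    by (rule slow_modification[OF a sm]) (rule that)
  let ?\<phi> = "\<lambda>t. \<psi> (\<phi> t)"
  define h where "h = gauge_of ?\<phi> \<epsilon>"
  have \<psi>\<phi>: "dim_gauge ?d ?\<phi> \<epsilon>" by (rule dim_gauge_slow_modification[OF \<phi>(1) s \<psi>])
  have h: "gauge h" "d_normalized ?d h" "gprec h (dnorm ?d g)"
    unfolding h_def
    by (rule gauge_gauge_of[OF \<psi>\<phi>] d_normalized_gauge_of[OF \<psi>\<phi>] gprec_gauge_of[OF \<phi>(1) dn \<psi>(1,3,4)]; assumption)+
  obtain \<phi>' \<epsilon>' where \<phi>': "dim_gauge ?d \<phi>' \<epsilon>'" "\<epsilon>' \<le> 1"
    "\<And>t. 0 < t \<Longrightarrow> t \<le> \<epsilon>' \<Longrightarrow> h (ennreal t) = ennreal (\<phi>' t)" "ennreal \<epsilon>' \<le> eps_h ?d h"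
    by (rule d_normalized_profile[OF h(1) gprec_ell_top[OF g h(3)] h(2) zero_less_one]) (rule that)
  have "hausdorff_g N h (limsup_balls x r) = 0"
  proof (rule hausdorff_limsup_zero[OF _ _ dim_gaugeD(1)[OF \<phi>(1)] _ r])
    show "mono_on {0..ennreal \<epsilon>} h" "h 0 = 0" unfolding h_def by (rule gauge_of_mono_on[OF \<psi>\<phi>]) simp
    show "dnorm ?d h (ennreal t) = ennreal (?\<phi> t) \<and> 0 \<le> ?\<phi> t" if "0 < t" "t \<le> \<epsilon>" for t
      unfolding h_def using dnorm_gauge_of[OF \<psi>\<phi> that] dim_gaugeD(2)[OF \<psi>\<phi> that] by simp
    show "summable (\<lambda>n. ?\<phi> (min (r n) \<epsilon>))" using \<psi>(5) by (simp add: s_def)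
  qed
  then have "M_inf ?d N h (limsup_balls x r) = 0" by (rule M_inf_zero[OF _ \<phi>'(1,3,4)])
  moreover have "M_inf ?d N h (F \<inter> U) = M_inf ?d N h U"
    using F(1) h U(1) by (auto simp: large_int_class_def)
  moreover have "M_inf ?d N h (F \<inter> U) \<le> M_inf ?d N h (limsup_balls x r)"
    using F(2) by (intro M_inf_mono) auto
  moreover have "0 < M_inf ?d N h U" by (rule M_inf_open_pos[OF U \<phi>'(1,3)])
  ultimately show False by simp
qed

text \<open>Both the majorizing and the minorizing collection are decided by the same dichotomy,
  convergence or divergence of the sum of the profile of g_d over r_n, which
  \<open>integral_dnorm_nr\<close> identifies with membership in \<open>Gn\<close>.\<close>

lemma describable_limsup_balls:
  assumes U: "open U" "U \<noteq> {}" and x: "uniformly_eutaxic N U x"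
    and r: "decseq r" "\<And>n. 0 < r n" and sm: "summable (\<lambda>n. r n ^ DIM('a))"
  shows "describable N (nr r) (limsup_balls x r) U"
proof -
  let ?d = "DIM('a)" and ?F = "limsup_balls x r"
  have "(\<lambda>n. root ?d (r n ^ ?d)) \<longlonglongrightarrow> root ?d 0"
    by (intro tendsto_real_root summable_LIMSEQ_zero sm)
  then have r0: "r \<longlonglongrightarrow> 0"
    using r(2) by (simp add: real_root_power_cancel less_imp_le)
  have Z: "?F \<in> Zset U"
  proof -
    have "emeasure lborel (?F \<inter> U) \<le> emeasure lborel ?F" by (intro emeasure_mono) auto
    then show ?thesis using emeasure_limsup_balls_eq_0[OF r(2) sm, of x] by (simp add: Zset_def)
  qed
  have key: "(hausdorff_g N g (?F \<inter> U) = 0 \<longleftrightarrow> g \<notin> Gn ?d (nr r)) \<and>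
      ((\<exists>F\<in>large_int_class N g U. F \<subseteq> ?F) \<longleftrightarrow> g \<in> Gn ?d (nr r))" if G: "g \<in> Gauges_inf ?d" for g
  proof -
    have g: "gauge g" "ell ?d g = top" using G by (auto simp: Gauges_inf_def)
    obtain \<phi> \<epsilon> where \<phi>: "dim_gauge ?d \<phi> \<epsilon>" "\<epsilon> \<le> 1"
      "\<And>t. 0 < t \<Longrightarrow> t \<le> \<epsilon> \<Longrightarrow> dnorm ?d g (ennreal t) = ennreal (\<phi> t)" "mono_on {0..ennreal \<epsilon>} g"
      by (rule gauge_profile[OF g zero_less_one]) (rule that)
    have Gn: "g \<in> Gn ?d (nr r) \<longleftrightarrow> \<not> summable (\<lambda>n. \<phi> (min (r n) \<epsilon>))"
      using integral_dnorm_nr[OF r(2) r0 g(1) \<phi>(1-3)] G by (simp add: Gn_def)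
    show ?thesis
    proof (cases "summable (\<lambda>n. \<phi> (min (r n) \<epsilon>))")
      case True
      have "hausdorff_g N g ?F = 0"
        using g(1) \<phi>(3) dim_gaugeD(1,2)[OF \<phi>(1)] True
        by (intro hausdorff_limsup_zero[OF \<phi>(4) _ _ _ r(2) r0]) (auto simp: gauge_def less_imp_le)
      then have "hausdorff_g N g (?F \<inter> U) = 0"
        using hausdorff_mono[of "?F \<inter> U" ?F g] by simp
      moreover have "\<not> (\<exists>F\<in>large_int_class N g U. F \<subseteq> ?F)"
        using no_large_subset[OF U r(2) r0 g \<phi>(1) True \<phi>(3)] by blast
      ultimately show ?thesis using Gn True by simp
    next
      case False
      have ge: "ennreal (\<phi> t) \<le> g (ennreal t)" if "0 < t" "t \<le> \<epsilon>" for t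
        using \<phi>(3)[OF that] dnorm_le[OF that(1), of ?d g] by simp
      have "hausdorff_g N g (?F \<inter> U) \<noteq> 0"
        by (rule hausdorff_limsup_pos[OF U x r r0 \<phi>(1) False ge])
      moreover have "?F \<in> large_int_class N g U"
        by (rule limsup_in_large_int_class[OF x r r0 g \<phi>(1) False \<phi>(3)])
      ultimately show ?thesis using Gn False by auto
    qed
  qed
  have "Gauges_inf ?d \<subseteq> Gauges_star ?d" by (auto simp: Gauges_inf_def Gauges_star_def)
  moreover have "Gn ?d (nr r) \<subseteq> Gauges_inf ?d" by (auto simp: Gn_def)
  ultimately have "majorizing N ?F U = Gauges_inf ?d - Gn ?d (nr r)"
    "minorizing N ?F U \<inter> Gauges_inf ?d = Gn ?d (nr r)"
    using key unfolding majorizing_def minorizing_def by blast+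
  then show ?thesis
    unfolding describable_def using Rd_nr[OF r(2) r0 sm] Z by simp
qed

end

theorem theorem8p7:
  fixes N :: "'a::euclidean_space \<Rightarrow> real" and U :: "'a set"
    and x :: "nat \<Rightarrow> 'a" and r :: "nat \<Rightarrow> real"
  assumes "is_norm N" and "open U" and "U \<noteq> {}"
    and "uniformly_eutaxic N U x"
    and "decseq r" and "\<forall>n. 0 < r n"
  shows "(\<not> summable (\<lambda>n. r n ^ DIM('a)) \<longrightarrow>
            emeasure lborel (U - {y. infinite {n. N (y - x n) < r n}}) = 0)
       \<and> (summable (\<lambda>n. r n ^ DIM('a)) \<longrightarrow>
            describable N (nr r) {y. infinite {n. N (y - x n) < r n}} U)"
proof -
  interpret euclidean_norm N by unfold_locales (rule assms(1))
  show ?thesis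
    using limsup_balls_full[of U x r] describable_limsup_balls[of U x r] assms(2-6)
    by (simp add: limsup_balls_def)
qed

end
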